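(* For any fixed $g\in\mathbb{N}$, deciding whether a $g$-bounded TS $A$ is $\tau$-solvable is polynomial if one of the following holds: (1) $\tau\in\{\{\mathsf{nop},\mathsf{inp},\mathsf{free}\},\{\mathsf{nop},\mathsf{inp},\mathsf{used},\mathsf{free}\},\{\mathsf{nop},\mathsf{out},\mathsf{used}\},\{\mathsf{nop},\mathsf{out},\mathsf{used},\mathsf{free}\}\}$ and $g<2$; (2) $\tau=\{\mathsf{nop},\mathsf{set},\mathsf{res}\}\cup\omega$ with $\emptyset\neq\omega\subseteq\{\mathsf{used},\mathsf{free}\}$ and $g<3$; (3) $\tau=\tau'\cup\omega$ with $\tau'\in\{\{\mathsf{nop},\mathsf{set},\mathsf{swap}\},\{\mathsf{nop},\mathsf{res},\mathsf{swap}\},\{\mathsf{nop},\mathsf{res},\mathsf{set},\mathsf{swap}\}\}$ and $\emptyset\neq\omega\subseteq\{\mathsf{used},\mathsf{free}\}$ and $g<2$; (4) $\tau\in\{\{\mathsf{nop},\mathsf{inp}\},\{\mathsf{nop},\mathsf{inp},\mathsf{used}\},\{\mathsf{nop},\mathsf{out}\},\{\mathsf{nop},\mathsf{out},\mathsf{free}\}\}$ or $\tau\in\{\{\mathsf{nop},\mathsf{set},\mathsf{swap}\},\{\mathsf{nop},\mathsf{res},\mathsf{swap}\},\{\mathsf{nop},\mathsf{set},\mathsf{res}\},\{\mathsf{nop},\mathsf{set},\mathsf{res},\mathsf{swap}\}\}$ (any $g$).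
   Context: A transition system (TS) $A=(S,E,\delta,s_0)$ is a directed labeled graph with states $S$, events $E$, a partial (deterministic) transition function $\delta:S\times E\to S$ and an initial state $s_0$ from which every state is reachable. For $g\in\mathbb{N}$, $A$ is $g$-bounded if every state has at most $g$ incoming and at most $g$ outgoing arcs. The Boolean interactions are the partial functions $\{0,1\}\to\{0,1\}$: $\mathsf{nop}$ ($0\mapsto0,1\mapsto1$), $\mathsf{inp}$ ($1\mapsto0$, undefined on $0$), $\mathsf{out}$ ($0\mapsto1$, undefined on $1$), $\mathsf{set}$ ($0,1\mapsto1$), $\mathsf{res}$ ($0,1\mapsto0$), $\mathsf{swap}$ ($0\mapsto1,1\mapsto0$), $\mathsf{used}$ ($1\mapsto1$, undefined on $0$), $\mathsf{free}$ ($0\mapsto0$, undefined on $1$). A Boolean type of net is a subset $\tau$ of these interactions. A $\tau$-net $N=(P,T,M_0,f)$ has places $P$, transitions $T$, initial marking $M_0:P\to\{0,1\}$ and flow $f:P\times T\to\tau$; a transition $t$ fires in marking $M$ iff $f(p,t)(M(p))$ is defined for all $p$, producing $M'(p)=f(p,t)(M(p))$. A TS $A$ is $\tau$-solvable if it is isomorphic to the reachability graph of some $\tau$-net. *)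

theory Defs
  imports "HOL-Computational_Algebra.Polynomial"
begin

section \<open>Transition systems\<close>

record ('s, 'e) ts =
  states :: "'s set"
  events :: "'e set"
  delta :: "'s \<Rightarrow> 'e \<Rightarrow> 's option"
  init :: 's

inductive reachable :: "('s \<Rightarrow> 'e \<Rightarrow> 's option) \<Rightarrow> 's \<Rightarrow> 's \<Rightarrow> bool"
  for d :: "'s \<Rightarrow> 'e \<Rightarrow> 's option" and s0 :: 's where
  start: "reachable d s0 s0"
| step: "reachable d s0 s \<Longrightarrow> d s e = Some s' \<Longrightarrow> reachable d s0 s'"

text \<open>Finiteness is part of the notion, since transition systems are inputs of algorithms.
  An event need not occur on any arc.\<close>

definition is_ts :: "('s, 'e) ts \<Rightarrow> bool" where
  "is_ts A \<longleftrightarrow>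
     finite (states A) \<and> finite (events A) \<and> init A \<in> states A \<and>
     (\<forall>s e s'. delta A s e = Some s' \<longrightarrow> s \<in> states A \<and> e \<in> events A \<and> s' \<in> states A) \<and>
     (\<forall>s \<in> states A. reachable (delta A) (init A) s)"

definition g_bounded :: "nat \<Rightarrow> ('s, 'e) ts \<Rightarrow> bool" where
  "g_bounded g A \<longleftrightarrow> (\<forall>s \<in> states A.
     card {(s', e). delta A s' e = Some s} \<le> g \<and>
     card {(e, s'). delta A s e = Some s'} \<le> g)"

text \<open>Both systems carry the same event labels, so an isomorphism only renames states.\<close>

definition isomorphic :: "('s, 'e) ts \<Rightarrow> ('t, 'e) ts \<Rightarrow> bool" where
  "isomorphic A B \<longleftrightarrow> events A = events B \<and>
     (\<exists>\<phi>. bij_betw \<phi> (states A) (states B) \<and> \<phi> (init A) = init B \<and>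
        (\<forall>s \<in> states A. \<forall>e \<in> events A. \<forall>s' \<in> states A.
           delta A s e = Some s' \<longleftrightarrow> delta B (\<phi> s) e = Some (\<phi> s')))"


section \<open>Boolean types of nets\<close>

text \<open>Interactions are partial functions on the Booleans; \<open>False\<close> is 0 and \<open>True\<close> is 1.\<close>

type_synonym interaction = "bool \<Rightarrow> bool option"

definition NOP :: interaction where "NOP b = Some b"
definition INP :: interaction where "INP b = (if b then Some False else None)"
definition OUT :: interaction where "OUT b = (if b then None else Some True)"
definition SET :: interaction where "SET b = Some True"
definition RES :: interaction where "RES b = Some False"
definition SWAP :: interaction where "SWAP b = Some (\<not> b)"
definition USED :: interaction where "USED b = (if b then Some True else None)"
definition FREE :: interaction where "FREE b = (if b then None else Some False)"

record ('p, 't) net =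
  places :: "'p set"
  transitions :: "'t set"
  marking0 :: "'p \<Rightarrow> bool"
  flow :: "'p \<Rightarrow> 't \<Rightarrow> interaction"

definition is_net :: "interaction set \<Rightarrow> ('p, 't) net \<Rightarrow> bool" where
  "is_net \<tau> N \<longleftrightarrow> finite (places N) \<and> finite (transitions N) \<and>
     (\<forall>p \<in> places N. \<forall>t \<in> transitions N. flow N p t \<in> \<tau>)"

text \<open>Markings are total functions whose values outside \<open>places N\<close> are never changed by
  firing. Two reachable markings are hence equal iff they agree on \<open>places N\<close>.\<close>

definition fire :: "('p, 't) net \<Rightarrow> ('p \<Rightarrow> bool) \<Rightarrow> 't \<Rightarrow> ('p \<Rightarrow> bool) option" where
  "fire N M t =
     (if t \<in> transitions N \<and> (\<forall>p \<in> places N. flow N p t (M p) \<noteq> None)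
      then Some (\<lambda>p. if p \<in> places N then the (flow N p t (M p)) else M p)
      else None)"

definition reachability_graph :: "('p, 't) net \<Rightarrow> ('p \<Rightarrow> bool, 't) ts" where
  "reachability_graph N =
     \<lparr> states = {M. reachable (fire N) (marking0 N) M},
       events = transitions N,
       delta = (\<lambda>M t. if reachable (fire N) (marking0 N) M then fire N M t else None),
       init = marking0 N \<rparr>"

text \<open>Place sets are finite, so taking places from \<open>nat\<close> is no restriction.\<close>

definition solvable :: "interaction set \<Rightarrow> ('s, 'e) ts \<Rightarrow> bool" where
  "solvable \<tau> A \<longleftrightarrow>
     (\<exists>N :: (nat, 'e) net. is_net \<tau> N \<and> isomorphic A (reachability_graph N))"


section \<open>Polynomial time\<close>

text \<open>The machine model is the WHILE language over binary trees (Jones, Computability and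
  Complexity from a Programming Perspective, 1997). An assignment is charged the size of the
  assigned value. The store therefore never outgrows the input by more than the elapsed time
  (lemma \<open>exec_size\<close> below), and since the expressions of a program have constant length, a
  Turing machine simulates a run of cost \<open>t\<close> on an input of size \<open>n\<close> in time polynomial in
  \<open>n + t\<close>. Conversely, a Turing machine tape is a pair of lists, whose single-cell updates cost
  at most the tape length. So \<open>in_P\<close> is the usual class P.

  The function \<open>size\<close> on \<open>tree\<close> counts inner nodes.\<close>

datatype tree = Leaf | Node tree tree

datatype exp = Var nat | Nil_exp | Cons_exp exp exp | Hd exp | Tl exp

datatype com = Skip | Assign nat exp | Seq com com | If exp com com | While exp com

type_synonym store = "nat \<Rightarrow> tree"

fun hd_tree :: "tree \<Rightarrow> tree" where
  "hd_tree Leaf = Leaf"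
| "hd_tree (Node l r) = l"

fun tl_tree :: "tree \<Rightarrow> tree" where
  "tl_tree Leaf = Leaf"
| "tl_tree (Node l r) = r"

fun val :: "exp \<Rightarrow> store \<Rightarrow> tree" where
  "val (Var x) \<sigma> = \<sigma> x"
| "val Nil_exp \<sigma> = Leaf"
| "val (Cons_exp a b) \<sigma> = Node (val a \<sigma>) (val b \<sigma>)"
| "val (Hd a) \<sigma> = hd_tree (val a \<sigma>)"
| "val (Tl a) \<sigma> = tl_tree (val a \<sigma>)"

text \<open>\<open>exec c \<sigma> t \<sigma>'\<close>: started in store \<open>\<sigma>\<close>, the command \<open>c\<close> terminates in store \<open>\<sigma>'\<close> after
  time \<open>t\<close>. A guard is true iff its value is not \<open>Leaf\<close>.\<close>

inductive exec :: "com \<Rightarrow> store \<Rightarrow> nat \<Rightarrow> store \<Rightarrow> bool" where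
  Skip: "exec Skip \<sigma> 1 \<sigma>"
| Assign: "exec (Assign x a) \<sigma> (Suc (size (val a \<sigma>))) (\<sigma>(x := val a \<sigma>))"
| Seq: "exec c1 \<sigma> t1 \<sigma>1 \<Longrightarrow> exec c2 \<sigma>1 t2 \<sigma>2 \<Longrightarrow> exec (Seq c1 c2) \<sigma> (t1 + t2) \<sigma>2"
| IfTrue: "val b \<sigma> \<noteq> Leaf \<Longrightarrow> exec c1 \<sigma> t \<sigma>' \<Longrightarrow> exec (If b c1 c2) \<sigma> (Suc t) \<sigma>'"
| IfFalse: "val b \<sigma> = Leaf \<Longrightarrow> exec c2 \<sigma> t \<sigma>' \<Longrightarrow> exec (If b c1 c2) \<sigma> (Suc t) \<sigma>'"
| WhileFalse: "val b \<sigma> = Leaf \<Longrightarrow> exec (While b c) \<sigma> 1 \<sigma>"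
| WhileTrue: "val b \<sigma> \<noteq> Leaf \<Longrightarrow> exec c \<sigma> t1 \<sigma>1 \<Longrightarrow> exec (While b c) \<sigma>1 t2 \<sigma>2 \<Longrightarrow>
    exec (While b c) \<sigma> (Suc (t1 + t2)) \<sigma>2"

inductive_cases exec_SkipE: "exec Skip \<sigma> t \<sigma>'"
inductive_cases exec_AssignE: "exec (Assign x a) \<sigma> t \<sigma>'"
inductive_cases exec_SeqE: "exec (Seq c1 c2) \<sigma> t \<sigma>'"
inductive_cases exec_IfE: "exec (If b c1 c2) \<sigma> t \<sigma>'"
inductive_cases exec_WhileE: "exec (While b c) \<sigma> t \<sigma>'"

lemma exec_deterministic:
  "exec c \<sigma> t \<sigma>' \<Longrightarrow> exec c \<sigma> u \<sigma>'' \<Longrightarrow> t = u \<and> \<sigma>' = \<sigma>''"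
proof (induction arbitrary: u \<sigma>'' rule: exec.induct)
  case Skip then show ?case by (auto elim: exec_SkipE)
next
  case Assign then show ?case by (auto elim: exec_AssignE)
next
  case Seq then show ?case by (blast elim: exec_SeqE)
next
  case IfTrue then show ?case by (blast elim: exec_IfE)
next
  case IfFalse then show ?case by (blast elim: exec_IfE)
next
  case WhileFalse from WhileFalse(2,1) show ?case by (auto elim: exec_WhileE)
next
  case (WhileTrue b \<sigma> c t1 \<sigma>1 t2 \<sigma>2)
  from WhileTrue.prems WhileTrue.hyps(1) obtain u1 \<rho> u2 where
    "exec c \<sigma> u1 \<rho>" "exec (While b c) \<rho> u2 \<sigma>''" "u = Suc (u1 + u2)"
    by (auto elim: exec_WhileE)
  with WhileTrue.IH show ?case by blast
qed

lemma exec_size: "exec c \<sigma> t \<sigma>' \<Longrightarrow> size (\<sigma>' x) \<le> size (\<sigma> x) + t"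
  by (induction rule: exec.induct) auto

text \<open>Input and output are passed in variable 0, all other variables initially hold \<open>Leaf\<close>.
  The input is accepted iff the output is not \<open>Leaf\<close>.\<close>

definition in_P :: "tree set \<Rightarrow> bool" where
  "in_P L \<longleftrightarrow> (\<exists>(c :: com) (q :: nat poly). \<forall>x. \<exists>t \<sigma>.
     exec c ((\<lambda>_. Leaf)(0 := x)) t \<sigma> \<and> t \<le> poly q (size x) \<and> (\<sigma> 0 \<noteq> Leaf \<longleftrightarrow> x \<in> L))"


section \<open>The synthesis problem\<close>

definition tree_of_list :: "tree list \<Rightarrow> tree" where
  "tree_of_list xs = foldr Node xs Leaf"

text \<open>States and events are named by arbitrary trees (for instance, lists of bits), and the
  names count towards the size of the input. The lists may be in any order and may contain
  repetitions.\<close>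

definition encodes :: "tree \<Rightarrow> (tree, tree) ts \<Rightarrow> bool" where
  "encodes x A \<longleftrightarrow> (\<exists>ss es arcs.
     set ss = states A \<and> set es = events A \<and>
     set arcs = {(s, e, s'). delta A s e = Some s'} \<and>
     x = Node (tree_of_list ss) (Node (tree_of_list es)
           (Node (tree_of_list (map (\<lambda>(s, e, s'). Node s (Node e s')) arcs)) (init A))))"

text \<open>The instances are the encodings of \<open>g\<close>-bounded transition systems; trees that are no
  such encoding are to be rejected.\<close>

definition solvability_problem :: "interaction set \<Rightarrow> nat \<Rightarrow> tree set" where
  "solvability_problem \<tau> g =
     {x. \<exists>A. encodes x A \<and> is_ts A \<and> g_bounded g A \<and> solvable \<tau> A}"

end

theory Submission
  imports Defs "HOL-Library.FuncSet"
begin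

text \<open>A transition system is \<open>\<tau>\<close>-solvable iff regions (pairs of a support and a signature)
  separate any two distinct states and inhibit every event at every state where it is disabled.

  In case (1), the system is a path or a cycle, and supports only decrease along it (or
  only increase, in the dual case). So an event whose firing separates two states occurs only once,
  and conversely the cuts of a path with distinct labels are regions that separate everything.

  In case (2), all interactions are idempotent, so every arc is followed by a loop with the
  same label. Then all arcs entering a state carry the same label, and a separation problem is
  solvable iff a Horn-style propagation of its forced consequences is not contradictory.

  In cases (3) and (4), every event that occurs at all is already enabled in the initial state, so there
  are at most \<open>g\<close> of these. A support is determined by its initial value and the signature of these events,
  so the number of states is bounded by a constant, and it suffices to compare the input with a finite list of systems.

  On the machine side, every tree is a list of trees. The predicates decidable in polynomial time
  are closed under quantification over lists computed from the input and under least fixpoints inside such lists,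
  and all of the above criteria are expressible in this way.\<close>


section \<open>Polynomial-time programs\<close>

text \<open>In cases (1) and (2) one criterion serves all types, up to a duality: it follows from
  separability for a largest type and implies separability for a smallest one. The duality
  complements supports and exchanges \<open>INP\<close> with \<open>OUT\<close>, \<open>SET\<close>
  with \<open>RES\<close> and \<open>USED\<close> with \<open>FREE\<close>. The Horn rules of case
  (2) leave states undetermined, and filling these in is the real difficulty: a value that an event
  sets at one target has to be set at all its targets without disturbing other events. This succeeds
  because, as soon as there are two states, only one label enters each of them. In cases (3) and (4)
  the number of states is bounded, but that of events is not, since any number of events may occur
  on no arc. So inputs are compared with systems whose events are the actions on states themselves.
  The suitable ones form a finite set that is built into the program; their solvability is never
  computed.\<close>

lemma poly_nat_mono: "m \<le> n \<Longrightarrow> poly p m \<le> poly p n" for p :: "nat poly"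
  by (induction p) (auto intro!: add_mono mult_mono)

text \<open>From \<open>vbound c\<close> on, variables survive a run of \<open>c\<close> and can
  serve as registers of a surrounding program.\<close>

fun vbound :: "com \<Rightarrow> nat" where
  "vbound Skip = 0"
| "vbound (Assign x a) = Suc x"
| "vbound (Seq c d) = max (vbound c) (vbound d)"
| "vbound (If b c d) = max (vbound c) (vbound d)"
| "vbound (While b c) = vbound c"

lemma exec_frame: "exec c \<sigma> t \<sigma>' \<Longrightarrow> vbound c \<le> y \<Longrightarrow> \<sigma>' y = \<sigma> y"
  by (induction rule: exec.induct) auto

text \<open>The initial store is arbitrary, so that the program of a subroutine can be reused
  anywhere inside a larger program.\<close>

definition ptime :: "(tree \<Rightarrow> tree) \<Rightarrow> bool" where
  "ptime f \<longleftrightarrow> (\<exists>c (q :: nat poly). \<forall>\<sigma>. \<exists>t \<sigma>'.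
     exec c \<sigma> t \<sigma>' \<and> \<sigma>' 0 = f (\<sigma> 0) \<and> t \<le> poly q (size (\<sigma> 0)))"

definition dec :: "(tree \<Rightarrow> bool) \<Rightarrow> bool" where
  "dec P \<longleftrightarrow> ptime (\<lambda>x. if P x then Node Leaf Leaf else Leaf)"

lemma in_P_if_dec:
  assumes "dec (\<lambda>x. x \<in> L)"
  shows "in_P L"
proof -
  from assms obtain c and q :: "nat poly" where c: "\<And>\<sigma>. \<exists>t \<sigma>'.
     exec c \<sigma> t \<sigma>' \<and> \<sigma>' 0 = (if \<sigma> 0 \<in> L then Node Leaf Leaf else Leaf) \<and> t \<le> poly q (size (\<sigma> 0))"
    unfolding dec_def ptime_def by blast
  show ?thesis unfolding in_P_def
  proof (rule exI, rule exI, rule allI)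
    fix x
    show "\<exists>t \<sigma>. exec c ((\<lambda>_. Leaf)(0 := x)) t \<sigma> \<and> t \<le> poly q (size x) \<and> (\<sigma> 0 \<noteq> Leaf \<longleftrightarrow> x \<in> L)"
      using c[of "(\<lambda>_. Leaf)(0 := x)"] by (fastforce split: if_splits)
  qed
qed

lemma ptimeI:
  fixes q :: "nat poly"
  assumes "\<And>\<sigma>. \<exists>t \<sigma>'. exec c \<sigma> t \<sigma>' \<and> \<sigma>' 0 = f (\<sigma> 0) \<and> t \<le> poly q (size (\<sigma> 0))"
  shows "ptime f"
  using assms unfolding ptime_def by blast

lemma ptimeE:
  assumes "ptime f"
  obtains c and q :: "nat poly" where
    "\<And>\<sigma>. \<exists>t \<sigma>'. exec c \<sigma> t \<sigma>' \<and> \<sigma>' 0 = f (\<sigma> 0) \<and> t \<le> poly q (size (\<sigma> 0))"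
  using assms unfolding ptime_def by blast

text \<open>A run enlarges no variable by more than its cost (\<open>exec_size\<close>), so a time
  bound also bounds the size of the result. Time bounds of nested computations stay polynomial for
  this reason.\<close>

lemma ptime_size:
  assumes "ptime f"
  obtains q :: "nat poly" where "\<And>x. size (f x) \<le> poly q (size x)"
proof -
  obtain c and q :: "nat poly" where c:
    "\<And>\<sigma>. \<exists>t \<sigma>'. exec c \<sigma> t \<sigma>' \<and> \<sigma>' 0 = f (\<sigma> 0) \<and> t \<le> poly q (size (\<sigma> 0))"
    using ptimeE[OF assms] by blast
  have "size (f x) \<le> poly ([:0, 1:] + q) (size x)" for x
  proof -
    obtain t \<sigma>' where e: "exec c (\<lambda>_. x) t \<sigma>'" "\<sigma>' 0 = f x" "t \<le> poly q (size x)"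
      using c[of "\<lambda>_. x"] by auto
    show ?thesis using exec_size[OF e(1), of 0] e(2,3) by simp
  qed
  then show ?thesis by (rule that)
qed

lemma ptime_expression:
  assumes "\<And>\<sigma>. val a \<sigma> = f (\<sigma> 0)" "\<And>x. size (f x) \<le> size x + k"
  shows "ptime f"
  unfolding ptime_def
proof (intro exI allI conjI)
  fix \<sigma>
  show "exec (Assign 0 a) \<sigma> (Suc (size (val a \<sigma>))) (\<sigma>(0 := val a \<sigma>))" by (rule exec.Assign)
  show "(\<sigma>(0 := val a \<sigma>)) 0 = f (\<sigma> 0)" using assms(1) by simp
  show "Suc (size (val a \<sigma>)) \<le> poly [:Suc k, 1:] (size (\<sigma> 0))"
    using assms(1)[of \<sigma>] assms(2)[of "\<sigma> 0"] by simp
qed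

fun exp_of_tree :: "tree \<Rightarrow> exp" where
  "exp_of_tree Leaf = Nil_exp"
| "exp_of_tree (Node l r) = Cons_exp (exp_of_tree l) (exp_of_tree r)"

lemma val_exp_of_tree: "val (exp_of_tree t) \<sigma> = t"
  by (induction t) auto

lemma ptime_const: "ptime (\<lambda>x. c)"
  by (rule ptime_expression[of "exp_of_tree c" _ "size c"]) (auto simp: val_exp_of_tree)

lemma ptime_id: "ptime (\<lambda>x. x)"
  by (rule ptime_expression[of "Var 0" _ 0]) auto

lemma ptime_comp:
  assumes "ptime f" "ptime g"
  shows "ptime (\<lambda>x. f (g x))"
proof -
  obtain c and p :: "nat poly" where c:
    "\<And>\<sigma>. \<exists>t \<sigma>'. exec c \<sigma> t \<sigma>' \<and> \<sigma>' 0 = f (\<sigma> 0) \<and> t \<le> poly p (size (\<sigma> 0))"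
    using ptimeE[OF assms(1)] by blast
  obtain d and q :: "nat poly" where d:
    "\<And>\<sigma>. \<exists>t \<sigma>'. exec d \<sigma> t \<sigma>' \<and> \<sigma>' 0 = g (\<sigma> 0) \<and> t \<le> poly q (size (\<sigma> 0))"
    using ptimeE[OF assms(2)] by blast
  show ?thesis
  proof (rule ptimeI)
    fix \<sigma>
    obtain t \<sigma>1 where 1: "exec d \<sigma> t \<sigma>1" "\<sigma>1 0 = g (\<sigma> 0)" "t \<le> poly q (size (\<sigma> 0))"
      using d by blast
    obtain u \<sigma>2 where 2: "exec c \<sigma>1 u \<sigma>2" "\<sigma>2 0 = f (\<sigma>1 0)" "u \<le> poly p (size (\<sigma>1 0))"
      using c by blast
    have "size (\<sigma>1 0) \<le> size (\<sigma> 0) + poly q (size (\<sigma> 0))"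
      using exec_size[OF 1(1), of 0] 1(3) by simp
    then have "poly p (size (\<sigma>1 0)) \<le> poly (pcompose p ([:0,1:] + q)) (size (\<sigma> 0))"
      by (simp add: poly_pcompose poly_nat_mono)
    then have "t + u \<le> poly (q + pcompose p ([:0,1:] + q)) (size (\<sigma> 0))"
      using 1(3) 2(3) by simp
    moreover have "exec (Seq d c) \<sigma> (t + u) \<sigma>2" by (rule exec.Seq[OF 1(1) 2(1)])
    ultimately show "\<exists>t \<sigma>'. exec (Seq d c) \<sigma> t \<sigma>' \<and> \<sigma>' 0 = f (g (\<sigma> 0)) \<and>
        t \<le> poly (q + pcompose p ([:0,1:] + q)) (size (\<sigma> 0))"
      using 1(2) 2(2) by auto
  qed
qed

lemma ptime_hd: "ptime f \<Longrightarrow> ptime (\<lambda>x. hd_tree (f x))"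
proof (rule ptime_comp[of hd_tree])
  have "size (hd_tree x) \<le> size x + 0" for x by (cases x) auto
  then show "ptime hd_tree" by (intro ptime_expression[of "Hd (Var 0)" _ 0]) auto
qed

lemma ptime_tl: "ptime f \<Longrightarrow> ptime (\<lambda>x. tl_tree (f x))"
proof (rule ptime_comp[of tl_tree])
  have "size (tl_tree x) \<le> size x + 0" for x by (cases x) auto
  then show "ptime tl_tree" by (intro ptime_expression[of "Tl (Var 0)" _ 0]) auto
qed

text \<open>A run overwrites its input in variable 0. Therefore the input is parked in
  \<open>k\<close> during the first run and the first result in \<open>Suc k\<close> during the
  second; both variables lie beyond everything that the two programs write.\<close>

lemma two_results:
  assumes "ptime f" "ptime g"
  obtains c and q :: "nat poly" and k :: nat where "0 < k"
    "\<And>\<sigma>. \<exists>t \<sigma>'. exec c \<sigma> t \<sigma>' \<and> \<sigma>' k = f (\<sigma> 0) \<and> \<sigma>' 0 = g (\<sigma> 0) \<and> t \<le> poly q (size (\<sigma> 0))"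
proof -
  obtain c and p :: "nat poly" where c:
    "\<And>\<sigma>. \<exists>t \<sigma>'. exec c \<sigma> t \<sigma>' \<and> \<sigma>' 0 = f (\<sigma> 0) \<and> t \<le> poly p (size (\<sigma> 0))"
    using ptimeE[OF assms(1)] by blast
  obtain d and q :: "nat poly" where d:
    "\<And>\<sigma>. \<exists>t \<sigma>'. exec d \<sigma> t \<sigma>' \<and> \<sigma>' 0 = g (\<sigma> 0) \<and> t \<le> poly q (size (\<sigma> 0))"
    using ptimeE[OF assms(2)] by blast
  define k where "k = Suc (max (vbound c) (vbound d))"
  have k: "0 < k" "vbound c \<le> k" "vbound d \<le> k" "vbound d \<le> Suc k" by (auto simp: k_def)
  define C where "C = Seq (Assign k (Var 0)) (Seq c (Seq (Assign (Suc k) (Var 0))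
    (Seq (Assign 0 (Var k)) (Seq d (Assign k (Var (Suc k)))))))"
  define Q :: "nat poly" where "Q = [:4, 2:] + [:0, 2:] + p + p + p + q"
  show ?thesis
  proof (rule that)
    show "0 < k" by (rule k)
    fix \<sigma> :: store
    let ?n = "size (\<sigma> 0)"
    let ?s0 = "\<sigma>(k := \<sigma> 0)"
    obtain t s1 where 1: "exec c ?s0 t s1" "s1 0 = f (\<sigma> 0)" "t \<le> poly p ?n"
      using c[of ?s0] k by auto
    have s1: "s1 k = \<sigma> 0" using exec_frame[OF 1(1) k(2)] by simp
    let ?s2 = "s1(Suc k := s1 0)"
    let ?s3 = "?s2(0 := s1 k)"
    obtain u s4 where 4: "exec d ?s3 u s4" "s4 0 = g (\<sigma> 0)" "u \<le> poly q ?n"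
      using d[of ?s3] s1 by auto
    have s4: "s4 (Suc k) = f (\<sigma> 0)" using exec_frame[OF 4(1) k(4)] 1(2) by simp
    let ?s5 = "s4(k := s4 (Suc k))"
    have a: "exec (Assign k (Var 0)) \<sigma> (Suc ?n) ?s0"
      using exec.Assign[of k "Var 0" \<sigma>] by simp
    have b: "exec (Assign (Suc k) (Var 0)) s1 (Suc (size (s1 0))) ?s2"
      using exec.Assign[of "Suc k" "Var 0" s1] by simp
    have e: "exec (Assign 0 (Var k)) ?s2 (Suc ?n) ?s3"
      using exec.Assign[of 0 "Var k" ?s2] k(1) s1 by simp
    have h: "exec (Assign k (Var (Suc k))) s4 (Suc (size (f (\<sigma> 0)))) ?s5"
      using exec.Assign[of k "Var (Suc k)" s4] s4 by simp
    have sz: "size (f (\<sigma> 0)) \<le> ?n + poly p ?n"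
      using exec_size[OF 1(1), of 0] 1(2,3) k(1) by simp
    let ?t = "Suc ?n + (t + (Suc (size (s1 0)) + (Suc ?n + (u + Suc (size (f (\<sigma> 0)))))))"
    have "exec C \<sigma> ?t ?s5" unfolding C_def
      by (intro exec.Seq[OF a] exec.Seq[OF 1(1)] exec.Seq[OF b] exec.Seq[OF e] exec.Seq[OF 4(1)] h)
    moreover have "?t \<le> poly Q ?n"
      using 1(2,3) 4(3) sz unfolding Q_def poly_add by (auto simp: algebra_simps)
    ultimately show "\<exists>t \<sigma>'. exec C \<sigma> t \<sigma>' \<and> \<sigma>' k = f (\<sigma> 0) \<and> \<sigma>' 0 = g (\<sigma> 0) \<and> t \<le> poly Q ?n"
      using s4 4(2) k(1) by (intro exI[of _ ?t] exI[of _ ?s5]) auto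
  qed
qed

lemma ptime_Node:
  assumes "ptime f" "ptime g"
  shows "ptime (\<lambda>x. Node (f x) (g x))"
proof -
  obtain c and q :: "nat poly" and k where k: "0 < k" and c:
    "\<And>\<sigma>. \<exists>t \<sigma>'. exec c \<sigma> t \<sigma>' \<and> \<sigma>' k = f (\<sigma> 0) \<and> \<sigma>' 0 = g (\<sigma> 0) \<and> t \<le> poly q (size (\<sigma> 0))"
    by (rule two_results[OF assms]) (rule that)
  obtain p1 :: "nat poly" where p1: "\<And>x. size (f x) \<le> poly p1 (size x)" using ptime_size[OF assms(1)] by blast
  obtain p2 :: "nat poly" where p2: "\<And>x. size (g x) \<le> poly p2 (size x)" using ptime_size[OF assms(2)] by blast
  show ?thesis
  proof (rule ptimeI)
    fix \<sigma>
    obtain t s where 1: "exec c \<sigma> t s" "s k = f (\<sigma> 0)" "s 0 = g (\<sigma> 0)" "t \<le> poly q (size (\<sigma> 0))"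
      using c by blast
    let ?c = "Seq c (Assign 0 (Cons_exp (Var k) (Var 0)))"
    let ?t = "t + Suc (size (Node (s k) (s 0)))"
    let ?s = "s(0 := Node (s k) (s 0))"
    have e: "exec ?c \<sigma> ?t ?s"
      using exec.Seq[OF 1(1) exec.Assign[of 0 "Cons_exp (Var k) (Var 0)" s]] by simp
    have t: "?t \<le> poly (q + p1 + p2 + [:2:]) (size (\<sigma> 0))"
      using 1(4) p1[of "\<sigma> 0"] p2[of "\<sigma> 0"] unfolding 1(2,3) by simp
    show "\<exists>t \<sigma>'. exec ?c \<sigma> t \<sigma>' \<and>
        \<sigma>' 0 = Node (f (\<sigma> 0)) (g (\<sigma> 0)) \<and> t \<le> poly (q + p1 + p2 + [:2:]) (size (\<sigma> 0))"
      by (rule exI[of _ ?t], rule exI[of _ ?s], intro conjI, rule e, simp only: 1(2,3) fun_upd_same, rule t)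
  qed
qed

lemma ptime_if:
  assumes "dec P" "ptime f" "ptime g"
  shows "ptime (\<lambda>x. if P x then f x else g x)"
proof -
  obtain c and q :: "nat poly" and k where k: "0 < k" and c:
    "\<And>\<sigma>. \<exists>t \<sigma>'. exec c \<sigma> t \<sigma>' \<and> \<sigma>' k = (if P (\<sigma> 0) then Node Leaf Leaf else Leaf) \<and> \<sigma>' 0 = \<sigma> 0 \<and>
      t \<le> poly q (size (\<sigma> 0))"
    \<comment> \<open>With the identity as second function, the input is back in variable 0 after
      the test, ready for either branch.\<close>
    by (rule two_results[OF assms(1)[unfolded dec_def] ptime_id]) (rule that)
  obtain d and p1 :: "nat poly" where d:
    "\<And>\<sigma>. \<exists>t \<sigma>'. exec d \<sigma> t \<sigma>' \<and> \<sigma>' 0 = f (\<sigma> 0) \<and> t \<le> poly p1 (size (\<sigma> 0))"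
    using ptimeE[OF assms(2)] by blast
  obtain e and p2 :: "nat poly" where e:
    "\<And>\<sigma>. \<exists>t \<sigma>'. exec e \<sigma> t \<sigma>' \<and> \<sigma>' 0 = g (\<sigma> 0) \<and> t \<le> poly p2 (size (\<sigma> 0))"
    using ptimeE[OF assms(3)] by blast
  show ?thesis
  proof (rule ptimeI)
    fix \<sigma>
    obtain t s where 1: "exec c \<sigma> t s" "s k = (if P (\<sigma> 0) then Node Leaf Leaf else Leaf)"
        "s 0 = \<sigma> 0" "t \<le> poly q (size (\<sigma> 0))"
      using c by blast
    show "\<exists>t \<sigma>'. exec (Seq c (If (Var k) d e)) \<sigma> t \<sigma>' \<and>
        \<sigma>' 0 = (if P (\<sigma> 0) then f (\<sigma> 0) else g (\<sigma> 0)) \<and> t \<le> poly (q + p1 + p2 + [:1:]) (size (\<sigma> 0))"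
    proof (cases "P (\<sigma> 0)")
      case True
      obtain u s' where 2: "exec d s u s'" "s' 0 = f (\<sigma> 0)" "u \<le> poly p1 (size (\<sigma> 0))"
        using d[of s] 1(3) by auto
      have "exec (Seq c (If (Var k) d e)) \<sigma> (t + Suc u) s'"
        using exec.Seq[OF 1(1) exec.IfTrue[OF _ 2(1)]] True 1(2) by simp
      then show ?thesis using True 1 2 by (intro exI[of _ "t + Suc u"] exI[of _ s']) auto
    next
      case False
      obtain u s' where 2: "exec e s u s'" "s' 0 = g (\<sigma> 0)" "u \<le> poly p2 (size (\<sigma> 0))"
        using e[of s] 1(3) by auto
      have "exec (Seq c (If (Var k) d e)) \<sigma> (t + Suc u) s'"
        using exec.Seq[OF 1(1) exec.IfFalse[OF _ 2(1)]] False 1(2) by simp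
      then show ?thesis using False 1 2 by (intro exI[of _ "t + Suc u"] exI[of _ s']) auto
    qed
  qed
qed

text \<open>The measure \<open>\<mu>\<close> limits the number of rounds, and the invariant keeps
  every state of the loop polynomial in the original input \<open>x\<close>; a polynomial-time body
  alone could double the state in each round. The loop runs while the head of its state is not
  \<open>Leaf\<close>.\<close>

lemma ptime_while:
  fixes p :: "nat poly" and \<mu> :: "tree \<Rightarrow> nat"
  assumes f: "ptime f" and h: "ptime h"
    and start: "\<And>x. Inv x (h x)" "\<And>x. \<mu> (h x) \<le> poly p (size x)"
    and step: "\<And>x s. Inv x s \<Longrightarrow> hd_tree s \<noteq> Leaf \<Longrightarrow> Inv x (f s) \<and> \<mu> (f s) < \<mu> s"
    and size: "\<And>x s. Inv x s \<Longrightarrow> size s \<le> poly p (size x)"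
    and final: "\<And>x s. Inv x s \<Longrightarrow> hd_tree s = Leaf \<Longrightarrow> s = r x"
  shows "ptime r"
proof -
  obtain c and q :: "nat poly" where c:
    "\<And>\<sigma>. \<exists>t \<sigma>'. exec c \<sigma> t \<sigma>' \<and> \<sigma>' 0 = f (\<sigma> 0) \<and> t \<le> poly q (size (\<sigma> 0))"
    using ptimeE[OF f] by blast
  obtain d and q' :: "nat poly" where d:
    "\<And>\<sigma>. \<exists>t \<sigma>'. exec d \<sigma> t \<sigma>' \<and> \<sigma>' 0 = h (\<sigma> 0) \<and> t \<le> poly q' (size (\<sigma> 0))"
    using ptimeE[OF h] by blast
  let ?w = "While (Hd (Var 0)) c"
  have loop: "\<exists>t \<sigma>'. exec ?w \<sigma> t \<sigma>' \<and> \<sigma>' 0 = r x \<and>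
      t \<le> m * (1 + poly q (poly p (size x))) + 1"
    if "Inv x (\<sigma> 0)" "\<mu> (\<sigma> 0) \<le> m" for x \<sigma> m
    using that
  proof (induction m arbitrary: \<sigma>)
    case 0
    then have "hd_tree (\<sigma> 0) = Leaf" using step[of x "\<sigma> 0"] by force
    then show ?case using final[OF 0(1)] exec.WhileFalse[of "Hd (Var 0)" \<sigma> c]
      by (intro exI[of _ 1] exI[of _ \<sigma>]) simp
  next
    case (Suc m)
    show ?case
    proof (cases "hd_tree (\<sigma> 0) = Leaf")
      case True
      then show ?thesis using final[OF Suc.prems(1)] exec.WhileFalse[of "Hd (Var 0)" \<sigma> c]
        by (intro exI[of _ 1] exI[of _ \<sigma>]) simp
    next
      case False
      obtain t \<sigma>1 where 1: "exec c \<sigma> t \<sigma>1" "\<sigma>1 0 = f (\<sigma> 0)" "t \<le> poly q (size (\<sigma> 0))"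
        using c by blast
      have t: "t \<le> poly q (poly p (size x))"
        using 1(3) poly_nat_mono[OF size[OF Suc.prems(1)], of q] by simp
      have "Inv x (\<sigma>1 0)" "\<mu> (\<sigma>1 0) \<le> m"
        using step[OF Suc.prems(1) False] Suc.prems(2) 1(2) by auto
      then obtain u \<sigma>2 where 2: "exec ?w \<sigma>1 u \<sigma>2" "\<sigma>2 0 = r x"
          "u \<le> m * (1 + poly q (poly p (size x))) + 1"
        using Suc.IH by blast
      have "exec ?w \<sigma> (Suc (t + u)) \<sigma>2"
        using exec.WhileTrue[OF _ 1(1) 2(1)] False by simp
      then show ?thesis using 2 t by (intro exI[of _ "Suc (t + u)"] exI[of _ \<sigma>2]) auto
    qed
  qed
  let ?Q = "q' + (p * ([:1:] + pcompose q p) + [:1:])"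
  show ?thesis
  proof (rule ptimeI)
    fix \<sigma>
    obtain t s where 1: "exec d \<sigma> t s" "s 0 = h (\<sigma> 0)" "t \<le> poly q' (size (\<sigma> 0))"
      using d by blast
    obtain u s' where 2: "exec ?w s u s'" "s' 0 = r (\<sigma> 0)"
        "u \<le> poly p (size (\<sigma> 0)) * (1 + poly q (poly p (size (\<sigma> 0)))) + 1"
      using loop[of "\<sigma> 0" s "poly p (size (\<sigma> 0))"] 1(2) start[of "\<sigma> 0"] by auto
    show "\<exists>t \<sigma>'. exec (Seq d ?w) \<sigma> t \<sigma>' \<and> \<sigma>' 0 = r (\<sigma> 0) \<and> t \<le> poly ?Q (size (\<sigma> 0))"
      using exec.Seq[OF 1(1) 2(1)] 1(3) 2(2,3)
      by (intro exI[of _ "t + u"] exI[of _ s']) (auto simp: poly_pcompose)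
  qed
qed


section \<open>Trees as lists\<close>

fun list_of_tree :: "tree \<Rightarrow> tree list" where
  "list_of_tree Leaf = []"
| "list_of_tree (Node x t) = x # list_of_tree t"

lemma tree_of_list_simps [simp]:
  "tree_of_list [] = Leaf" "tree_of_list (x # xs) = Node x (tree_of_list xs)"
  by (simp_all add: tree_of_list_def)

lemma list_of_tree_of_list [simp]: "list_of_tree (tree_of_list xs) = xs"
  by (induction xs) auto

lemma tree_of_list_of_tree [simp]: "tree_of_list (list_of_tree t) = t"
  by (induction t) auto

lemma tree_of_list_eq_Leaf [simp]: "tree_of_list xs = Leaf \<longleftrightarrow> xs = []"
  by (cases xs) auto

lemma size_tree_of_list: "size (tree_of_list xs) = (\<Sum>x\<leftarrow>xs. Suc (size x))"
  by (induction xs) auto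

lemma size_list_elem: "x \<in> set xs \<Longrightarrow> size x < size (tree_of_list xs)"
  by (induction xs) auto

lemma length_le_size: "length xs \<le> size (tree_of_list xs)"
  by (induction xs) auto

lemma size_tree_of_list_append:
  "size (tree_of_list (xs @ ys)) = size (tree_of_list xs) + size (tree_of_list ys)"
  by (induction xs) auto

lemma size_filter_le: "size (tree_of_list (filter P xs)) \<le> size (tree_of_list xs)"
  by (induction xs) auto

text \<open>The state of the loop consists of the unread part of the list, the input and the
  accumulator; the unread part, as its head, is also the guard. The size bound is asked for after
  every prefix \<open>ys\<close>, because intermediate accumulators have to stay small as
  well.\<close>

lemma ptime_fold:
  assumes l: "ptime l" and a: "ptime a" and st: "ptime (\<lambda>z. st (hd_tree z) (hd_tree (tl_tree z)) (tl_tree (tl_tree z)))"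
    and bound: "\<And>x ys zs. list_of_tree (l x) = ys @ zs \<Longrightarrow> size (fold (st x) ys (a x)) \<le> poly q (size x)"
  shows "ptime (\<lambda>x. fold (st x) (list_of_tree (l x)) (a x))"
proof -
  define step where "step s = (let r = hd_tree s; x = hd_tree (tl_tree s); b = tl_tree (tl_tree s)
     in Node (tl_tree r) (Node x (st x (hd_tree r) b)))" for s
  obtain p :: "nat poly" where p: "\<And>x. size (l x) \<le> poly p (size x)" using ptime_size[OF l] by blast
  have "ptime step"
    using ptime_comp[OF st ptime_Node[OF ptime_hd[OF ptime_tl[OF ptime_id]]
      ptime_Node[OF ptime_hd[OF ptime_hd[OF ptime_id]] ptime_tl[OF ptime_tl[OF ptime_id]]]]]
    unfolding step_def Let_def
    by (intro ptime_Node ptime_hd ptime_tl ptime_id) auto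
  moreover have "ptime (\<lambda>x. Node (l x) (Node x (a x)))"
    by (intro ptime_Node l a ptime_id)
  ultimately have "ptime (\<lambda>x. Node Leaf (Node x (fold (st x) (list_of_tree (l x)) (a x))))"
  proof (rule ptime_while[where \<mu> = "\<lambda>s. length (list_of_tree (hd_tree s))" and p = "p + q + [:2, 1:]"
      and Inv = "\<lambda>x s. \<exists>ys zs. list_of_tree (l x) = ys @ zs \<and>
        s = Node (tree_of_list zs) (Node x (fold (st x) ys (a x)))"])
    fix x
    show "\<exists>ys zs. list_of_tree (l x) = ys @ zs \<and>
        Node (l x) (Node x (a x)) = Node (tree_of_list zs) (Node x (fold (st x) ys (a x)))"
      by (intro exI[of _ "[]"] exI[of _ "list_of_tree (l x)"]) simp
    show "length (list_of_tree (hd_tree (Node (l x) (Node x (a x))))) \<le> poly (p + q + [:2, 1:]) (size x)"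
      using p[of x] length_le_size[of "list_of_tree (l x)"] by simp
    fix s
    assume "\<exists>ys zs. list_of_tree (l x) = ys @ zs \<and>
        s = Node (tree_of_list zs) (Node x (fold (st x) ys (a x)))"
    then obtain ys zs where s: "list_of_tree (l x) = ys @ zs"
        "s = Node (tree_of_list zs) (Node x (fold (st x) ys (a x)))" by blast
    have "size (tree_of_list zs) \<le> size (l x)"
      using size_tree_of_list_append[of ys zs] s(1) by (metis le_add2 tree_of_list_of_tree)
    then show "size s \<le> poly (p + q + [:2, 1:]) (size x)"
      using p[of x] bound[OF s(1)] s(2) by simp
    { assume "hd_tree s = Leaf"
      then show "s = Node Leaf (Node x (fold (st x) (list_of_tree (l x)) (a x)))"
        using s by simp }
    { assume "hd_tree s \<noteq> Leaf"
      then obtain z zs' where zs: "zs = z # zs'" using s by (cases zs) auto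
      show "(\<exists>ys zs. list_of_tree (l x) = ys @ zs \<and>
          step s = Node (tree_of_list zs) (Node x (fold (st x) ys (a x)))) \<and>
          length (list_of_tree (hd_tree (step s))) < length (list_of_tree (hd_tree s))"
        using s zs by (intro conjI exI[of _ "ys @ [z]"] exI[of _ zs']) (auto simp: step_def Let_def) }
  qed
  from ptime_tl[OF ptime_tl[OF this]] show ?thesis by simp
qed

text \<open>Pushing elements one by one onto the empty list reverses it. A left fold over the
  reversed list is a right fold, and right folds with \<open>Node\<close> preserve the
  order.\<close>

lemma ptime_rev: "ptime l \<Longrightarrow> ptime (\<lambda>x. tree_of_list (rev (list_of_tree (l x))))"
proof -
  assume l: "ptime l"
  obtain p :: "nat poly" where p: "\<And>x. size (l x) \<le> poly p (size x)" using ptime_size[OF l] by blast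
  have *: "fold Node ys (tree_of_list zs) = tree_of_list (rev ys @ zs)" for ys zs
    by (induction ys arbitrary: zs) (auto simp flip: tree_of_list_simps)
  have "ptime (\<lambda>x. fold Node (list_of_tree (l x)) Leaf)"
  proof (rule ptime_fold[where q = p and st = "\<lambda>x. Node"])
    show "ptime (\<lambda>z. Node (hd_tree (tl_tree z)) (tl_tree (tl_tree z)))"
      by (intro ptime_Node ptime_hd ptime_tl ptime_id)
    fix x ys zs
    assume a: "list_of_tree (l x) = ys @ zs"
    have "size (tree_of_list (rev ys)) = size (tree_of_list ys)"
      by (simp add: size_tree_of_list rev_map[symmetric])
    also have "\<dots> \<le> size (l x)"
      using size_tree_of_list_append[of ys zs] a by (metis le_add1 tree_of_list_of_tree)
    finally show "size (fold Node ys Leaf) \<le> poly p (size x)"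
      using *[of ys "[]"] p[of x] by simp
  qed (rule l ptime_const)+
  then show ?thesis using *[of _ "[]"] by simp
qed

lemma ptime_foldr:
  assumes l: "ptime l" and a: "ptime a" and st: "ptime (\<lambda>z. st (hd_tree z) (hd_tree (tl_tree z)) (tl_tree (tl_tree z)))"
    and bound: "\<And>x ys zs. list_of_tree (l x) = ys @ zs \<Longrightarrow> size (foldr (st x) zs (a x)) \<le> poly q (size x)"
  shows "ptime (\<lambda>x. foldr (st x) (list_of_tree (l x)) (a x))"
proof -
  have "ptime (\<lambda>x. fold (st x) (list_of_tree (tree_of_list (rev (list_of_tree (l x))))) (a x))"
  proof (rule ptime_fold[OF ptime_rev[OF l] a st])
    fix x ys zs
    assume "list_of_tree (tree_of_list (rev (list_of_tree (l x)))) = ys @ zs"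
    then have "rev (ys @ zs) = list_of_tree (l x)" by (metis list_of_tree_of_list rev_rev_ident)
    then show "size (fold (st x) ys (a x)) \<le> poly q (size x)"
      using bound[of x "rev zs" "rev ys"] by (simp add: foldr_conv_fold)
  qed
  then show ?thesis by (simp add: foldr_conv_fold)
qed

text \<open>Predicates with a parameter are passed as predicates on one tree \<open>z\<close>, the
  pair of the parameter \<open>x\<close> and the list element \<open>y\<close>. Nested quantifiers
  thereby turn into nested pairs.\<close>

lemma ptime_filter:
  assumes l: "ptime l" and P: "dec (\<lambda>z. P (hd_tree z) (tl_tree z))"
  shows "ptime (\<lambda>x. tree_of_list (filter (P x) (list_of_tree (l x))))"
proof -
  obtain p :: "nat poly" where p: "\<And>x. size (l x) \<le> poly p (size x)" using ptime_size[OF l] by blast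
  have P': "dec (\<lambda>z. P (hd_tree z) (hd_tree (tl_tree z)))"
    using ptime_comp[OF P[unfolded dec_def] ptime_Node[OF ptime_hd[OF ptime_id] ptime_hd[OF ptime_tl[OF ptime_id]]]]
    unfolding dec_def by simp
  have *: "foldr (\<lambda>y b. if P x y then Node y b else b) ys Leaf = tree_of_list (filter (P x) ys)" for x ys
    by (induction ys) auto
  have "ptime (\<lambda>x. foldr (\<lambda>y b. if P x y then Node y b else b) (list_of_tree (l x)) Leaf)"
  proof (rule ptime_foldr[where q = p and st = "\<lambda>x y b. if P x y then Node y b else b"])
    show "ptime (\<lambda>z. if P (hd_tree z) (hd_tree (tl_tree z))
        then Node (hd_tree (tl_tree z)) (tl_tree (tl_tree z)) else tl_tree (tl_tree z))"
      by (intro ptime_if P' ptime_Node ptime_hd ptime_tl ptime_id)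
    fix x ys zs
    assume a: "list_of_tree (l x) = ys @ zs"
    have "size (tree_of_list (filter (P x) zs)) \<le> size (tree_of_list zs)" by (rule size_filter_le)
    also have "\<dots> \<le> size (l x)"
      using size_tree_of_list_append[of ys zs] a by (metis le_add2 tree_of_list_of_tree)
    finally show "size (foldr (\<lambda>y b. if P x y then Node y b else b) zs Leaf) \<le> poly p (size x)"
      using p[of x] by (simp add: *)
  qed (rule l ptime_const)+
  then show ?thesis by (simp add: *)
qed

lemma ptime_append:
  assumes l: "ptime l" and a: "ptime a"
  shows "ptime (\<lambda>x. tree_of_list (list_of_tree (l x) @ list_of_tree (a x)))"
proof -
  obtain p :: "nat poly" where p: "\<And>x. size (l x) \<le> poly p (size x)" using ptime_size[OF l] by blast
  obtain q :: "nat poly" where q: "\<And>x. size (a x) \<le> poly q (size x)" using ptime_size[OF a] by blast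
  have *: "foldr Node ys (a x) = tree_of_list (ys @ list_of_tree (a x))" for x ys
    by (induction ys) auto
  have "ptime (\<lambda>x. foldr Node (list_of_tree (l x)) (a x))"
  proof (rule ptime_foldr[where q = "p + q" and st = "\<lambda>x. Node"])
    show "ptime (\<lambda>z. Node (hd_tree (tl_tree z)) (tl_tree (tl_tree z)))"
      by (intro ptime_Node ptime_hd ptime_tl ptime_id)
    fix x ys zs
    assume b: "list_of_tree (l x) = ys @ zs"
    have "size (tree_of_list zs) \<le> size (l x)"
      using size_tree_of_list_append[of ys zs] b by (metis le_add2 tree_of_list_of_tree)
    then show "size (foldr Node zs (a x)) \<le> poly (p + q) (size x)"
      using p[of x] q[of x] by (simp add: * size_tree_of_list_append)
  qed (rule l a)+
  then show ?thesis by (simp add: *)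
qed

lemma ptime_map:
  assumes l: "ptime l" and f: "ptime (\<lambda>z. f (hd_tree z) (tl_tree z))"
  shows "ptime (\<lambda>x. tree_of_list (map (f x) (list_of_tree (l x))))"
proof -
  obtain p :: "nat poly" where p: "\<And>x. size (l x) \<le> poly p (size x)" using ptime_size[OF l] by blast
  obtain q :: "nat poly" where q: "\<And>z. size (f (hd_tree z) (tl_tree z)) \<le> poly q (size z)"
    using ptime_size[OF f] by blast
  have f': "ptime (\<lambda>z. f (hd_tree z) (hd_tree (tl_tree z)))"
    using ptime_comp[OF f ptime_Node[OF ptime_hd[OF ptime_id] ptime_hd[OF ptime_tl[OF ptime_id]]]] by simp
  have *: "foldr (\<lambda>y b. Node (f x y) b) ys Leaf = tree_of_list (map (f x) ys)" for x ys
    by (induction ys) auto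
  have "ptime (\<lambda>x. foldr (\<lambda>y b. Node (f x y) b) (list_of_tree (l x)) Leaf)"
  \<comment> \<open>The factor \<open>p\<close> counts the elements, and \<open>[:1, 1:] + p\<close>
    bounds the size of the pair \<open>Node x y\<close> on which \<open>f\<close> is
    evaluated.\<close>
  proof (rule ptime_foldr[where q = "p * ([:1:] + pcompose q ([:1, 1:] + p))" and st = "\<lambda>x y b. Node (f x y) b"])
    show "ptime (\<lambda>z. Node (f (hd_tree z) (hd_tree (tl_tree z))) (tl_tree (tl_tree z)))"
      by (intro ptime_Node f' ptime_tl ptime_id)
    fix x ys zs
    assume a: "list_of_tree (l x) = ys @ zs"
    have l': "size (tree_of_list zs) \<le> size (l x)"
      using size_tree_of_list_append[of ys zs] a by (metis le_add2 tree_of_list_of_tree)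
    have "size (f x y) \<le> poly q (1 + size x + poly p (size x))" if "y \<in> set zs" for y
    proof -
      have "size (f x y) \<le> poly q (size (Node x y))" using q[of "Node x y"] by simp
      also have "\<dots> \<le> poly q (1 + size x + poly p (size x))"
        using size_list_elem[OF that] l' p[of x] by (intro poly_nat_mono) simp
      finally show ?thesis .
    qed
    then have "(\<Sum>y\<leftarrow>zs. Suc (size (f x y))) \<le> (\<Sum>y\<leftarrow>zs. 1 + poly q (1 + size x + poly p (size x)))"
      by (intro sum_list_mono) auto
    also have "\<dots> = length zs * (1 + poly q (1 + size x + poly p (size x)))"
      by (simp add: sum_list_triv)
    also have "\<dots> \<le> poly p (size x) * (1 + poly q (1 + size x + poly p (size x)))"
      using length_le_size[of zs] l' p[of x] by (intro mult_right_mono) auto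
    finally show "size (foldr (\<lambda>y b. Node (f x y) b) zs Leaf)
        \<le> poly (p * ([:1:] + pcompose q ([:1, 1:] + p))) (size x)"
      by (simp add: * size_tree_of_list o_def poly_pcompose)
  qed (rule l ptime_const)+
  then show ?thesis by (simp add: *)
qed

section \<open>Closure properties of the predicates decidable in polynomial time\<close>

lemma dec_const: "dec (\<lambda>x. b)"
  unfolding dec_def by (rule ptime_const)

lemma dec_comp: "dec P \<Longrightarrow> ptime f \<Longrightarrow> dec (\<lambda>x. P (f x))"
  unfolding dec_def by (rule ptime_comp)

lemma dec_if:
  assumes "dec P" "dec Q" "dec R"
  shows "dec (\<lambda>x. if P x then Q x else R x)"
proof -
  have "(\<lambda>x. if (if P x then Q x else R x) then Node Leaf Leaf else Leaf) =
      (\<lambda>x. if P x then if Q x then Node Leaf Leaf else Leaf else if R x then Node Leaf Leaf else Leaf)"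
    by (rule ext) simp
  then show ?thesis
    using ptime_if[OF assms(1) assms(2,3)[unfolded dec_def]] unfolding dec_def by simp
qed

lemma if_False_True: "(if b then False else True) \<longleftrightarrow> \<not> b" "(if b then c else False) \<longleftrightarrow> b \<and> c"
  by simp_all

lemma dec_not: "dec P \<Longrightarrow> dec (\<lambda>x. \<not> P x)"
  using dec_if[OF _ dec_const[of False] dec_const[of True], of P] by (simp only: if_False_True)

lemma dec_conj: "dec P \<Longrightarrow> dec Q \<Longrightarrow> dec (\<lambda>x. P x \<and> Q x)"
  using dec_if[OF _ _ dec_const[of False], of P Q] by (simp only: if_False_True)

lemma dec_disj: "dec P \<Longrightarrow> dec Q \<Longrightarrow> dec (\<lambda>x. P x \<or> Q x)"
  using dec_not[OF dec_conj[OF dec_not dec_not], of P Q] by (simp only: de_Morgan_conj not_not)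

lemma dec_imp: "dec P \<Longrightarrow> dec Q \<Longrightarrow> dec (\<lambda>x. P x \<longrightarrow> Q x)"
  using dec_disj[OF dec_not, of P Q] by (simp only: imp_conv_disj)

lemma dec_iff: "dec P \<Longrightarrow> dec Q \<Longrightarrow> dec (\<lambda>x. P x \<longleftrightarrow> Q x)"
  using dec_conj[OF dec_imp dec_imp, of P Q Q P] by (simp only: iff_conv_conj_imp)

lemma dec_fin_ball:
  assumes "finite I" "\<And>i. i \<in> I \<Longrightarrow> dec (P i)"
  shows "dec (\<lambda>x. \<forall>i\<in>I. P i x)"
  using assms by (induction I rule: finite_induct) (simp_all add: dec_const dec_conj)

lemma dec_fin_bex:
  assumes "finite I" "\<And>i. i \<in> I \<Longrightarrow> dec (P i)"
  shows "dec (\<lambda>x. \<exists>i\<in>I. P i x)"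
  using dec_not[OF dec_fin_ball[OF assms(1) dec_not[OF assms(2)]]] by (simp only: ball_simps not_not)

text \<open>The only test built into the language. Equality, membership and quantifiers over lists
  all rest on it.\<close>

lemma dec_not_Leaf: "ptime f \<Longrightarrow> dec (\<lambda>x. f x \<noteq> Leaf)"
proof (rule dec_comp[of "\<lambda>x. x \<noteq> Leaf"])
  show "dec (\<lambda>x. x \<noteq> Leaf)" unfolding dec_def
  proof (rule ptimeI)
    fix \<sigma> :: store
    let ?a = "Assign 0 (Cons_exp Nil_exp Nil_exp)"
    have "exec (If (Var 0) ?a Skip) \<sigma> 3 (\<sigma>(0 := Node Leaf Leaf))" if "\<sigma> 0 \<noteq> Leaf"
      using exec.IfTrue[of "Var 0" \<sigma> ?a, OF _ exec.Assign, of Skip] that by (simp add: numeral_3_eq_3)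
    moreover have "exec (If (Var 0) ?a Skip) \<sigma> 2 \<sigma>" if "\<sigma> 0 = Leaf"
      using exec.IfFalse[of "Var 0" \<sigma> Skip, OF _ exec.Skip, of ?a] that by (simp add: numeral_2_eq_2)
    ultimately show "\<exists>t \<sigma>'. exec (If (Var 0) ?a Skip) \<sigma> t \<sigma>' \<and>
        \<sigma>' 0 = (if \<sigma> 0 \<noteq> Leaf then Node Leaf Leaf else Leaf) \<and> t \<le> poly [:3:] (size (\<sigma> 0))"
      by (cases "\<sigma> 0 = Leaf") fastforce+
  qed
qed

lemma dec_Leaf: "ptime f \<Longrightarrow> dec (\<lambda>x. f x = Leaf)"
  using dec_not[OF dec_not_Leaf] by (simp only: not_not)

text \<open>Searching a list is filtering it and testing whether anything is left.\<close>

lemma dec_bex: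
  assumes "ptime l" "dec (\<lambda>z. P (hd_tree z) (tl_tree z))"
  shows "dec (\<lambda>x. \<exists>y\<in>set (list_of_tree (l x)). P x y)"
proof -
  have "dec (\<lambda>x. tree_of_list (filter (P x) (list_of_tree (l x))) \<noteq> Leaf)"
    by (intro dec_not_Leaf ptime_filter assms)
  then show ?thesis by (simp add: filter_empty_conv)
qed

lemma dec_ball:
  assumes "ptime l" "dec (\<lambda>z. P (hd_tree z) (tl_tree z))"
  shows "dec (\<lambda>x. \<forall>y\<in>set (list_of_tree (l x)). P x y)"
  using dec_not[OF dec_bex[OF assms(1) dec_not[OF assms(2)]]] by (simp only: bex_simps not_not)

text \<open>Equality is decided with a stack of pairs of subtrees that remain to be compared. A leaf
  in the second component signals that a difference has been found.\<close>

definition eq_step :: "tree \<Rightarrow> tree" where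
  "eq_step s = (let a = hd_tree (hd_tree (hd_tree s)); b = tl_tree (hd_tree (hd_tree s)); r = tl_tree (hd_tree s) in
     if a = Leaf then if b = Leaf then Node r (tl_tree s) else Node Leaf Leaf
     else if b = Leaf then Node Leaf Leaf
     else Node (Node (Node (hd_tree a) (hd_tree b)) (Node (Node (tl_tree a) (tl_tree b)) r)) (tl_tree s))"

lemma ptime_eq_step: "ptime eq_step"
  unfolding eq_step_def Let_def
  by (intro ptime_if dec_Leaf ptime_Node ptime_hd ptime_tl ptime_id ptime_const)

lemma dec_eq:
  assumes "ptime f" "ptime g"
  shows "dec (\<lambda>x. f x = g x)"
proof -
  define todo where "todo ps = tree_of_list (map (\<lambda>(a, b). Node a b) ps)" for ps
  have todo [simp]: "todo [] = Leaf" "todo ((a, b) # ps) = Node (Node a b) (todo ps)"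
      "todo ps = Leaf \<longleftrightarrow> ps = []" for a b ps
    by (simp_all add: todo_def)
  define state where "state x s \<longleftrightarrow> s = Node Leaf Leaf \<and> f x \<noteq> g x \<or>
    (\<exists>ps. s = Node (todo ps) (Node Leaf Leaf) \<and> (f x = g x \<longleftrightarrow> (\<forall>(a, b) \<in> set ps. a = b)))" for x s
  have fail: "state x (Node Leaf Leaf)" if "f x \<noteq> g x" for x
    unfolding state_def using that by (intro disjI1 conjI refl)
  have cont: "state x (Node (todo ps) (Node Leaf Leaf))"
    if "f x = g x \<longleftrightarrow> (\<forall>(a, b) \<in> set ps. a = b)" for x ps
    unfolding state_def by (intro disjI2 exI[of _ ps] conjI refl that)
  \<comment> \<open>The total size of the pairs on the stack. Splitting a pair of inner nodes into
    two pairs lowers it by one, whereas the size of the whole state stays the same, since the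
    additional pair needs a list cell of its own.\<close>
  define weight where "weight s = (\<Sum>t\<leftarrow>list_of_tree (hd_tree s). size t)" for s
  have step: "state x (eq_step s) \<and> size (eq_step s) \<le> size s \<and> weight (eq_step s) < weight s"
    if st: "state x s" and ne: "hd_tree s \<noteq> Leaf" for x s
  proof -
    have "s \<noteq> Node Leaf Leaf" using ne by auto
    then have "\<exists>ps. s = Node (todo ps) (Node Leaf Leaf) \<and> (f x = g x \<longleftrightarrow> (\<forall>(a, b) \<in> set ps. a = b))"
      using st unfolding state_def by (simp only: simp_thms)
    then obtain ps where ps: "s = Node (todo ps) (Node Leaf Leaf)"
      "f x = g x \<longleftrightarrow> (\<forall>(a, b) \<in> set ps. a = b)" by (elim exE conjE) (rule that)
    have "ps \<noteq> []" using ne ps(1) by auto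
    then obtain a b qs where qs: "ps = (a, b) # qs" by (cases ps) auto
    have eq: "f x = g x \<longleftrightarrow> a = b \<and> (\<forall>(a, b) \<in> set qs. a = b)" using ps(2) qs by simp
    have s: "s = Node (Node (Node a b) (todo qs)) (Node Leaf Leaf)" using ps(1) qs by simp
    show ?thesis
    proof (cases a)
      case Leaf
      show ?thesis
      proof (cases b)
        case Leaf
        then show ?thesis using cont[of x qs] eq \<open>a = Leaf\<close> by (simp add: s eq_step_def weight_def)
      next
        case Node
        then show ?thesis using fail[of x] eq \<open>a = Leaf\<close> by (simp add: s eq_step_def weight_def)
      qed
    next
      case a: (Node a1 a2)
      show ?thesis
      proof (cases b)
        case Leaf
        then show ?thesis using fail[of x] eq a by (simp add: s eq_step_def weight_def)
      next
        case (Node b1 b2)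
        have "f x = g x \<longleftrightarrow> (\<forall>(a, b) \<in> set ((a1, b1) # (a2, b2) # qs). a = b)"
          using eq a Node by auto
        from cont[OF this] show ?thesis using a Node by (simp add: s eq_step_def weight_def)
      qed
    qed
  qed
  obtain p :: "nat poly" where p: "\<And>x. size (f x) \<le> poly p (size x)" using ptime_size[OF assms(1)] by blast
  obtain q :: "nat poly" where q: "\<And>x. size (g x) \<le> poly q (size x)" using ptime_size[OF assms(2)] by blast
  let ?h = "\<lambda>x. Node (Node (Node (f x) (g x)) Leaf) (Node Leaf Leaf)"
  have h: "size (?h x) \<le> poly (p + q + [:4:]) (size x)" for x
    using p[of x] q[of x] by simp
  have "ptime (\<lambda>x. Node Leaf (if f x = g x then Node Leaf Leaf else Leaf))"
  proof (rule ptime_while[where f = eq_step and h = ?h and \<mu> = weight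
        and Inv = "\<lambda>x s. state x s \<and> size s \<le> size (?h x)" and p = "p + q + [:4:]"])
    fix x
    show "state x (?h x) \<and> size (?h x) \<le> size (?h x)" using cont[of x "[(f x, g x)]"] by simp
    show "weight (?h x) \<le> poly (p + q + [:4:]) (size x)" using h[of x] by (simp add: weight_def)
    fix s assume s: "state x s \<and> size s \<le> size (?h x)"
    show "size s \<le> poly (p + q + [:4:]) (size x)" using s h[of x] by linarith
    show "(state x (eq_step s) \<and> size (eq_step s) \<le> size (?h x)) \<and>
        weight (eq_step s) < weight s" if "hd_tree s \<noteq> Leaf"
      using step[OF conjunct1[OF s] that] s by linarith
    show "s = Node Leaf (if f x = g x then Node Leaf Leaf else Leaf)" if "hd_tree s = Leaf"
      using s that by (auto simp: state_def)
  qed (intro ptime_eq_step ptime_Node ptime_const assms)+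
  from ptime_tl[OF this] show ?thesis unfolding dec_def by simp
qed

lemma dec_mem:
  assumes "ptime f" "ptime l"
  shows "dec (\<lambda>x. f x \<in> set (list_of_tree (l x)))"
proof -
  have "dec (\<lambda>x. \<exists>y\<in>set (list_of_tree (l x)). f x = y)"
    by (intro dec_bex dec_eq assms ptime_tl ptime_id ptime_comp[of f] ptime_hd)
  then show ?thesis by simp
qed

lemma ptime_remove_first:
  assumes "ptime l"
  shows "ptime (\<lambda>x. tree_of_list (filter (\<lambda>y. y \<noteq> hd_tree (l x)) (list_of_tree (l x))))"
  by (intro ptime_filter dec_not dec_eq assms ptime_tl ptime_id ptime_hd ptime_comp[of l])

text \<open>An input list may contain repetitions, so its length does not give the cardinality.
  Deleting all copies of the head lowers the cardinality by exactly one, and since \<open>k\<close>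
  is a constant, this recursion is unrolled in the program.\<close>

lemma dec_card_le:
  assumes "ptime l"
  shows "dec (\<lambda>x. card (set (list_of_tree (l x))) \<le> k)"
  using assms
proof (induction k arbitrary: l)
  case 0
  have "card (set (list_of_tree t)) = 0 \<longleftrightarrow> t = Leaf" for t by (cases t) auto
  then show ?case using dec_Leaf[OF 0] by simp
next
  case (Suc k)
  have *: "card (set (list_of_tree t)) \<le> Suc k \<longleftrightarrow>
    t = Leaf \<or> card (set (list_of_tree (tree_of_list (filter (\<lambda>y. y \<noteq> hd_tree t) (list_of_tree t))))) \<le> k" for t
  proof (cases t)
    case (Node a u)
    have "set (filter (\<lambda>y. y \<noteq> a) (list_of_tree u)) = set (list_of_tree t) - {a}" using Node by auto
    moreover have "card (set (list_of_tree t)) = Suc (card (set (list_of_tree t) - {a}))"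
      using Node by (intro card.remove) auto
    ultimately show ?thesis using Node by simp
  qed simp
  show ?case
    by (subst *) (intro dec_disj dec_Leaf Suc.prems Suc.IH ptime_remove_first)
qed

text \<open>A fixed number \<open>n\<close> of nested searches takes polynomial time, with a degree
  that depends on \<open>n\<close>. Each search hands the element it has found to the next one
  within the parameter.\<close>

lemma dec_tuple:
  assumes "ptime l" "dec (\<lambda>z. P (hd_tree z) (tl_tree z))"
  shows "dec (\<lambda>x. \<exists>ys. length ys = n \<and> set ys \<subseteq> set (list_of_tree (l x)) \<and> P x (tree_of_list ys))"
  using assms
proof (induction n arbitrary: l P)
  case 0
  show ?case using dec_comp[OF 0(2) ptime_Node[OF ptime_id ptime_const[of Leaf]]] by simp
next
  case (Suc n)
  have "dec (\<lambda>x. \<exists>y\<in>set (list_of_tree (l x)). (\<lambda>z. \<exists>ys. length ys = n \<and>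
      set ys \<subseteq> set (list_of_tree (l (hd_tree z))) \<and>
      (\<lambda>z ys. P (hd_tree z) (Node (tl_tree z) ys)) z (tree_of_list ys)) (Node x y))"
  proof (rule dec_bex[OF Suc.prems(1)], rule dec_comp[OF Suc.IH])
    show "dec (\<lambda>z. P (hd_tree (hd_tree z)) (Node (tl_tree (hd_tree z)) (tl_tree z)))"
      using dec_comp[OF Suc.prems(2), of "\<lambda>z. Node (hd_tree (hd_tree z)) (Node (tl_tree (hd_tree z)) (tl_tree z))"]
      by (simp add: ptime_Node ptime_hd ptime_tl ptime_id)
  qed (intro ptime_comp[OF Suc.prems(1)] ptime_Node ptime_hd ptime_tl ptime_id)+
  moreover have "(\<exists>ys. length ys = Suc n \<and> set ys \<subseteq> S \<and> Q (tree_of_list ys)) \<longleftrightarrow>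
      (\<exists>y\<in>S. \<exists>ys. length ys = n \<and> set ys \<subseteq> S \<and> Q (Node y (tree_of_list ys)))"
    (is "?A \<longleftrightarrow> ?B") for S Q
  proof
    assume ?A
    then obtain ys where ys: "length ys = Suc n" "set ys \<subseteq> S" "Q (tree_of_list ys)" by blast
    then obtain z zs where "ys = z # zs" by (cases ys) auto
    with ys show ?B by (intro bexI[of _ z] exI[of _ zs]) auto
  next
    assume ?B
    then obtain y ys where "y \<in> S" "length ys = n" "set ys \<subseteq> S" "Q (Node y (tree_of_list ys))" by blast
    then show ?A by (intro exI[of _ "y # ys"]) simp
  qed
  ultimately show ?case by simp
qed

section \<open>Least fixpoints inside a list\<close>

definition lfp_list :: "('a list \<Rightarrow> 'a \<Rightarrow> bool) \<Rightarrow> 'a list \<Rightarrow> 'a list" where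
  "lfp_list P U = foldr (\<lambda>_ S. filter (\<lambda>y. y \<in> set S \<or> P S y) U) U []"

text \<open>Every iterate is a sublist of \<open>U\<close>, so the accumulator never outgrows
  it.\<close>

lemma ptime_lfp_list:
  assumes U: "ptime U" and P: "dec (\<lambda>z. P (hd_tree z) (list_of_tree (hd_tree (tl_tree z))) (tl_tree (tl_tree z)))"
  shows "ptime (\<lambda>x. tree_of_list (lfp_list (P x) (list_of_tree (U x))))"
proof -
  obtain p :: "nat poly" where p: "\<And>x. size (U x) \<le> poly p (size x)" using ptime_size[OF U] by blast
  let ?f = "\<lambda>x _ S. tree_of_list (filter (\<lambda>y. y \<in> set (list_of_tree S) \<or> P x (list_of_tree S) y) (list_of_tree (U x)))"
  have *: "foldr (?f x) zs Leaf =
      tree_of_list (foldr (\<lambda>_ S. filter (\<lambda>y. y \<in> set S \<or> P x S y) (list_of_tree (U x))) zs [])" for x zs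
    by (induction zs) auto
  have "ptime (\<lambda>x. foldr (?f x) (list_of_tree (U x)) Leaf)"
  proof (rule ptime_foldr[where q = p and st = ?f])
    have "ptime (\<lambda>z. tree_of_list (filter ((\<lambda>z y. y \<in> set (list_of_tree (tl_tree z)) \<or>
        P (hd_tree z) (list_of_tree (tl_tree z)) y) z) (list_of_tree (U (hd_tree z)))))"
    proof (rule ptime_filter)
      show "dec (\<lambda>z. tl_tree z \<in> set (list_of_tree (tl_tree (hd_tree z))) \<or>
          P (hd_tree (hd_tree z)) (list_of_tree (tl_tree (hd_tree z))) (tl_tree z))"
        using dec_comp[OF P, of "\<lambda>z. Node (hd_tree (hd_tree z)) (Node (tl_tree (hd_tree z)) (tl_tree z))"]
        by (intro dec_disj dec_mem ptime_hd ptime_tl ptime_id) (simp add: ptime_Node ptime_hd ptime_tl ptime_id)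
    qed (intro ptime_comp[OF U] ptime_hd ptime_id)
    from ptime_comp[OF this, of "\<lambda>z. Node (hd_tree z) (tl_tree (tl_tree z))"]
    show "ptime (\<lambda>z. ?f (hd_tree z) (hd_tree (tl_tree z)) (tl_tree (tl_tree z)))"
      by (simp add: ptime_Node ptime_hd ptime_tl ptime_id)
    fix x ys zs
    show "size (foldr (?f x) zs Leaf) \<le> poly p (size x)"
      using size_filter_le[of _ "list_of_tree (U x)"] p[of x] by (cases zs) (auto intro: order_trans)
  qed (rule U ptime_const)+
  then show ?thesis by (simp add: * lfp_list_def)
qed

lemma set_lfp_list_subset: "set (lfp_list P U) \<subseteq> set U"
  unfolding lfp_list_def by (cases U) auto

lemma lfp_list_least:
  assumes "\<And>S y. y \<in> set U \<Longrightarrow> set S \<subseteq> Q \<Longrightarrow> P S y \<Longrightarrow> y \<in> Q"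
  shows "set (lfp_list P U) \<subseteq> Q"
proof -
  have "set (foldr (\<lambda>_ S. filter (\<lambda>y. y \<in> set S \<or> P S y) U) zs []) \<subseteq> Q" for zs
    by (induction zs) (use assms in auto)
  then show ?thesis by (simp add: lfp_list_def)
qed

text \<open>The list over which \<open>lfp_list\<close> folds only counts the rounds. Each round
  that is not stable adds an element, so \<open>length U\<close> rounds are enough. By monotonicity
  a round depends on the set of elements only, not on the list, so that stability persists.\<close>

lemma lfp_list_closed:
  assumes mono: "\<And>S T y. set S \<subseteq> set T \<Longrightarrow> P S y \<Longrightarrow> P T y"
    and y: "y \<in> set U" "P (lfp_list P U) y"
  shows "y \<in> set (lfp_list P U)"
proof -
  define F where "F S = filter (\<lambda>y. y \<in> set S \<or> P S y) U" for S
  define G where "G zs = foldr (\<lambda>_. F) zs []" for zs :: "'a list"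
  have sub: "set (G zs) \<subseteq> set U" for zs by (cases zs) (auto simp: G_def F_def)
  have inc: "set (G zs) \<subseteq> set (F (G zs))" for zs using sub by (auto simp: F_def)
  have F_cong: "F S = F T" if "set S = set T" for S T
    using mono[of S T] mono[of T S] that unfolding F_def by (intro filter_cong) auto
  have "length zs \<le> card (set (G zs)) \<or> set (F (G zs)) = set (G zs)" for zs
  proof (induction zs)
    case (Cons z zs)
    have G: "G (z # zs) = F (G zs)" by (simp add: G_def)
    show ?case
    proof (cases "set (F (G zs)) = set (G zs)")
      case True
      then show ?thesis using F_cong[OF True] G by simp
    next
      case False
      then have "card (set (G zs)) < card (set (F (G zs)))"
        using inc[of zs] by (intro psubset_card_mono) auto
      then show ?thesis using Cons False G by simp
    qed
  qed (simp add: G_def)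
  from this[of U] have "set (F (G U)) = set (G U)"
  proof
    assume "length U \<le> card (set (G U))"
    then have "card (set U) \<le> card (set (G U))" using card_length[of U] by simp
    then have "set (G U) = set U" using sub[of U] by (intro card_seteq) auto
    then show ?thesis using inc[of U] by (auto simp: F_def)
  qed
  moreover have "lfp_list P U = G U" unfolding lfp_list_def G_def F_def ..
  ultimately show ?thesis using y by (auto simp: F_def)
qed


section \<open>Regions\<close>

definition region :: "interaction set \<Rightarrow> ('s, 'e) ts \<Rightarrow> ('s \<Rightarrow> bool) \<Rightarrow> ('e \<Rightarrow> interaction) \<Rightarrow> bool" where
  "region \<tau> A sp sig \<longleftrightarrow> (\<forall>e \<in> events A. sig e \<in> \<tau>) \<and>
     (\<forall>s e s'. delta A s e = Some s' \<longrightarrow> sig e (sp s) = Some (sp s'))"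

definition separable :: "interaction set \<Rightarrow> ('s, 'e) ts \<Rightarrow> bool" where
  "separable \<tau> A \<longleftrightarrow>
     (\<forall>s \<in> states A. \<forall>s' \<in> states A. s \<noteq> s' \<longrightarrow> (\<exists>sp sig. region \<tau> A sp sig \<and> sp s \<noteq> sp s')) \<and>
     (\<forall>s \<in> states A. \<forall>e \<in> events A. delta A s e = None \<longrightarrow>
        (\<exists>sp sig. region \<tau> A sp sig \<and> sig e (sp s) = None))"

lemma ts_delta:
  assumes "is_ts A" "delta A s e = Some s'"
  shows "s \<in> states A" "e \<in> events A" "s' \<in> states A"
  using assms unfolding is_ts_def by blast+

lemma reachable_trans: "reachable d s t \<Longrightarrow> reachable d r s \<Longrightarrow> reachable d r t"
  by (induction rule: reachable.induct) (auto intro: reachable.step)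

lemma reachable_first: "d s e = Some s' \<Longrightarrow> reachable d s' t \<Longrightarrow> reachable d s t"
  using reachable_trans[OF _ reachable.step[OF reachable.start]] by metis

lemma fire_outside: "reachable (fire N) M0 M \<Longrightarrow> p \<notin> places N \<Longrightarrow> M p = M0 p"
  by (induction rule: reachable.induct) (auto simp: fire_def split: if_splits)

text \<open>Each place is a region: its content in the marking of a state is the support, its row of
  the flow the signature. Different markings differ at a place, and a transition that cannot fire is
  blocked at a place.\<close>

lemma separable_if_solvable:
  assumes A: "is_ts A" and "solvable \<tau> A"
  shows "separable \<tau> A"
proof -
  obtain N :: "(nat, 'b) net" where N: "is_net \<tau> N" "isomorphic A (reachability_graph N)"
    using assms(2) unfolding solvable_def by blast
  let ?B = "reachability_graph N"
  obtain \<phi> where ev: "events A = transitions N" and bij: "bij_betw \<phi> (states A) (states ?B)"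
    and iso: "\<And>s e s'. s \<in> states A \<Longrightarrow> e \<in> events A \<Longrightarrow> s' \<in> states A \<Longrightarrow>
      delta A s e = Some s' \<longleftrightarrow> delta ?B (\<phi> s) e = Some (\<phi> s')"
    using N(2) unfolding isomorphic_def by (auto simp: reachability_graph_def)
  have reach: "reachable (fire N) (marking0 N) (\<phi> s)" if "s \<in> states A" for s
    using bij that by (auto simp: bij_betw_def reachability_graph_def)
  have B: "delta ?B (\<phi> s) e = fire N (\<phi> s) e" if "s \<in> states A" for s e
    using reach[OF that] by (simp add: reachability_graph_def)
  have reg: "region \<tau> A (\<lambda>s. \<phi> s p) (flow N p)" if p: "p \<in> places N" for p
    unfolding region_def
  proof (intro conjI ballI allI impI)
    show "flow N p e \<in> \<tau>" if "e \<in> events A" for e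
      using N(1) p that ev by (auto simp: is_net_def)
    fix s e s' assume d: "delta A s e = Some s'"
    then have "fire N (\<phi> s) e = Some (\<phi> s')"
      using iso[of s e s'] B[of s e] ts_delta[OF A d] by simp
    then have "flow N p e (\<phi> s p) \<noteq> None" "\<phi> s' p = the (flow N p e (\<phi> s p))"
      using p by (auto simp: fire_def fun_eq_iff split: if_splits)
    then show "flow N p e (\<phi> s p) = Some (\<phi> s' p)" using p by simp
  qed
  show ?thesis unfolding separable_def
  proof (intro conjI ballI impI)
    fix s s' assume s: "s \<in> states A" "s' \<in> states A" "s \<noteq> s'"
    then have "\<phi> s \<noteq> \<phi> s'" using bij by (auto simp: bij_betw_def inj_on_def)
    then obtain p where p: "\<phi> s p \<noteq> \<phi> s' p" by auto
    then have "p \<in> places N" using fire_outside[OF reach] s by metis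
    then show "\<exists>sp sig. region \<tau> A sp sig \<and> sp s \<noteq> sp s'"
      using reg[of p] p by (intro exI[of _ "\<lambda>s. \<phi> s p"] exI[of _ "flow N p"]) simp
  next
    fix s e assume s: "s \<in> states A" "e \<in> events A" "delta A s e = None"
    have "fire N (\<phi> s) e = None"
    proof (rule ccontr)
      assume "fire N (\<phi> s) e \<noteq> None"
      then obtain M where M: "fire N (\<phi> s) e = Some M" by auto
      then have "M \<in> states ?B"
        using reach[OF s(1)] reachable.step[of "fire N"] by (auto simp: reachability_graph_def)
      then obtain s' where "s' \<in> states A" "M = \<phi> s'" using bij by (auto simp: bij_betw_def)
      then show False using iso[OF s(1,2), of s'] B[OF s(1)] M s(3) by simp
    qed
    then obtain p where p: "p \<in> places N" "flow N p e (\<phi> s p) = None"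
      using s(2) ev by (auto simp: fire_def split: if_splits)
    then show "\<exists>sp sig. region \<tau> A sp sig \<and> sig e (sp s) = None"
      using reg[of p] by (intro exI[of _ "\<lambda>s. \<phi> s p"] exI[of _ "flow N p"]) simp
  qed
qed

text \<open>One region is chosen for each pair of distinct states and for each event disabled at a
  state; these finitely many regions become the places of the net.\<close>

lemma solvable_if_separable:
  assumes A: "is_ts A" and sep: "separable \<tau> A"
  shows "solvable \<tau> A"
proof -
  let ?X = "{(s, s'). s \<in> states A \<and> s' \<in> states A \<and> s \<noteq> s'}"
  let ?Y = "{(s, e). s \<in> states A \<and> e \<in> events A \<and> delta A s e = None}"
  have "\<exists>R. region \<tau> A (fst R) (snd R) \<and> fst R (fst x) \<noteq> fst R (snd x)" if "x \<in> ?X" for x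
  proof -
    have "fst x \<in> states A" "snd x \<in> states A" "fst x \<noteq> snd x" using that by auto
    then obtain sp sig where "region \<tau> A sp sig" "sp (fst x) \<noteq> sp (snd x)"
      using sep unfolding separable_def by blast
    then show ?thesis by (intro exI[of _ "(sp, sig)"]) simp
  qed
  note exf = this
  define f where "f x = (SOME R. region \<tau> A (fst R) (snd R) \<and> fst R (fst x) \<noteq> fst R (snd x))" for x
  have f: "region \<tau> A (fst (f x)) (snd (f x)) \<and> fst (f x) (fst x) \<noteq> fst (f x) (snd x)" if "x \<in> ?X" for x
    unfolding f_def by (rule someI_ex[OF exf[OF that]])
  have "\<exists>R. region \<tau> A (fst R) (snd R) \<and> snd R (snd y) (fst R (fst y)) = None" if "y \<in> ?Y" for y
  proof -
    have "fst y \<in> states A" "snd y \<in> events A" "delta A (fst y) (snd y) = None" using that by auto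
    then obtain sp sig where "region \<tau> A sp sig" "sig (snd y) (sp (fst y)) = None"
      using sep unfolding separable_def by blast
    then show ?thesis by (intro exI[of _ "(sp, sig)"]) simp
  qed
  note exh = this
  define h where "h y = (SOME R. region \<tau> A (fst R) (snd R) \<and> snd R (snd y) (fst R (fst y)) = None)" for y
  have h: "region \<tau> A (fst (h y)) (snd (h y)) \<and> snd (h y) (snd y) (fst (h y) (fst y)) = None" if "y \<in> ?Y" for y
    unfolding h_def by (rule someI_ex[OF exh[OF that]])
  have "finite ?X" "finite ?Y"
    using A by (auto simp: is_ts_def intro: finite_subset[of _ "states A \<times> states A"]
        finite_subset[of _ "states A \<times> events A"])
  then have "finite (f ` ?X \<union> h ` ?Y)" by simp
  from finite_list[OF this] obtain rs where rs: "set rs = f ` ?X \<union> h ` ?Y" by (elim exE) (rule that)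
  have reg: "region \<tau> A (fst (rs ! p)) (snd (rs ! p))" if "p < length rs" for p
  proof -
    have "rs ! p \<in> f ` ?X \<union> h ` ?Y" using nth_mem[OF that] unfolding rs .
    then show ?thesis by (elim UnE imageE) (simp_all only: f h)
  qed
  \<comment> \<open>Off the places all values are \<open>False\<close>, and firing keeps them so;
    hence \<open>fire\<close> can be shown to commute with \<open>\<phi>\<close> as an equation
    between functions.\<close>
  define \<phi> where "\<phi> s = (\<lambda>p. p < length rs \<and> fst (rs ! p) s)" for s
  define N where "N = \<lparr>places = {..<length rs}, transitions = events A, marking0 = \<phi> (init A),
    flow = \<lambda>p. snd (rs ! p)\<rparr>"
  have N [simp]: "places N = {..<length rs}" "transitions N = events A" "marking0 N = \<phi> (init A)"
    "flow N p = snd (rs ! p)" for p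
    by (simp_all add: N_def)
  have inj: "inj_on \<phi> (states A)"
  proof (rule inj_onI, rule ccontr)
    fix s s' assume s: "s \<in> states A" "s' \<in> states A" "\<phi> s = \<phi> s'" "s \<noteq> s'"
    then have "f (s, s') \<in> set rs" unfolding rs by (intro UnI1 imageI) simp
    then obtain p where p: "p < length rs" "rs ! p = f (s, s')" by (auto simp: in_set_conv_nth)
    then have "\<phi> s p \<noteq> \<phi> s' p" using f[of "(s, s')"] s(1,2,4) by (simp add: \<phi>_def)
    then show False using s(3) by simp
  qed
  have fire: "fire N (\<phi> s) e = map_option \<phi> (delta A s e)" if s: "s \<in> states A" for s e
  proof (cases "e \<in> events A")
    case True
    show ?thesis
    proof (cases "delta A s e")
      case None
      then have "h (s, e) \<in> set rs" unfolding rs using s True by (intro UnI2 imageI) simp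
      then obtain p where p: "p < length rs" "rs ! p = h (s, e)" by (auto simp: in_set_conv_nth)
      then have "flow N p e (\<phi> s p) = None" using h[of "(s, e)"] s True None by (simp add: \<phi>_def)
      then show ?thesis using None p(1) by (auto simp: fire_def intro!: bexI[of _ p])
    next
      case (Some s')
      have "flow N p e (\<phi> s p) = Some (\<phi> s' p)" if "p < length rs" for p
        using reg[OF that] Some that by (auto simp: region_def \<phi>_def)
      then show ?thesis using Some True by (auto simp: fire_def \<phi>_def)
    qed
  next
    case False
    then have "delta A s e = None" using ts_delta(2)[OF A, of s e] by (cases "delta A s e") auto
    then show ?thesis using False by (simp add: fire_def)
  qed
  have init: "init A \<in> states A" using A by (simp add: is_ts_def)
  have "\<phi> s \<in> {M. reachable (fire N) (\<phi> (init A)) M}" if "s \<in> states A" for s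
  proof -
    have "reachable (delta A) (init A) s" using A that by (simp add: is_ts_def)
    then have "reachable (fire N) (\<phi> (init A)) (\<phi> s) \<and> s \<in> states A"
    proof (induction rule: reachable.induct)
      case (step s e s')
      then show ?case using fire[of s e] ts_delta(3)[OF A step(2)]
        by (auto intro: reachable.step[of "fire N"])
    qed (use init in \<open>auto intro: reachable.start\<close>)
    then show ?thesis by simp
  qed
  moreover have "M \<in> \<phi> ` states A" if "reachable (fire N) (\<phi> (init A)) M" for M
    using that
  proof (induction rule: reachable.induct)
    case (step M e M')
    then obtain s where s: "s \<in> states A" "M = \<phi> s" by blast
    then obtain s' where "delta A s e = Some s'" "M' = \<phi> s'" using fire[OF s(1), of e] step(2) by auto
    then show ?case using ts_delta(3)[OF A] by blast
  qed (use init in blast)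
  ultimately have states: "\<phi> ` states A = {M. reachable (fire N) (\<phi> (init A)) M}" by blast
  have "is_net \<tau> N"
    using A reg by (auto simp: is_net_def is_ts_def region_def)
  moreover have "isomorphic A (reachability_graph N)"
    unfolding isomorphic_def
  proof (intro conjI exI[of _ \<phi>] ballI)
    show "bij_betw \<phi> (states A) (states (reachability_graph N))"
      using inj states by (simp add: bij_betw_def reachability_graph_def)
    fix s e s' assume s: "s \<in> states A" "e \<in> events A" "s' \<in> states A"
    have "delta (reachability_graph N) (\<phi> s) e = fire N (\<phi> s) e"
      using states s(1) by (auto simp: reachability_graph_def)
    moreover have "t = s'" if "delta A s e = Some t" "\<phi> t = \<phi> s'" for t
      using inj_onD[OF inj that(2) ts_delta(3)[OF A that(1)] s(3)] .
    ultimately show "delta A s e = Some s' \<longleftrightarrow> delta (reachability_graph N) (\<phi> s) e = Some (\<phi> s')"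
      using fire[OF s(1), of e] by auto
  qed (simp_all add: reachability_graph_def)
  ultimately show ?thesis unfolding solvable_def by blast
qed

lemma solvable_iff_separable: "is_ts A \<Longrightarrow> solvable \<tau> A \<longleftrightarrow> separable \<tau> A"
  using solvable_if_separable separable_if_solvable by blast

lemma separable_mono: "separable \<tau> A \<Longrightarrow> \<tau> \<subseteq> \<tau>' \<Longrightarrow> separable \<tau>' A"
proof -
  assume "separable \<tau> A" "\<tau> \<subseteq> \<tau>'"
  moreover from this(2) have "region \<tau> A sp sig \<Longrightarrow> region \<tau>' A sp sig" for sp sig
    by (auto simp: region_def)
  ultimately show ?thesis unfolding separable_def by meson
qed

text \<open>Supports and signatures are composed with \<open>\<phi>\<close> and
  \<open>\<rho>\<close>. Several events of \<open>B\<close> may share an image under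
  \<open>\<rho>\<close>, so a system with many events of equal action can be compared with one that
  has a single copy.\<close>

lemma separable_pullback:
  assumes sep: "separable \<tau> A" and \<phi>: "inj_on \<phi> (states B)" "\<phi> ` states B \<subseteq> states A"
    and \<rho>: "\<rho> ` events B \<subseteq> events A"
    and B: "\<And>s e s'. delta B s e = Some s' \<Longrightarrow> s \<in> states B \<and> e \<in> events B"
    and eq: "\<And>s e. s \<in> states B \<Longrightarrow> e \<in> events B \<Longrightarrow> delta A (\<phi> s) (\<rho> e) = map_option \<phi> (delta B s e)"
  shows "separable \<tau> B"
proof -
  have reg: "region \<tau> B (sp \<circ> \<phi>) (sig \<circ> \<rho>)" if "region \<tau> A sp sig" for sp sig
    unfolding region_def
  proof (intro conjI ballI allI impI)
    show "(sig \<circ> \<rho>) e \<in> \<tau>" if "e \<in> events B" for e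
      using \<open>region \<tau> A sp sig\<close> that \<rho> by (auto simp: region_def)
    fix s e s' assume d: "delta B s e = Some s'"
    then have "delta A (\<phi> s) (\<rho> e) = Some (\<phi> s')" using eq[of s e] B[OF d] by simp
    then show "(sig \<circ> \<rho>) e ((sp \<circ> \<phi>) s) = Some ((sp \<circ> \<phi>) s')"
      using that by (simp add: region_def)
  qed
  show ?thesis unfolding separable_def
  proof (intro conjI ballI impI)
    fix s s' assume s: "s \<in> states B" "s' \<in> states B" "s \<noteq> s'"
    then have "\<phi> s \<in> states A" "\<phi> s' \<in> states A" "\<phi> s \<noteq> \<phi> s'" using \<phi> by (auto simp: inj_on_def)
    then obtain sp sig where "region \<tau> A sp sig" "sp (\<phi> s) \<noteq> sp (\<phi> s')"
      using sep unfolding separable_def by blast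
    then show "\<exists>sp sig. region \<tau> B sp sig \<and> sp s \<noteq> sp s'"
      using reg[of sp sig] by (intro exI[of _ "sp \<circ> \<phi>"] exI[of _ "sig \<circ> \<rho>"]) simp
  next
    fix s e assume s: "s \<in> states B" "e \<in> events B" "delta B s e = None"
    then have "\<phi> s \<in> states A" "\<rho> e \<in> events A" "delta A (\<phi> s) (\<rho> e) = None" using \<phi> \<rho> eq[OF s(1,2)] by auto
    then obtain sp sig where "region \<tau> A sp sig" "sig (\<rho> e) (sp (\<phi> s)) = None"
      using sep unfolding separable_def by blast
    then show "\<exists>sp sig. region \<tau> B sp sig \<and> sig e (sp s) = None"
      using reg[of sp sig] by (intro exI[of _ "sp \<circ> \<phi>"] exI[of _ "sig \<circ> \<rho>"]) simp
  qed
qed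

section \<open>Exchanging the two Boolean values\<close>

definition dual :: "interaction \<Rightarrow> interaction" where
  "dual i = (\<lambda>b. map_option Not (i (\<not> b)))"

lemma dual_simps [simp]:
  "dual NOP = NOP" "dual INP = OUT" "dual OUT = INP" "dual SET = RES" "dual RES = SET"
  "dual SWAP = SWAP" "dual USED = FREE" "dual FREE = USED"
  by (auto simp: dual_def fun_eq_iff NOP_def INP_def OUT_def SET_def RES_def SWAP_def USED_def FREE_def)

text \<open>Complementing the support of a region gives a region for the interactions conjugated
  with negation.\<close>

lemma separable_dual:
  assumes "separable \<tau> A"
  shows "separable (dual ` \<tau>) A"
proof -
  have reg: "region (dual ` \<tau>) A (Not \<circ> sp) (dual \<circ> sig)" if "region \<tau> A sp sig" for sp sig
    using that by (auto simp: region_def dual_def)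
  show ?thesis unfolding separable_def
  proof (intro conjI ballI impI)
    fix s s' assume s: "s \<in> states A" "s' \<in> states A" "s \<noteq> s'"
    then obtain sp sig where "region \<tau> A sp sig" "sp s \<noteq> sp s'"
      using assms unfolding separable_def by blast
    then show "\<exists>sp sig. region (dual ` \<tau>) A sp sig \<and> sp s \<noteq> sp s'"
      using reg[of sp sig] by (intro exI[of _ "Not \<circ> sp"] exI[of _ "dual \<circ> sig"]) simp
  next
    fix s e assume s: "s \<in> states A" "e \<in> events A" "delta A s e = None"
    then obtain sp sig where "region \<tau> A sp sig" "sig e (sp s) = None"
      using assms unfolding separable_def by blast
    then show "\<exists>sp sig. region (dual ` \<tau>) A sp sig \<and> sig e (sp s) = None"
      using reg[of sp sig] by (intro exI[of _ "Not \<circ> sp"] exI[of _ "dual \<circ> sig"]) (simp add: dual_def)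
  qed
qed


section \<open>Linear transition systems\<close>

lemma finite_arcs:
  assumes "is_ts A"
  shows "finite {(s', e). delta A s' e = Some s}" "finite {(e, s'). delta A s e = Some s'}"
proof -
  have fin: "finite (states A \<times> events A)" "finite (events A \<times> states A)"
    using assms by (auto simp: is_ts_def)
  show "finite {(s', e). delta A s' e = Some s}"
    by (rule finite_subset[OF _ fin(1)]) (use ts_delta[OF assms] in auto)
  show "finite {(e, s'). delta A s e = Some s'}"
    by (rule finite_subset[OF _ fin(2)]) (use ts_delta[OF assms] in auto)
qed

lemma g_boundedD:
  assumes "is_ts A" "g_bounded g A" "g \<le> k" "s \<in> states A"
  shows "card {(s', e). delta A s' e = Some s} \<le> k" "card {(e, s'). delta A s e = Some s'} \<le> k"
  using assms(2-) unfolding g_bounded_def by (auto intro: order_trans)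

lemma one_bounded:
  assumes A: "is_ts A" and "g_bounded g A" "g < 2"
  shows one_in: "delta A s e = Some t \<Longrightarrow> delta A u f = Some t \<Longrightarrow> s = u \<and> e = f"
    and one_out: "delta A s e = Some t \<Longrightarrow> delta A s f = Some u \<Longrightarrow> e = f \<and> t = u"
proof -
  have 1: "g \<le> Suc 0" using assms(3) by simp
  show "s = u \<and> e = f" if "delta A s e = Some t" "delta A u f = Some t"
    using g_boundedD(1)[OF A assms(2) 1 ts_delta(3)[OF A that(1)]] that
    unfolding card_le_Suc0_iff_eq[OF finite_arcs(1)[OF A]] by blast
  show "e = f \<and> t = u" if "delta A s e = Some t" "delta A s f = Some u"
    using g_boundedD(2)[OF A assms(2) 1 ts_delta(1)[OF A that(1)]] that
    unfolding card_le_Suc0_iff_eq[OF finite_arcs(2)[OF A]] by blast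
qed

lemma reachable_cases_first:
  assumes "reachable d s t" "s \<noteq> t"
  obtains e s' where "d s e = Some s'" "reachable d s' t"
proof -
  from assms(1) have "s = t \<or> (\<exists>e s'. d s e = Some s' \<and> reachable d s' t)"
    by (induction rule: reachable.induct) (blast intro: reachable.intros)+
  with assms(2) that show ?thesis by blast
qed

text \<open>With only one arc leaving each state, a path cannot branch: a proper path from
  \<open>t\<close> to \<open>s\<close> has to begin with the arc from \<open>t\<close> to
  \<open>t'\<close>.\<close>

lemma linear_order:
  assumes A: "is_ts A" "g_bounded g A" "g < 2" and s: "s \<in> states A" and t: "t \<in> states A"
  shows "reachable (delta A) s t \<or> reachable (delta A) t s"
proof -
  have "reachable (delta A) (init A) t" using A(1) t by (simp add: is_ts_def)
  then show ?thesis
  proof (induction rule: reachable.induct)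
    case start
    then show ?case using A(1) s by (simp add: is_ts_def)
  next
    case (step t e t')
    show ?case
    proof (cases "reachable (delta A) s t")
      case True
      then show ?thesis using reachable.step step(2) by metis
    next
      case False
      then have "reachable (delta A) t s" "t \<noteq> s" using step.IH reachable.start by auto
      then obtain f u where "delta A t f = Some u" "reachable (delta A) u s"
        by (rule reachable_cases_first)
      then show ?thesis using one_out[OF A step(2)] by blast
    qed
  qed
qed

text \<open>By determinism, equal sources make equally labelled arcs equal, so every label has at
  most one arc. In a 1-bounded system every cycle contains the initial state, so the second clause
  excludes all cycles but a loop at a lone state.\<close>

definition linear_labels :: "('s, 'e) ts \<Rightarrow> bool" where
  "linear_labels A \<longleftrightarrow>
     (\<forall>s e s' t t'. delta A s e = Some s' \<longrightarrow> delta A t e = Some t' \<longrightarrow> s = t) \<and>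
     (\<forall>s e. delta A s e = Some (init A) \<longrightarrow> states A = {init A})"

lemma only_init:
  assumes A: "is_ts A" "g_bounded g A" "g < 2" and loop: "delta A (init A) e = Some (init A)"
  shows "states A = {init A}"
proof -
  have "s = init A" if "reachable (delta A) (init A) s" for s
    using that by (induction rule: reachable.induct) (use one_out[OF A loop] in blast)+
  then show ?thesis using A(1) by (auto simp: is_ts_def)
qed

lemma antitone_region:
  assumes "is_ts A" "region {NOP, INP, USED, FREE} A sp sig" "reachable (delta A) s t" "sp t"
  shows "sp s"
  using assms(3,4)
proof (induction rule: reachable.induct)
  case (step t e t')
  then have "sig e \<in> {NOP, INP, USED, FREE}" "sig e (sp t) = Some (sp t')"
    using assms(2) ts_delta(2)[OF assms(1) step(2)] by (auto simp: region_def)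
  then show ?case using step by (auto simp: NOP_def INP_def USED_def FREE_def split: if_splits)
qed

lemma linear_labels_if_separable:
  assumes A: "is_ts A" "g_bounded g A" "g < 2" and sep: "separable {NOP, INP, USED, FREE} A"
  shows "linear_labels A"
proof -
  have init: "init A \<in> states A" and reach: "\<And>s. s \<in> states A \<Longrightarrow> reachable (delta A) (init A) s"
    using A(1) by (auto simp: is_ts_def)
  have no_in: "states A = {init A}" if "delta A s e = Some (init A)" for s e
  proof -
    have s: "s \<in> states A" using ts_delta(1)[OF A(1) that] .
    have "s = init A"
    proof (rule ccontr)
      assume "s \<noteq> init A"
      then obtain sp sig where R: "region {NOP, INP, USED, FREE} A sp sig" "sp s \<noteq> sp (init A)"
        using sep s init unfolding separable_def by blast
      have "reachable (delta A) s (init A)" using that reachable.step[OF reachable.start] by metis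
      then show False using antitone_region[OF A(1) R(1)] reach[OF s] R(2) by blast
    qed
    then show ?thesis using only_init[OF A] that by simp
  qed
  have "s = t" if st: "delta A s e = Some s'" "delta A t e = Some t'" for s e s' t t'
  proof (rule ccontr)
    assume ne: "s \<noteq> t"
    have s: "s \<in> states A" "e \<in> events A" "s' \<in> states A" and t: "t \<in> states A" "t' \<in> states A"
      using ts_delta[OF A(1) st(1)] ts_delta[OF A(1) st(2)] by auto
    \<comment> \<open>A loop takes up the single incoming arc of \<open>u\<close>, so
      \<open>u\<close> must be the initial state, and then no other state exists.\<close>
    have noloop: "u \<noteq> u'" if u: "delta A u f = Some u'" "u \<noteq> v" "v \<in> states A" for u f u' v
    proof
      assume "u = u'"
      have "x = u \<longrightarrow> u = init A" if "reachable (delta A) (init A) x" for x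
        using that
      proof (induction rule: reachable.induct)
        case (step x k y)
        then show ?case using one_in[OF A step(2), of u f] u(1) \<open>u = u'\<close> by auto
      qed simp
      from this[OF reach[OF ts_delta(1)[OF A(1) u(1)]]] have "u = init A" by simp
      then have "states A = {init A}" using no_in[of u f] u(1) \<open>u = u'\<close> by simp
      then show False using u(2,3) \<open>u = init A\<close> by simp
    qed
    \<comment> \<open>The region that separates the ends of the first arc must use
      \<open>INP\<close> for \<open>e\<close>. Then \<open>y\<close> needs support 1 although it
      lies behind \<open>x'\<close>, where the support is already 0.\<close>
    have False if xy: "delta A x e = Some x'" "delta A y e = Some y'" "x \<noteq> y" "reachable (delta A) x y" for x x' y y'
    proof -
      have mem: "x \<in> states A" "x' \<in> states A" "y \<in> states A"
        using xy ts_delta[OF A(1)] by auto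
      have "x \<noteq> x'" using noloop[OF xy(1,3) mem(3)] .
      then obtain sp sig where R: "region {NOP, INP, USED, FREE} A sp sig" "sp x \<noteq> sp x'"
        using sep mem unfolding separable_def by blast
      have e: "sig e (sp x) = Some (sp x')" "sig e (sp y) = Some (sp y')" "sig e \<in> {NOP, INP, USED, FREE}"
        using R(1) xy s(2) by (auto simp: region_def)
      then have *: "\<not> sp x'" "sp y"
        using R(2) by (auto simp: NOP_def INP_def USED_def FREE_def split: if_splits)
      obtain f u where "delta A x f = Some u" "reachable (delta A) u y"
        using reachable_cases_first[OF xy(4,3)] by blast
      then have "reachable (delta A) x' y" using one_out[OF A xy(1)] by blast
      then show False using antitone_region[OF A(1) R(1)] * by blast
    qed
    then show False using linear_order[OF A s(1) t(1)] st ne by metis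
  qed
  then show ?thesis unfolding linear_labels_def using no_in by blast
qed

text \<open>Events without any arc have to be inhibited as well: under the constant support 0,
  \<open>INP\<close> is enabled nowhere.\<close>

lemma dead_event_region:
  assumes A: "is_ts A" and dead: "\<And>s s'. delta A s e \<noteq> Some s'" and "{NOP, INP} \<subseteq> \<tau>"
  shows "region \<tau> A (\<lambda>_. False) ((\<lambda>_. NOP)(e := INP))"
  using assms by (auto simp: region_def NOP_def)

text \<open>Each arc defines a cut with 1 before and 0 behind it and with its own label as
  \<open>INP\<close>. This inhibits the label at all states behind the arc. At a state
  \<open>u\<close> before it, the cut at the arc leaving \<open>u\<close> is taken instead; there
  the label occurs on the 0 side only and can be \<open>FREE\<close>.\<close>

lemma separable_if_linear_labels:
  assumes A: "is_ts A" "g_bounded g A" "g < 2" and lin: "linear_labels A"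
  shows "separable {NOP, INP, FREE} A"
proof -
  let ?r = "reachable (delta A)"
  have init: "init A \<in> states A" and reach: "\<And>s. s \<in> states A \<Longrightarrow> ?r (init A) s"
    using A(1) by (auto simp: is_ts_def)
  have label: "s = t" if "delta A s e = Some s'" "delta A t e = Some t'" for s e s' t t'
    using lin that unfolding linear_labels_def by blast
  have dead: "\<exists>sp sig. region {NOP, INP, FREE} A sp sig \<and> sig e (sp s) = None"
    if "\<And>s s'. delta A s e \<noteq> Some s'" for s e
    using dead_event_region[OF A(1) that, of "{NOP, INP, FREE}"] by (intro exI) (auto simp: INP_def)
  show ?thesis
  proof (cases "states A = {init A}")
    case True
    have "delta A s e \<noteq> Some s'" if "delta A (init A) e = None" for s e s'
      using ts_delta(1)[OF A(1), of s e s'] True that by auto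
    then show ?thesis using dead True unfolding separable_def by simp
  next
    case False
    then have no_in: "delta A s e \<noteq> Some (init A)" for s e
      using lin unfolding linear_labels_def by blast
    \<comment> \<open>Predecessors are unique, so a cycle through \<open>s\<close> also runs through
      the predecessor of \<open>s\<close>. It is pushed back in this way to the initial state, which
      no arc enters.\<close>
    have acyclic: "\<not> ?r s' s" if "delta A s e = Some s'" for s e s'
    proof -
      have "?r (init A) s" using reach ts_delta(1)[OF A(1) that] by blast
      then show ?thesis using that
      proof (induction arbitrary: e s' rule: reachable.induct)
        case start
        show ?case
        proof
          assume "?r s' (init A)"
          then show False using start no_in by (cases rule: reachable.cases) auto
        qed
      next
        case (step p f s)
        show ?case
        proof
          assume "?r s' s"
          then have "?r s p"
          proof (cases rule: reachable.cases)
            case start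
            then show ?thesis using one_in[OF A step(2), of s e] step.prems reachable.start by auto
          next
            case (step q h)
            then have "?r s' p" using one_in[OF A \<open>delta A p f = Some s\<close>, of q h] by auto
            then show ?thesis using reachable_first[of "delta A" s e s' p] step.prems by blast
          qed
          then show False using step.IH[OF step(2)] by blast
        qed
      qed
    qed
    define sp where "sp x t \<longleftrightarrow> \<not> ?r x t" for x t
    \<comment> \<open>The arc labelled \<open>e\<close> is the only one into \<open>s'\<close>, so
      every arc with another label stays on one side of the cut.\<close>
    have pass: "sp s' t = sp s' t'" if "delta A s e = Some s'" "delta A t f = Some t'" "f \<noteq> e" for s e s' t f t'
    proof -
      have "?r s' t" if "?r s' t'"
        using that
      proof (cases rule: reachable.cases)
        case start
        then show ?thesis using one_in[OF A \<open>delta A s e = Some s'\<close>, of t f] \<open>delta A t f = Some t'\<close> \<open>f \<noteq> e\<close> by auto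
      next
        case (step q h)
        then show ?thesis using one_in[OF A \<open>delta A t f = Some t'\<close>, of q h] by auto
      qed
      then show ?thesis using reachable.step[of "delta A" s' t f t'] that(2) unfolding sp_def by blast
    qed
    have cross: "sp s' s" "\<not> sp s' s'" if "delta A s e = Some s'" for s e s'
      using acyclic[OF that] reachable.start unfolding sp_def by auto
    have reg: "region {NOP, INP, FREE} A (sp s') ((\<lambda>_. NOP)(e := INP))" if e: "delta A s e = Some s'" for s e s'
      unfolding region_def
    proof (intro conjI allI impI)
      fix t f t' assume t: "delta A t f = Some t'"
      show "((\<lambda>_. NOP)(e := INP)) f (sp s' t) = Some (sp s' t')"
        using pass[OF e t] label[OF e, of t t'] cross[OF e] t e
        by (cases "f = e") (auto simp: NOP_def INP_def)
    qed auto
    have reg_free: "region {NOP, INP, FREE} A (sp s') ((\<lambda>_. NOP)(e := INP, f := FREE))"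
      if e: "delta A s e = Some s'" and f: "delta A t f = Some t'" "?r s' t" for s e s' t f t'
      unfolding region_def
    proof (intro conjI allI impI)
      have "?r s' t'" using f reachable.step by metis
      then have nsp: "\<not> sp s' t" "\<not> sp s' t'" using f unfolding sp_def by auto
      fix u h u' assume u: "delta A u h = Some u'"
      show "((\<lambda>_. NOP)(e := INP, f := FREE)) h (sp s' u) = Some (sp s' u')"
        using pass[OF e u] label[OF e, of u u'] cross[OF e] u e label[OF f(1), of u u'] f nsp
        by (cases "h = e"; cases "h = f") (auto simp: NOP_def INP_def FREE_def)
    qed auto
    show ?thesis unfolding separable_def
    proof (intro conjI ballI impI)
      have *: "\<exists>sp sig. region {NOP, INP, FREE} A sp sig \<and> sp s \<noteq> sp t" if st: "?r s t" "s \<noteq> t" for s t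
      proof -
        obtain e s' where e: "delta A s e = Some s'" "?r s' t"
          using reachable_cases_first[OF st] by blast
        then have "sp s' s \<noteq> sp s' t" using cross[OF e(1)] unfolding sp_def by simp
        then show ?thesis using reg[OF e(1)] by (intro exI[of _ "sp s'"] exI[of _ "(\<lambda>_. NOP)(e := INP)"] conjI)
      qed
      fix s t assume "s \<in> states A" "t \<in> states A" "s \<noteq> t"
      then show "\<exists>sp sig. region {NOP, INP, FREE} A sp sig \<and> sp s \<noteq> sp t"
        using linear_order[OF A, of s t] *[of s t] *[of t s] by metis
    next
      fix u e assume u: "u \<in> states A" "e \<in> events A" "delta A u e = None"
      show "\<exists>sp sig. region {NOP, INP, FREE} A sp sig \<and> sig e (sp u) = None"
      proof (cases "\<exists>s s'. delta A s e = Some s'")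
        case False
        then show ?thesis by (intro dead) simp
      next
        case True
        then obtain s s' where e: "delta A s e = Some s'" by blast
        then have "u \<noteq> s" using u(3) by auto
        consider "?r s u" | "?r u s" using linear_order[OF A u(1) ts_delta(1)[OF A(1) e]] by blast
        then show ?thesis
        proof cases
          case 1
          obtain f v where "delta A s f = Some v" "?r v u"
            using reachable_cases_first[OF 1 \<open>u \<noteq> s\<close>[symmetric]] by blast
          then have "\<not> sp s' u" using one_out[OF A e] unfolding sp_def by blast
          then show ?thesis using reg[OF e]
            by (intro exI[of _ "sp s'"] exI[of _ "(\<lambda>_. NOP)(e := INP)"]) (simp add: INP_def)
        next
          case 2
          obtain f v where f: "delta A u f = Some v" "?r v s"
            using reachable_cases_first[OF 2 \<open>u \<noteq> s\<close>] by blast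
          have "f \<noteq> e" using u(3) f(1) by auto
          then show ?thesis using reg_free[OF f(1) e f(2)] cross(1)[OF f(1)]
            by (intro exI[of _ "sp v"] exI[of _ "(\<lambda>_. NOP)(f := INP, e := FREE)"]) (simp add: FREE_def)
        qed
      qed
    qed
  qed
qed


section \<open>Inference of regions without \<open>SWAP\<close>\<close>

text \<open>What a region of a type without \<open>SWAP\<close> is forced to do when the support values \<open>V0\<close>
  are prescribed and the events \<open>N0\<close> must not change their support: an event with targets of
  both values is neither \<open>SET\<close> nor \<open>RES\<close>, hence keeps the support constant along its arcs.\<close>

inductive forced :: "('s \<Rightarrow> 'e \<Rightarrow> 's option) \<Rightarrow> ('s \<Rightarrow> bool \<Rightarrow> bool) \<Rightarrow> ('e \<Rightarrow> bool) \<Rightarrow> 's \<Rightarrow> bool \<Rightarrow> bool"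
  and rigid :: "('s \<Rightarrow> 'e \<Rightarrow> 's option) \<Rightarrow> ('s \<Rightarrow> bool \<Rightarrow> bool) \<Rightarrow> ('e \<Rightarrow> bool) \<Rightarrow> 'e \<Rightarrow> bool"
  for d V0 N0 where
  given_value: "V0 t b \<Longrightarrow> forced d V0 N0 t b"
| given_event: "N0 e \<Longrightarrow> rigid d V0 N0 e"
| forward: "rigid d V0 N0 e \<Longrightarrow> d t e = Some t' \<Longrightarrow> forced d V0 N0 t b \<Longrightarrow> forced d V0 N0 t' b"
| backward: "rigid d V0 N0 e \<Longrightarrow> d t e = Some t' \<Longrightarrow> forced d V0 N0 t' b \<Longrightarrow> forced d V0 N0 t b"
| both_values: "d t e = Some t' \<Longrightarrow> d u e = Some u' \<Longrightarrow> forced d V0 N0 t' True \<Longrightarrow> forced d V0 N0 u' False \<Longrightarrow>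
    rigid d V0 N0 e"

definition consistent :: "('s \<Rightarrow> 'e \<Rightarrow> 's option) \<Rightarrow> ('s \<Rightarrow> bool \<Rightarrow> bool) \<Rightarrow> ('e \<Rightarrow> bool) \<Rightarrow> bool" where
  "consistent d V0 N0 \<longleftrightarrow> (\<forall>t. \<not> (forced d V0 N0 t True \<and> forced d V0 N0 t False))"

definition state_goal :: "'s \<Rightarrow> 's \<Rightarrow> 's \<Rightarrow> bool \<Rightarrow> bool" where
  "state_goal s s' t b \<longleftrightarrow> (if b then t = s else t = s')"

text \<open>The event is to be inhibited as \<open>USED\<close>: its sources carry 1, the state
  \<open>s\<close> carries 0. Since the rules treat both values alike, this goal also stands for the
  complementary choice \<open>FREE\<close>.\<close>

definition event_goal :: "('s \<Rightarrow> 'e \<Rightarrow> 's option) \<Rightarrow> 's \<Rightarrow> 'e \<Rightarrow> 's \<Rightarrow> bool \<Rightarrow> bool" where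
  "event_goal d s e t b \<longleftrightarrow> (if b then d t e \<noteq> None else t = s)"

definition looping :: "('s, 'e) ts \<Rightarrow> bool" where
  "looping A \<longleftrightarrow> (\<forall>s e s'. delta A s e = Some s' \<longrightarrow> delta A s' e = Some s')"

definition inferable :: "('s, 'e) ts \<Rightarrow> bool" where
  "inferable A \<longleftrightarrow> looping A \<and>
     (\<forall>s \<in> states A. \<forall>s' \<in> states A. s \<noteq> s' \<longrightarrow> consistent (delta A) (state_goal s s') (\<lambda>_. False)) \<and>
     (\<forall>s \<in> states A. \<forall>e \<in> events A. delta A s e = None \<longrightarrow>
        consistent (delta A) (event_goal (delta A) s e) (\<lambda>e'. e' = e))"

text \<open>A given region may realise a goal with the two values exchanged. \<open>pos\<close>
  records which way round it does, and the symmetry of the rules allows one induction for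
  both.\<close>

lemma forced_sound:
  assumes A: "is_ts A" and R: "region {NOP, SET, RES, USED, FREE} A sp sig"
    and V0: "\<And>t b. V0 t b \<Longrightarrow> sp t = (b = pos)"
    and N0: "\<And>e t t'. N0 e \<Longrightarrow> delta A t e = Some t' \<Longrightarrow> sp t' = sp t"
  shows "(forced (delta A) V0 N0 t b \<longrightarrow> sp t = (b = pos))"
    and "(rigid (delta A) V0 N0 e \<longrightarrow> (\<forall>t t'. delta A t e = Some t' \<longrightarrow> sp t' = sp t))"
proof -
  have arc: "sig e \<in> {NOP, SET, RES, USED, FREE} \<and> sig e (sp t) = Some (sp t')" if "delta A t e = Some t'" for t e t'
    using R that ts_delta(2)[OF A that] by (auto simp: region_def)
  have "(forced (delta A) V0 N0 t b \<longrightarrow> sp t = (b = pos)) \<and>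
    (rigid (delta A) V0 N0 e \<longrightarrow> (\<forall>t t'. delta A t e = Some t' \<longrightarrow> sp t' = sp t))"
  proof (induction rule: forced_rigid.induct)
    case (both_values t e t' u u')
    then have "sp t' \<noteq> sp u'" by auto
    moreover have "sig e \<in> {NOP, SET, RES, USED, FREE}" "sig e (sp t) = Some (sp t')" "sig e (sp u) = Some (sp u')"
      using arc both_values by auto
    ultimately have *: "sig e \<in> {NOP, USED, FREE}"
      by (auto simp: SET_def RES_def)
    show ?case
    proof (intro allI impI)
      fix x x' assume "delta A x e = Some x'"
      then show "sp x' = sp x"
        using arc[of x e x'] * by (auto simp: NOP_def USED_def FREE_def split: if_splits)
    qed
  qed (use V0 N0 in auto)
  then show "forced (delta A) V0 N0 t b \<longrightarrow> sp t = (b = pos)"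
    "rigid (delta A) V0 N0 e \<longrightarrow> (\<forall>t t'. delta A t e = Some t' \<longrightarrow> sp t' = sp t)" by auto
qed

lemma inferable_if_separable:
  assumes A: "is_ts A" and sep: "separable {NOP, SET, RES, USED, FREE} A"
  shows "inferable A"
proof -
  let ?\<tau> = "{NOP, SET, RES, USED, FREE}"
  have arc: "sig e \<in> ?\<tau> \<and> sig e (sp t) = Some (sp t')"
    if "region ?\<tau> A sp sig" "delta A t e = Some t'" for sp sig t e t'
    using that ts_delta(2)[OF A that(2)] by (auto simp: region_def)
  have idem: "sig e (sp t') = Some (sp t')" if "region ?\<tau> A sp sig" "delta A t e = Some t'" for sp sig t e t'
    using arc[OF that] by (auto simp: NOP_def SET_def RES_def USED_def FREE_def split: if_splits)
  have "looping A" unfolding looping_def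
  proof (intro allI impI)
    fix s e s' assume d: "delta A s e = Some s'"
    note mem = ts_delta[OF A d]
    obtain s'' where s'': "delta A s' e = Some s''"
    proof (cases "delta A s' e")
      case None
      then obtain sp sig where "region ?\<tau> A sp sig" "sig e (sp s') = None"
        using sep mem unfolding separable_def by blast
      then show ?thesis using idem[OF _ d, of sp sig] by simp
    qed
    have "s'' = s'"
    proof (rule ccontr)
      assume "s'' \<noteq> s'"
      then obtain sp sig where R: "region ?\<tau> A sp sig" "sp s'' \<noteq> sp s'"
        using sep mem(3) ts_delta(3)[OF A s''] unfolding separable_def by blast
      then show False using idem[OF R(1) d] arc[OF R(1) s''] by simp
    qed
    then show "delta A s' e = Some s'" using s'' by simp
  qed
  moreover have "consistent (delta A) (state_goal s s') (\<lambda>_. False)"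
    if s: "s \<in> states A" "s' \<in> states A" "s \<noteq> s'" for s s'
  proof -
    obtain sp sig where R: "region ?\<tau> A sp sig" "sp s \<noteq> sp s'"
      using sep s unfolding separable_def by blast
    have "forced (delta A) (state_goal s s') (\<lambda>_. False) t b \<longrightarrow> sp t = (b = sp s)" for t b
      by (rule forced_sound(1)[OF A R(1)]) (use R(2) in \<open>auto simp: state_goal_def split: if_splits\<close>)
    then show ?thesis unfolding consistent_def by metis
  qed
  moreover have "consistent (delta A) (event_goal (delta A) s e) (\<lambda>e'. e' = e)"
    if s: "s \<in> states A" "e \<in> events A" "delta A s e = None" for s e
  proof -
    obtain sp sig where R: "region ?\<tau> A sp sig" "sig e (sp s) = None"
      using sep s unfolding separable_def by blast
    have e: "sig e \<in> ?\<tau>" using R(1) s(2) by (auto simp: region_def)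
    \<comment> \<open>Only \<open>USED\<close> and \<open>FREE\<close> are ever undefined. Either
      way, all arcs of \<open>e\<close> preserve the support, and their ends carry the value
      opposite to that of \<open>s\<close>.\<close>
    then have "sig e = USED \<and> \<not> sp s \<or> sig e = FREE \<and> sp s"
      using R(2) by (auto simp: NOP_def SET_def RES_def USED_def FREE_def split: if_splits)
    then have const: "sp t = (\<not> sp s) \<and> sp t' = sp t" if "delta A t e = Some t'" for t t'
      using arc[OF R(1) that] by (auto simp: USED_def FREE_def split: if_splits)
    have "forced (delta A) (event_goal (delta A) s e) (\<lambda>e'. e' = e) t b \<longrightarrow> sp t = (b = (\<not> sp s))" for t b
      by (rule forced_sound(1)[OF A R(1)]) (use const in \<open>auto simp: event_goal_def split: if_splits\<close>)
    then show ?thesis unfolding consistent_def by metis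
  qed
  ultimately show ?thesis unfolding inferable_def by blast
qed

text \<open>Every non-loop arc \<open>x -h\<rightarrow> t\<close> comes with a loop \<open>t -h\<rightarrow> t\<close>, and these two already
  exhaust the in-degree of \<open>t\<close>.\<close>

lemma looping_in_arcs:
  assumes A: "is_ts A" "g_bounded g A" "g < 3" and "looping A"
    and t: "delta A x h = Some t" "x \<noteq> t" "delta A y k = Some t"
  shows "k = h \<and> (y = x \<or> y = t)"
proof (rule ccontr)
  assume ne: "\<not> (k = h \<and> (y = x \<or> y = t))"
  have "delta A t h = Some t" using assms(4) t(1) unfolding looping_def by blast
  then have "{(x, h), (t, h), (y, k)} \<subseteq> {(s, e). delta A s e = Some t}" using t by auto
  then have "card {(x, h), (t, h), (y, k)} \<le> card {(s, e). delta A s e = Some t}"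
    by (rule card_mono[OF finite_arcs(1)[OF A(1)]])
  also have "\<dots> \<le> 2" using g_boundedD(1)[OF A(1,2) _ ts_delta(3)[OF A(1) t(1)], of 2] A(3) by simp
  finally show False using t(2) ne by (auto simp: card_insert_if split: if_splits)
qed

text \<open>A proper arc into \<open>t\<close> settles the matter by the in-degree. An initial state
  may be entered by loops only; then some proper arc leaves it, and the out-degree admits just one
  loop besides. A lone state can carry two loops with different labels and is therefore
  excluded.\<close>

lemma looping_in_label:
  assumes A: "is_ts A" "g_bounded g A" "g < 3" and loops: "looping A" and "states A \<noteq> {t}"
    and t: "delta A x h = Some t" "delta A y k = Some t"
  shows "k = h"
proof (cases "x = t \<and> y = t")
  case False
  then show ?thesis using looping_in_arcs[OF A loops t(1) _ t(2)] looping_in_arcs[OF A loops t(2) _ t(1)] by metis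
next
  case True
  have tA: "t \<in> states A" using ts_delta(3)[OF A(1) t(1)] .
  then obtain s where s: "s \<in> states A" "s \<noteq> t" using assms(5) by blast
  show ?thesis
  proof (cases "t = init A")
    case False
    have "reachable (delta A) (init A) t" using A(1) tA by (simp add: is_ts_def)
    then obtain z l where "delta A z l = Some t" "z \<noteq> t"
    proof -
      have "t = init A \<or> (\<exists>z l. delta A z l = Some t \<and> z \<noteq> t)" if "reachable (delta A) (init A) t" for t
        using that
      proof (induction rule: reachable.induct)
        case (step s e s')
        then show ?case by (cases "s = s'") auto
      qed simp
      from this[OF \<open>reachable (delta A) (init A) t\<close>] show ?thesis using that False by blast
    qed
    then show ?thesis using looping_in_arcs[OF A loops] t by metis
  next
    case init: True
    have "reachable (delta A) t s" using A(1) s(1) init by (simp add: is_ts_def)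
    then have "\<exists>l z. delta A t l = Some z \<and> z \<noteq> t"
    proof -
      have "s = t \<or> (\<exists>l z. delta A t l = Some z \<and> z \<noteq> t)" if "reachable (delta A) t s" for s
        using that
      proof (induction rule: reachable.induct)
        case (step s e s')
        then show ?case by (cases "s = t") auto
      qed simp
      from this[OF \<open>reachable (delta A) t s\<close>] show ?thesis using s(2) by blast
    qed
    then obtain l z where z: "delta A t l = Some z" "z \<noteq> t" by blast
    show ?thesis
    proof (rule ccontr)
      assume "k \<noteq> h"
      have "{(h, t), (k, t), (l, z)} \<subseteq> {(e, s). delta A t e = Some s}" using t True z by auto
      then have "card {(h, t), (k, t), (l, z)} \<le> card {(e, s). delta A t e = Some s}"
        by (rule card_mono[OF finite_arcs(2)[OF A(1)]])
      also have "\<dots> \<le> 2" using g_boundedD(2)[OF A(1,2) _ tA, of 2] A(3) by simp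
      finally show False using z(2) \<open>k \<noteq> h\<close> by (auto simp: card_insert_if split: if_splits)
    qed
  qed
qed

text \<open>Extends the forced values by the value that is set by the unique event entering an
  undetermined component.\<close>

inductive spread :: "('s \<Rightarrow> 'e \<Rightarrow> 's option) \<Rightarrow> ('s \<Rightarrow> bool \<Rightarrow> bool) \<Rightarrow> ('e \<Rightarrow> bool) \<Rightarrow> 's \<Rightarrow> bool"
  for d V0 N0 where
  enter: "d x h = Some t \<Longrightarrow> \<not> rigid d V0 N0 h \<Longrightarrow> d y h = Some u \<Longrightarrow> forced d V0 N0 u True \<Longrightarrow>
    (\<And>b. \<not> forced d V0 N0 t b) \<Longrightarrow> spread d V0 N0 t"
| along: "spread d V0 N0 t \<Longrightarrow> rigid d V0 N0 h \<Longrightarrow> d t h = Some t' \<Longrightarrow> spread d V0 N0 t'"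

text \<open>A value forced at a state added by \<open>along\<close> would be passed back along the
  rigid arcs to the state added by \<open>enter\<close>, where nothing is forced.\<close>

lemma spread_unforced: "spread d V0 N0 t \<Longrightarrow> \<not> forced d V0 N0 t b"
  by (induction rule: spread.induct) (auto dest: backward)

text \<open>The support is 1 at the states forced to 1 and at the spread ones, and 0 elsewhere. An
  event that is not rigid never has forced targets of both values, so it becomes \<open>SET\<close>
  if some target is forced to 1 and \<open>RES\<close> otherwise; spreading makes its unforced
  targets comply.\<close>

lemma region_if_consistent:
  assumes A: "is_ts A" "g_bounded g A" "g < 3" and loops: "looping A"
    and cons: "consistent (delta A) V0 N0"
    and N0: "\<And>e t t'. N0 e \<Longrightarrow> delta A t e = Some t' \<Longrightarrow> V0 t True"
    and s: "s \<in> states A" "V0 s False"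
  shows "\<exists>sp sig. region {NOP, SET, RES, USED} A sp sig \<and> (\<forall>t b. V0 t b \<longrightarrow> sp t = b) \<and> (\<forall>e. N0 e \<longrightarrow> sig e = USED)"
proof -
  let ?F = "forced (delta A) V0 N0" and ?C = "rigid (delta A) V0 N0" and ?S = "spread (delta A) V0 N0"
  define sp where "sp t \<longleftrightarrow> ?F t True \<or> ?S t" for t
  define sig where "sig e = (if N0 e then USED else if ?C e then NOP
    else if \<exists>y u. delta A y e = Some u \<and> ?F u True then SET else RES)" for e
  \<comment> \<open>The prescribed 0 settles a lone state completely. So wherever a spread state
    exists, there are several states, and all arcs into it share one label.\<close>
  have single: "?F t False" if "states A = {t}" for t
    using s that by (auto intro: given_value)
  have forcedD: "sp t = b" if "?F t b" for t b
    using that cons spread_unforced[of "delta A" V0 N0 t b] unfolding sp_def consistent_def by (cases b) auto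
  \<comment> \<open>The support must not change along rigid arcs, so the spread set has to be closed
    backwards as well. The few arcs into \<open>u\<close> leave only two origins of the spread at
    \<open>u\<close>: the state \<open>t\<close> itself or a loop at \<open>u\<close>.\<close>
  have pull: "?S t" if "?S u" "?C h" "delta A t h = Some u" for t h u
  proof (cases "t = u")
    case False
    with that show ?thesis
    proof (induction rule: spread.induct)
      case (enter x h' u y v)
      then show ?case using looping_in_arcs[OF A loops enter.prems(2,3), of x h'] by simp
    next
      case (along t'' h' u)
      have "t'' = t \<or> t'' = u" using looping_in_arcs[OF A loops along.prems(2,3) along.hyps(3)] by simp
      then show ?case using along by blast
    qed
  qed (use that in simp)
  show ?thesis
  proof (intro exI conjI allI impI)
    show "region {NOP, SET, RES, USED} A sp sig" unfolding region_def
    proof (intro conjI ballI allI impI)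
      fix t h t' assume t: "delta A t h = Some t'"
      show "sig h (sp t) = Some (sp t')"
      proof (cases "?C h")
        case True
        have "sp t = sp t'"
          using forward[OF True t] backward[OF True t] spread.along[OF _ True t] pull[OF _ True t]
          unfolding sp_def by blast
        moreover have "sp t" if "N0 h" using forcedD[of t True] given_value[of V0 t True "delta A" N0] N0[OF that t] by simp
        ultimately show ?thesis using True by (auto simp: sig_def USED_def NOP_def)
      next
        case False
        then have "\<not> N0 h" by (auto intro: given_event)
        \<comment> \<open>For \<open>SET\<close> and \<open>RES\<close> the source does not matter;
          the value at the target has to agree with the choice of the signature. A spread target
          owes its value to \<open>h\<close>, as no other label enters it.\<close>
        have "sp t' \<longleftrightarrow> (\<exists>y u. delta A y h = Some u \<and> ?F u True)"
        proof
          assume "sp t'"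
          then consider "?F t' True" | "?S t'" unfolding sp_def by blast
          then show "\<exists>y u. delta A y h = Some u \<and> ?F u True"
          proof cases
            case 2
            then have "states A \<noteq> {t'}" using single spread_unforced by metis
            note label = looping_in_label[OF A loops this t]
            from 2 show ?thesis
            proof (cases rule: spread.cases)
              case (along t'' h')
              then show ?thesis using label False by metis
            qed (use label in metis)
          qed (use t in blast)
        next
          assume "\<exists>y u. delta A y h = Some u \<and> ?F u True"
          then obtain y u where u: "delta A y h = Some u" "?F u True" by blast
          show "sp t'"
          proof (cases "\<exists>b. ?F t' b")
            case True
            then obtain b where b: "?F t' b" by blast
            have b
            proof (rule ccontr)
              assume "\<not> b"
              then have "?F t' False" using b by simp
              then have "?C h" by (rule both_values[of "delta A", OF u(1) t u(2)])
              then show False using False by simp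
            qed
            then show ?thesis using forcedD[OF b] by simp
          next
            case no: False
            show ?thesis using spread.enter[of "delta A" t h t' V0 N0, OF t False u] no unfolding sp_def by blast
          qed
        qed
        then show ?thesis using False \<open>\<not> N0 h\<close> by (auto simp: sig_def SET_def RES_def)
      qed
    qed (simp add: sig_def)
    show "sp t = b" if "V0 t b" for t b using forcedD[of t b] given_value[of V0 t b "delta A" N0] that by simp
    show "sig e = USED" if "N0 e" for e using that by (simp add: sig_def)
  qed
qed

lemma separable_if_inferable:
  assumes A: "is_ts A" "g_bounded g A" "g < 3" and inf: "inferable A"
  shows "separable {NOP, SET, RES, USED} A"
  unfolding separable_def
proof (intro conjI ballI impI)
  have loops: "looping A" using inf by (simp add: inferable_def)
  fix s s' assume s: "s \<in> states A" "s' \<in> states A" "s \<noteq> s'"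
  have "consistent (delta A) (state_goal s s') (\<lambda>_. False)" using inf s unfolding inferable_def by blast
  from region_if_consistent[OF A loops this _ s(2)]
  obtain sp sig where "region {NOP, SET, RES, USED} A sp sig" "\<forall>t b. state_goal s s' t b \<longrightarrow> sp t = b"
    by (auto simp: state_goal_def)
  moreover from this(2) have "sp s = True" "sp s' = False"
    by (metis (full_types) state_goal_def)+
  ultimately show "\<exists>sp sig. region {NOP, SET, RES, USED} A sp sig \<and> sp s \<noteq> sp s'"
    by (intro exI[of _ sp] exI[of _ sig]) auto
next
  have loops: "looping A" using inf by (simp add: inferable_def)
  fix s e assume s: "s \<in> states A" "e \<in> events A" "delta A s e = None"
  have "consistent (delta A) (event_goal (delta A) s e) (\<lambda>e'. e' = e)" using inf s unfolding inferable_def by blast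
  from region_if_consistent[OF A loops this _ s(1)]
  obtain sp sig where "region {NOP, SET, RES, USED} A sp sig" "\<forall>t b. event_goal (delta A) s e t b \<longrightarrow> sp t = b" "sig e = USED"
    by (auto simp: event_goal_def)
  moreover from this(2) have "sp s = False" by (metis (full_types) event_goal_def)
  ultimately show "\<exists>sp sig. region {NOP, SET, RES, USED} A sp sig \<and> sig e (sp s) = None"
    by (intro exI[of _ sp] exI[of _ sig]) (auto simp: USED_def)
qed


section \<open>Transition systems with few states\<close>

text \<open>A region is determined by its support at the initial state and its signature on the events
  enabled there, and states are separated by regions.\<close>

lemma few_states:
  assumes A: "is_ts A" "g_bounded g A" and sep: "separable \<tau> A" and \<tau>: "finite \<tau>" "\<tau> \<noteq> {}"
    and live: "\<And>s e s'. delta A s e = Some s' \<Longrightarrow> delta A (init A) e \<noteq> None"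
  shows "card (states A) \<le> 2 ^ (2 * card \<tau> ^ g)"
proof -
  define E where "E = {e. delta A (init A) e \<noteq> None}"
  have init: "init A \<in> states A" using A(1) by (simp add: is_ts_def)
  have E: "E = fst ` {(e, s). delta A (init A) e = Some s}" by (force simp: E_def)
  have "finite E" unfolding E by (intro finite_imageI finite_arcs A)
  have "card E \<le> g" unfolding E
    by (rule order_trans[OF card_image_le[OF finite_arcs(2)[OF A(1)]]]) (use A(2) init in \<open>simp add: g_bounded_def\<close>)
  \<comment> \<open>Codes of regions: the initial value and the signature on the at most
    \<open>g\<close> events enabled initially. There are at most \<open>2 * card \<tau> ^ g\<close>
    of them.\<close>
  define D where "D = (UNIV :: bool set) \<times> (E \<rightarrow>\<^sub>E \<tau>)"
  have "finite D" unfolding D_def using \<open>finite E\<close> \<tau> by (simp add: finite_PiE)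
  \<comment> \<open>A state is identified by the codes of the regions whose support contains it,
    that is, by a subset of \<open>D\<close>; hence the outer power of two in the bound.\<close>
  define h where "h s = {(sp (init A), restrict sig E) | sp sig. region \<tau> A sp sig \<and> sp s}" for s
  have same: "sp s = sp' s" if R: "region \<tau> A sp sig" "region \<tau> A sp' sig'" and "sp (init A) = sp' (init A)"
    "restrict sig E = restrict sig' E" and s: "s \<in> states A" for sp sig sp' sig' s
  proof -
    have "reachable (delta A) (init A) s" using A(1) s by (simp add: is_ts_def)
    then show ?thesis
    proof (induction rule: reachable.induct)
      case (step s e s')
      then have "e \<in> E" using live by (auto simp: E_def)
      then have "sig e = sig' e" using that(4) by (metis restrict_apply')
      moreover have "sig e (sp s) = Some (sp s')" "sig' e (sp' s) = Some (sp' s')"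
        using R step(2) by (auto simp: region_def)
      ultimately show ?case using step.IH by simp
    qed (use that in simp)
  qed
  have hD: "h s \<subseteq> D" for s
  proof
    fix z assume "z \<in> h s"
    then obtain sp sig where z: "z = (sp (init A), restrict sig E)" "region \<tau> A sp sig" by (auto simp: h_def)
    have "E \<subseteq> events A" using ts_delta(2)[OF A(1)] by (auto simp: E_def)
    then show "z \<in> D" using z by (auto simp: D_def region_def)
  qed
  have sub: False if s: "s \<in> states A" "s' \<in> states A" "h s = h s'" and R: "region \<tau> A sp sig" "sp s" "\<not> sp s'" for s s' sp sig
  proof -
    have "(sp (init A), restrict sig E) \<in> h s"
      unfolding h_def by (rule CollectI, intro exI[of _ sp] exI[of _ sig] conjI refl R)
    then have "(sp (init A), restrict sig E) \<in> h s'" unfolding s(3) .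
    then obtain sp' sig' where "region \<tau> A sp' sig'" "sp' s'" "sp (init A) = sp' (init A)" "restrict sig E = restrict sig' E"
      by (auto simp: h_def)
    then show False using same[OF R(1), of sp' sig' s'] s(2) R(3) by simp
  qed
  have "inj_on h (states A)"
  proof (rule inj_onI, rule ccontr)
    fix s s' assume s: "s \<in> states A" "s' \<in> states A" "h s = h s'" "s \<noteq> s'"
    then obtain sp sig where "region \<tau> A sp sig" "sp s \<noteq> sp s'" using sep unfolding separable_def by blast
    then show False using sub[OF s(1-3)] sub[OF s(2,1) s(3)[symmetric]] by (cases "sp s") auto
  qed
  then have "card (states A) = card (h ` states A)" by (simp add: card_image)
  also have "\<dots> \<le> card (Pow D)" using hD \<open>finite D\<close> by (intro card_mono) auto
  also have "\<dots> = 2 ^ (2 * card \<tau> ^ card E)"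
    using \<open>finite D\<close> \<open>finite E\<close> by (simp add: card_Pow D_def card_cartesian_product card_PiE)
  also have "\<dots> \<le> 2 ^ (2 * card \<tau> ^ g)"
  proof -
    have "1 \<le> card \<tau>" using \<tau> by (simp add: Suc_le_eq card_gt_0_iff)
    then have "card \<tau> ^ card E \<le> card \<tau> ^ g" using \<open>card E \<le> g\<close> by (rule power_increasing[rotated])
    then show ?thesis by simp
  qed
  finally show ?thesis .
qed

text \<open>With these interactions a region can block \<open>e\<close> at the initial state only if
  the support is 0 there. As supports never rise, it is then 0 at every state, and the region would
  block \<open>e\<close> everywhere.\<close>

lemma live_at_init_decreasing:
  assumes A: "is_ts A" and sep: "separable {NOP, INP, USED} A" and d: "delta A s e = Some s'"
  shows "delta A (init A) e \<noteq> None"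
proof
  assume n: "delta A (init A) e = None"
  have init: "init A \<in> states A" and s: "s \<in> states A" "reachable (delta A) (init A) s"
    using A ts_delta(1)[OF A d] by (auto simp: is_ts_def)
  obtain sp sig where R: "region {NOP, INP, USED} A sp sig" "sig e (sp (init A)) = None"
    using sep n init ts_delta(2)[OF A d] unfolding separable_def by blast
  have R': "region {NOP, INP, USED, FREE} A sp sig" using R(1) by (auto simp: region_def)
  have e: "sig e \<in> {NOP, INP, USED}" "sig e (sp s) = Some (sp s')"
    using R(1) d ts_delta(2)[OF A d] by (auto simp: region_def)
  then have "\<not> sp (init A)" "sp s"
    using R(2) by (auto simp: NOP_def INP_def USED_def split: if_splits)
  then show False using antitone_region[OF A R' s(2)] by simp
qed

text \<open>All four interactions are total, so no region can block an event.\<close>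

lemma live_at_init_total:
  assumes A: "is_ts A" and sep: "separable {NOP, SET, RES, SWAP} A" and d: "delta A s e = Some s'"
  shows "delta A (init A) e \<noteq> None"
proof
  assume n: "delta A (init A) e = None"
  have "init A \<in> states A" using A by (auto simp: is_ts_def)
  then obtain sp sig where R: "region {NOP, SET, RES, SWAP} A sp sig" "sig e (sp (init A)) = None"
    using sep n ts_delta(2)[OF A d] unfolding separable_def by blast
  have "sig e \<in> {NOP, SET, RES, SWAP}" using R(1) ts_delta(2)[OF A d] by (auto simp: region_def)
  then show False using R(2) by (auto simp: NOP_def SET_def RES_def SWAP_def)
qed

text \<open>Without \<open>INP\<close> and \<open>OUT\<close>, an event that has just fired can fire again, so that in a
  1-bounded system no other event can follow.\<close>

lemma live_at_init_one_bounded: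
  assumes A: "is_ts A" "g_bounded g A" "g < 2" and sep: "separable {NOP, SET, RES, SWAP, USED, FREE} A"
    and d: "delta A s e = Some s'"
  shows "delta A (init A) e \<noteq> None"
proof -
  have again: "delta A t' f \<noteq> None" if t: "delta A t f = Some t'" for t f t'
  proof
    assume n: "delta A t' f = None"
    obtain sp sig where R: "region {NOP, SET, RES, SWAP, USED, FREE} A sp sig" "sig f (sp t') = None"
      using sep n ts_delta(2,3)[OF A(1) t] unfolding separable_def by blast
    have "sig f \<in> {NOP, SET, RES, SWAP, USED, FREE}" "sig f (sp t) = Some (sp t')"
      using R(1) t ts_delta(2)[OF A(1) t] by (auto simp: region_def)
    then show False using R(2)
      by (auto simp: NOP_def SET_def RES_def SWAP_def USED_def FREE_def split: if_splits)
  qed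
  have "reachable (delta A) (init A) s" using A(1) ts_delta(1)[OF A(1) d] by (simp add: is_ts_def)
  then show ?thesis using d
  proof (induction arbitrary: e s' rule: reachable.induct)
    case (step t f t')
    then obtain u where u: "delta A t' f = Some u" using again by blast
    then have "e = f" using one_out[OF A u step.prems] by simp
    then show ?case using step.IH[OF step(2)] by simp
  qed simp
qed

text \<open>The events are the actions on state numbers themselves. With \<open>F\<close> taken from
  \<open>partial_maps n\<close>, there are only finitely many such systems for each
  \<open>n\<close>, however many events the represented systems have.\<close>

definition canonical :: "nat \<Rightarrow> (nat \<Rightarrow> nat option) set \<Rightarrow> (nat, nat \<Rightarrow> nat option) ts" where
  "canonical n F = \<lparr>states = {..<n}, events = F, delta = \<lambda>i f. if i < n \<and> f \<in> F then f i else None, init = 0\<rparr>"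

text \<open>\<open>F\<close> may contain actions that no event of \<open>A\<close> has. Leaving out
  events preserves separability, so a match with a separable canonical system still shows that
  \<open>A\<close> is separable.\<close>

definition represents :: "'s list \<Rightarrow> (nat \<Rightarrow> nat option) set \<Rightarrow> ('s, 'e) ts \<Rightarrow> bool" where
  "represents ys F A \<longleftrightarrow> distinct ys \<and> set ys = states A \<and>
     (\<forall>e \<in> events A. \<exists>f \<in> F. \<forall>i < length ys. \<forall>j < length ys.
        delta A (ys ! i) e = Some (ys ! j) \<longleftrightarrow> f i = Some j)"

definition partial_maps :: "nat \<Rightarrow> (nat \<Rightarrow> nat option) set" where
  "partial_maps n = {f. dom f \<subseteq> {..<n} \<and> ran f \<subseteq> {..<n}}"

lemma finite_partial_maps: "finite (partial_maps n)"
proof -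
  have "partial_maps n \<subseteq> (\<Union>X\<in>Pow {..<n}. {f. dom f = X \<and> ran f \<subseteq> {..<n}})"
    by (auto simp: partial_maps_def)
  then show ?thesis
    by (rule finite_subset) (auto intro!: finite_set_of_finite_maps dest: finite_subset)
qed

lemma separable_if_represents:
  assumes A: "is_ts A" and ys: "represents ys F A" and F: "F \<subseteq> partial_maps (length ys)"
    and sep: "separable \<tau> (canonical (length ys) F)"
  shows "separable \<tau> A"
proof -
  let ?n = "length ys"
  have dist: "distinct ys" and set: "set ys = states A" using ys by (auto simp: represents_def)
  define \<phi> where "\<phi> s = (SOME i. i < ?n \<and> ys ! i = s)" for s
  have \<phi>: "\<phi> s < ?n" "ys ! \<phi> s = s" if "s \<in> states A" for s
  proof -
    have "\<exists>i. i < ?n \<and> ys ! i = s" using that set by (metis in_set_conv_nth)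
    from someI_ex[OF this] show "\<phi> s < ?n" "ys ! \<phi> s = s" unfolding \<phi>_def by auto
  qed
  have "\<exists>\<rho>. \<forall>e \<in> events A. \<rho> e \<in> F \<and> (\<forall>i < ?n. \<forall>j < ?n.
      delta A (ys ! i) e = Some (ys ! j) \<longleftrightarrow> \<rho> e i = Some j)"
    using ys unfolding represents_def by (intro bchoice) blast
  then obtain \<rho> where \<rho>: "\<And>e. e \<in> events A \<Longrightarrow> \<rho> e \<in> F" "\<And>e i j. e \<in> events A \<Longrightarrow> i < ?n \<Longrightarrow> j < ?n \<Longrightarrow>
      delta A (ys ! i) e = Some (ys ! j) \<longleftrightarrow> \<rho> e i = Some j" by blast
  show ?thesis
  proof (rule separable_pullback[OF sep])
    show "inj_on \<phi> (states A)" using \<phi>(2) by (metis inj_onI)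
    show "\<phi> ` states A \<subseteq> states (canonical ?n F)" using \<phi>(1) by (auto simp: canonical_def)
    show "\<rho> ` events A \<subseteq> events (canonical ?n F)" using \<rho>(1) by (auto simp: canonical_def)
    show "s \<in> states A \<and> e \<in> events A" if "delta A s e = Some s'" for s e s'
      using ts_delta[OF A that] by simp
    fix s e assume s: "s \<in> states A" "e \<in> events A"
    have c: "delta (canonical ?n F) (\<phi> s) (\<rho> e) = \<rho> e (\<phi> s)"
      using \<phi>(1)[OF s(1)] \<rho>(1)[OF s(2)] by (simp add: canonical_def)
    show "delta (canonical ?n F) (\<phi> s) (\<rho> e) = map_option \<phi> (delta A s e)"
    proof (cases "delta A s e")
      case (Some s')
      then show ?thesis using \<rho>(2)[OF s(2) \<phi>(1)[OF s(1)], of "\<phi> s'"] \<phi> s(1) ts_delta(3)[OF A Some] c by simp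
    next
      case None
      \<comment> \<open>An arc of the canonical system leads to an index below \<open>?n\<close> and
        would therefore come from an arc of \<open>A\<close>.\<close>
      have "\<rho> e (\<phi> s) = None"
      proof (rule ccontr)
        assume "\<rho> e (\<phi> s) \<noteq> None"
        then obtain j where j: "\<rho> e (\<phi> s) = Some j" by blast
        then have "j \<in> ran (\<rho> e)" by (rule ranI)
        then have "j < ?n" using F \<rho>(1)[OF s(2)] by (auto simp: partial_maps_def)
        then show False using \<rho>(2)[OF s(2) \<phi>(1)[OF s(1)], of j] \<phi>(2)[OF s(1)] j None by simp
      qed
      then show ?thesis using c None by simp
    qed
  qed
qed

lemma represents_if_separable:
  assumes A: "is_ts A" and sep: "separable \<tau> A"
  obtains ys F where "represents ys F A" "length ys = card (states A)" "F \<subseteq> partial_maps (length ys)"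
    "separable \<tau> (canonical (length ys) F)"
proof -
  have "finite (states A)" using A by (simp add: is_ts_def)
  then obtain ys where ys: "set ys = states A" "distinct ys" using finite_distinct_list by blast
  let ?n = "length ys"
  define idx where "idx s = (SOME i. i < ?n \<and> ys ! i = s)" for s
  have idx: "idx s < ?n" "ys ! idx s = s" if "s \<in> states A" for s
  proof -
    have "\<exists>i. i < ?n \<and> ys ! i = s" using that ys(1) by (metis in_set_conv_nth)
    from someI_ex[OF this] show "idx s < ?n" "ys ! idx s = s" unfolding idx_def by auto
  qed
  have idx_nth: "idx (ys ! i) = i" if "i < ?n" for i
    using idx[of "ys ! i"] that ys by (metis nth_eq_iff_index_eq nth_mem)
  define m where "m e i = (if i < ?n then map_option idx (delta A (ys ! i) e) else None)" for e i
  define F where "F = m ` events A"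
  have F: "F \<subseteq> partial_maps ?n"
  proof
    fix f assume "f \<in> F"
    then obtain e where f: "f = m e" by (auto simp: F_def)
    have "j < ?n" if "m e i = Some j" for i j
      using that idx(1) ts_delta(3)[OF A] by (auto simp: m_def split: if_splits)
    moreover have "i < ?n" if "m e i = Some j" for i j
      using that by (auto simp: m_def split: if_splits)
    ultimately show "f \<in> partial_maps ?n" unfolding f partial_maps_def
      by (auto simp: ran_def)
  qed
  show ?thesis
  proof (rule that[OF _ _ F])
    show "represents ys F A" unfolding represents_def
    proof (intro conjI ballI)
      fix e assume "e \<in> events A"
      then have "m e \<in> F" by (simp add: F_def)
      moreover have "delta A (ys ! i) e = Some (ys ! j) \<longleftrightarrow> m e i = Some j" if ij: "i < ?n" "j < ?n" for i j
      proof
        assume "delta A (ys ! i) e = Some (ys ! j)"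
        then show "m e i = Some j" using ij idx_nth by (simp add: m_def)
      next
        assume "m e i = Some j"
        then obtain s' where "delta A (ys ! i) e = Some s'" "idx s' = j" using ij(1) by (auto simp: m_def)
        then show "delta A (ys ! i) e = Some (ys ! j)" using idx(2) ts_delta(3)[OF A] by auto
      qed
      ultimately show "\<exists>f \<in> F. \<forall>i < ?n. \<forall>j < ?n. delta A (ys ! i) e = Some (ys ! j) \<longleftrightarrow> f i = Some j" by blast
    qed (use ys in auto)
    show "?n = card (states A)" using ys by (metis distinct_card)
    have "\<exists>\<rho>. \<forall>f \<in> F. \<rho> f \<in> events A \<and> m (\<rho> f) = f"
      by (intro bchoice) (auto simp: F_def)
    then obtain \<rho> where \<rho>: "\<And>f. f \<in> F \<Longrightarrow> \<rho> f \<in> events A" "\<And>f. f \<in> F \<Longrightarrow> m (\<rho> f) = f" by blast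
    show "separable \<tau> (canonical ?n F)"
    proof (rule separable_pullback[OF sep, of "(!) ys" _ \<rho>])
      show "inj_on ((!) ys) (states (canonical ?n F))"
        using ys by (auto simp: canonical_def inj_on_def nth_eq_iff_index_eq)
      show "(!) ys ` states (canonical ?n F) \<subseteq> states A"
      proof (rule image_subsetI)
        fix i assume "i \<in> states (canonical ?n F)"
        then have "i < ?n" by (simp add: canonical_def)
        then have "ys ! i \<in> set ys" by (rule nth_mem)
        then show "ys ! i \<in> states A" unfolding ys(1) .
      qed
      show "\<rho> ` events (canonical ?n F) \<subseteq> events A" using \<rho>(1) by (auto simp: canonical_def)
      show "i \<in> states (canonical ?n F) \<and> f \<in> events (canonical ?n F)"
        if d: "delta (canonical ?n F) i f = Some j" for i f j
        using d by (auto simp: canonical_def split: if_splits)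
      fix i f assume "i \<in> states (canonical ?n F)" "f \<in> events (canonical ?n F)"
      then have i: "i < ?n" "f \<in> F" by (auto simp: canonical_def)
      have "delta A (ys ! i) (\<rho> f) = map_option ((!) ys) (m (\<rho> f) i)"
        using i(1) idx(2) ts_delta(3)[OF A, of "ys ! i" "\<rho> f"]
        by (cases "delta A (ys ! i) (\<rho> f)") (auto simp: m_def)
      then show "delta A (ys ! i) (\<rho> f) = map_option ((!) ys) (delta (canonical ?n F) i f)"
        using i \<rho>(2) by (simp add: canonical_def)
    qed
  qed
qed


section \<open>Decoding the input\<close>

lemmas dec_intros = ptime_const ptime_id ptime_Node ptime_hd ptime_tl dec_const dec_conj dec_disj
  dec_imp dec_iff dec_not dec_eq dec_mem dec_bex dec_ball dec_card_le

abbreviation (input) states_of :: "tree \<Rightarrow> tree" where "states_of x \<equiv> hd_tree x"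
abbreviation (input) events_of :: "tree \<Rightarrow> tree" where "events_of x \<equiv> hd_tree (tl_tree x)"
abbreviation (input) arcs_of :: "tree \<Rightarrow> tree" where "arcs_of x \<equiv> hd_tree (tl_tree (tl_tree x))"
abbreviation (input) init_of :: "tree \<Rightarrow> tree" where "init_of x \<equiv> tl_tree (tl_tree (tl_tree x))"

abbreviation (input) source :: "tree \<Rightarrow> tree" where "source a \<equiv> hd_tree a"
abbreviation (input) label :: "tree \<Rightarrow> tree" where "label a \<equiv> hd_tree (tl_tree a)"
abbreviation (input) target :: "tree \<Rightarrow> tree" where "target a \<equiv> tl_tree (tl_tree a)"

abbreviation elems :: "tree \<Rightarrow> tree set" where "elems t \<equiv> set (list_of_tree t)"

definition arc :: "tree \<Rightarrow> tree \<Rightarrow> tree \<Rightarrow> tree \<Rightarrow> bool" where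
  "arc x s e s' \<longleftrightarrow> Node s (Node e s') \<in> elems (arcs_of x)"

definition decoded :: "tree \<Rightarrow> (tree, tree) ts" where
  "decoded x = \<lparr>states = elems (states_of x), events = elems (events_of x),
     delta = \<lambda>s e. if \<exists>s'. arc x s e s' then Some (SOME s'. arc x s e s') else None, init = init_of x\<rparr>"

definition well_formed :: "tree \<Rightarrow> bool" where
  "well_formed x \<longleftrightarrow> x \<noteq> Leaf \<and> tl_tree x \<noteq> Leaf \<and> tl_tree (tl_tree x) \<noteq> Leaf \<and>
     (\<forall>a\<in>elems (arcs_of x). a \<noteq> Leaf \<and> tl_tree a \<noteq> Leaf) \<and>
     (\<forall>a\<in>elems (arcs_of x). \<forall>b\<in>elems (arcs_of x).
        source a = source b \<and> label a = label b \<longrightarrow> target a = target b)"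

lemma dec_well_formed: "dec well_formed"
  unfolding well_formed_def by (intro dec_intros)

lemma Node_hd_tl: "t \<noteq> Leaf \<Longrightarrow> Node (hd_tree t) (tl_tree t) = t"
  by (cases t) auto

lemma arc_tree:
  assumes "well_formed x" "a \<in> elems (arcs_of x)"
  shows "Node (source a) (Node (label a) (target a)) = a"
proof -
  have "a \<noteq> Leaf" "tl_tree a \<noteq> Leaf" using assms unfolding well_formed_def by blast+
  then show ?thesis by (simp add: Node_hd_tl)
qed

lemma arc_iff: "well_formed x \<Longrightarrow> a \<in> elems (arcs_of x) \<Longrightarrow> arc x (source a) (label a) (target a)"
  by (simp add: arc_def arc_tree)

text \<open>Programs quantify over the trees in the arc list, the notions of transition systems over
  triples. This equivalence and the next one translate between the two.\<close>

lemma ex_arc: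
  assumes "well_formed x"
  shows "(\<exists>a\<in>elems (arcs_of x). P (source a) (label a) (target a)) \<longleftrightarrow> (\<exists>s e s'. arc x s e s' \<and> P s e s')"
  using arc_iff[OF assms] unfolding arc_def by force

lemma all_arc:
  assumes "well_formed x"
  shows "(\<forall>a\<in>elems (arcs_of x). P (source a) (label a) (target a)) \<longleftrightarrow> (\<forall>s e s'. arc x s e s' \<longrightarrow> P s e s')"
  using arc_iff[OF assms] unfolding arc_def by force

lemma decoded_simps [simp]:
  "states (decoded x) = elems (states_of x)" "events (decoded x) = elems (events_of x)"
  "init (decoded x) = init_of x"
  by (simp_all add: decoded_def)

lemma delta_decoded:
  assumes "well_formed x"
  shows "delta (decoded x) s e = Some s' \<longleftrightarrow> arc x s e s'"
proof -
  have uniq: "t = s'" if "arc x s e t" "arc x s e s'" for t s'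
    using assms that unfolding well_formed_def arc_def by fastforce
  show ?thesis
  proof
    assume "delta (decoded x) s e = Some s'"
    then show "arc x s e s'" by (auto simp: decoded_def split: if_splits intro: someI)
  next
    assume a: "arc x s e s'"
    then have "(SOME s'. arc x s e s') = s'" using uniq by (intro some_equality) auto
    then show "delta (decoded x) s e = Some s'" using a by (auto simp: decoded_def)
  qed
qed

text \<open>A tree determines the system that it encodes, so the existential quantifier in
  \<open>solvability_problem\<close> reduces to the single candidate
  \<open>decoded x\<close>.\<close>

lemma encodes_iff: "encodes x A \<longleftrightarrow> well_formed x \<and> A = decoded x"
proof
  assume "encodes x A"
  then obtain ss es arcs where e: "set ss = states A" "set es = events A"
    "set arcs = {(s, e, s'). delta A s e = Some s'}"
    and x: "x = Node (tree_of_list ss) (Node (tree_of_list es)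
      (Node (tree_of_list (map (\<lambda>(s, e, s'). Node s (Node e s')) arcs)) (init A)))"
    unfolding encodes_def by blast
  have arcs: "arc x s e s' \<longleftrightarrow> delta A s e = Some s'" for s e s'
  proof -
    have "arc x s e s' \<longleftrightarrow> (s, e, s') \<in> set arcs" by (force simp: arc_def x)
    then show ?thesis using e(3) by simp
  qed
  have wf: "well_formed x"
    unfolding well_formed_def using e(3) by (auto simp: x)
  have "delta A = delta (decoded x)"
  proof (intro ext)
    fix s e show "delta A s e = delta (decoded x) s e"
      using arcs[of s e] delta_decoded[OF wf, of s e]
      by (cases "delta A s e"; cases "delta (decoded x) s e") auto
  qed
  then have "A = decoded x" using e by (intro ts.equality) (auto simp: x)
  with wf show "well_formed x \<and> A = decoded x" ..
next
  assume "well_formed x \<and> A = decoded x"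
  then have wf: "well_formed x" and A: "A = decoded x" by auto
  let ?arcs = "map (\<lambda>a. (source a, label a, target a)) (list_of_tree (arcs_of x))"
  have m: "map (\<lambda>(s, e, s'). Node s (Node e s')) ?arcs = list_of_tree (arcs_of x)"
    by (simp add: map_idI arc_tree[OF wf])
  show "encodes x A" unfolding encodes_def
  proof (intro exI conjI)
    show "set (list_of_tree (states_of x)) = states A" "set (list_of_tree (events_of x)) = events A"
      by (simp_all add: A)
    show "set ?arcs = {(s, e, s'). delta A s e = Some s'}"
      using arc_iff[OF wf] by (force simp: A delta_decoded[OF wf] arc_def)
    show "x = Node (tree_of_list (list_of_tree (states_of x))) (Node (tree_of_list (list_of_tree (events_of x)))
      (Node (tree_of_list (map (\<lambda>(s, e, s'). Node s (Node e s')) ?arcs)) (init A)))"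
    proof -
      have "x \<noteq> Leaf" "tl_tree x \<noteq> Leaf" "tl_tree (tl_tree x) \<noteq> Leaf" using wf unfolding well_formed_def by blast+
      then show ?thesis unfolding m tree_of_list_of_tree A decoded_simps by (simp add: Node_hd_tl)
    qed
  qed
qed

lemma solvability_problem_iff:
  "x \<in> solvability_problem \<tau> g \<longleftrightarrow>
     well_formed x \<and> is_ts (decoded x) \<and> g_bounded g (decoded x) \<and> separable \<tau> (decoded x)"
  unfolding solvability_problem_def encodes_iff using solvable_iff_separable by auto

section \<open>Recognising encodings of bounded transition systems\<close>

definition reached :: "tree \<Rightarrow> tree list" where
  "reached x = lfp_list (\<lambda>S y. y = init_of x \<or> (\<exists>a\<in>elems (arcs_of x). target a = y \<and> source a \<in> set S))
     (list_of_tree (states_of x))"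

lemma ptime_reached: "ptime (\<lambda>x. tree_of_list (reached x))"
  unfolding reached_def by (intro ptime_lfp_list dec_intros)

text \<open>The fixpoint is taken inside the list of states. No reachable state is lost, since the
  initial state and the targets of all arcs are listed; \<open>ts_check\<close> tests this
  separately.\<close>

lemma set_reached:
  assumes wf: "well_formed x" and ends: "\<And>s e s'. arc x s e s' \<Longrightarrow> s' \<in> elems (states_of x)"
    and init: "init_of x \<in> elems (states_of x)"
  shows "s \<in> set (reached x) \<longleftrightarrow> reachable (delta (decoded x)) (init_of x) s"
proof
  let ?P = "\<lambda>S y. y = init_of x \<or> (\<exists>a\<in>elems (arcs_of x). target a = y \<and> source a \<in> set S)"
  have "set (reached x) \<subseteq> {s. reachable (delta (decoded x)) (init_of x) s}"
    unfolding reached_def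
  proof (rule lfp_list_least)
    fix S y
    assume S: "set S \<subseteq> {s. reachable (delta (decoded x)) (init_of x) s}" and "?P S y"
    then consider "y = init_of x" | a where "a \<in> elems (arcs_of x)" "target a = y" "source a \<in> set S" by blast
    then show "y \<in> {s. reachable (delta (decoded x)) (init_of x) s}"
    proof cases
      case 1
      then show ?thesis by (simp add: reachable.start)
    next
      case 2
      then have "delta (decoded x) (source a) (label a) = Some y"
        using arc_iff[OF wf] delta_decoded[OF wf] by blast
      moreover have "reachable (delta (decoded x)) (init_of x) (source a)" using S 2 by blast
      ultimately show ?thesis by (simp add: reachable.step)
    qed
  qed
  then show "reachable (delta (decoded x)) (init_of x) s" if "s \<in> set (reached x)" using that by blast
  show "s \<in> set (reached x)" if "reachable (delta (decoded x)) (init_of x) s"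
    using that
  proof (induction rule: reachable.induct)
    case start
    show ?case unfolding reached_def by (rule lfp_list_closed) (use init in auto)
  next
    case (step s e s')
    then have "arc x s e s'" using delta_decoded[OF wf] by simp
    then have "s' \<in> elems (states_of x)" "\<exists>a\<in>elems (arcs_of x). target a = s' \<and> source a \<in> set (reached x)"
      using ends step.IH ex_arc[OF wf, of "\<lambda>s e t. t = s' \<and> s \<in> set (reached x)"] by blast+
    then show ?case unfolding reached_def by (intro lfp_list_closed[where P = ?P]) auto
  qed
qed

definition ts_check :: "tree \<Rightarrow> bool" where
  "ts_check x \<longleftrightarrow> init_of x \<in> elems (states_of x) \<and>
     (\<forall>a\<in>elems (arcs_of x). source a \<in> elems (states_of x) \<and> label a \<in> elems (events_of x) \<and> target a \<in> elems (states_of x)) \<and>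
     (\<forall>s\<in>elems (states_of x). s \<in> elems (tree_of_list (reached x)))"

lemma dec_ts_check: "dec ts_check"
  unfolding ts_check_def by (intro dec_intros ptime_comp[OF ptime_reached])

lemma ts_check_iff:
  assumes wf: "well_formed x"
  shows "ts_check x \<longleftrightarrow> is_ts (decoded x)"
proof -
  have arcs: "(\<forall>a\<in>elems (arcs_of x). source a \<in> elems (states_of x) \<and> label a \<in> elems (events_of x) \<and> target a \<in> elems (states_of x))
    \<longleftrightarrow> (\<forall>s e s'. arc x s e s' \<longrightarrow> s \<in> elems (states_of x) \<and> e \<in> elems (events_of x) \<and> s' \<in> elems (states_of x))"
    by (rule all_arc[OF wf, of "\<lambda>s e s'. s \<in> elems (states_of x) \<and> e \<in> elems (events_of x) \<and> s' \<in> elems (states_of x)"])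
  show ?thesis
    unfolding ts_check_def is_ts_def arcs delta_decoded[OF wf] decoded_simps list_of_tree_of_list
    using set_reached[OF wf] by auto
qed

definition bounded_check :: "nat \<Rightarrow> tree \<Rightarrow> bool" where
  "bounded_check g x \<longleftrightarrow> (\<forall>s\<in>elems (states_of x).
     card (elems (tree_of_list (filter (\<lambda>a. target a = s) (list_of_tree (arcs_of x))))) \<le> g \<and>
     card (elems (tree_of_list (filter (\<lambda>a. source a = s) (list_of_tree (arcs_of x))))) \<le> g)"

lemma dec_bounded_check: "dec (bounded_check g)"
  unfolding bounded_check_def by (intro dec_intros ptime_filter)

lemma bounded_check_iff:
  assumes wf: "well_formed x"
  shows "bounded_check g x \<longleftrightarrow> g_bounded g (decoded x)"
proof -
  have "elems (tree_of_list (filter (\<lambda>a. target a = s) (list_of_tree (arcs_of x)))) =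
      (\<lambda>(s', e). Node s' (Node e s)) ` {(s', e). arc x s' e s}" (is "?L = ?R") for s
  proof (intro set_eqI iffI)
    fix a assume "a \<in> ?L"
    then have a: "a \<in> elems (arcs_of x)" "target a = s" by auto
    then show "a \<in> ?R" using arc_iff[OF wf a(1)] arc_tree[OF wf a(1)]
      by (intro image_eqI[of _ _ "(source a, label a)"]) auto
  qed (auto simp: arc_def)
  moreover have "elems (tree_of_list (filter (\<lambda>a. source a = s) (list_of_tree (arcs_of x)))) =
      (\<lambda>(e, s'). Node s (Node e s')) ` {(e, s'). arc x s e s'}" (is "?L = ?R") for s
  proof (intro set_eqI iffI)
    fix a assume "a \<in> ?L"
    then have a: "a \<in> elems (arcs_of x)" "source a = s" by auto
    then show "a \<in> ?R" using arc_iff[OF wf a(1)] arc_tree[OF wf a(1)]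
      by (intro image_eqI[of _ _ "(label a, target a)"]) auto
  qed (auto simp: arc_def)
  ultimately show ?thesis
    unfolding bounded_check_def g_bounded_def delta_decoded[OF wf]
    by (simp add: card_image inj_on_def split_beta)
qed

text \<open>The validity of the input is tested alongside, so a criterion has to be right only on
  encodings of \<open>g\<close>-bounded systems, where solvability is the same as
  separability.\<close>

lemma in_P_if_criterion:
  assumes C: "dec C"
    and iff: "\<And>x. well_formed x \<Longrightarrow> is_ts (decoded x) \<Longrightarrow> g_bounded g (decoded x) \<Longrightarrow>
      C x \<longleftrightarrow> separable \<tau> (decoded x)"
  shows "in_P (solvability_problem \<tau> g)"
proof (rule in_P_if_dec)
  have "dec (\<lambda>x. well_formed x \<and> ts_check x \<and> bounded_check g x \<and> C x)"
    by (intro dec_conj dec_well_formed dec_ts_check dec_bounded_check C)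
  moreover have "(\<lambda>x. x \<in> solvability_problem \<tau> g) =
      (\<lambda>x. well_formed x \<and> ts_check x \<and> bounded_check g x \<and> C x)"
    unfolding solvability_problem_iff using ts_check_iff bounded_check_iff iff by blast
  ultimately show "dec (\<lambda>x. x \<in> solvability_problem \<tau> g)" by simp
qed

section \<open>The criterion for paths and cycles as a program\<close>

definition linear_labels_check :: "tree \<Rightarrow> bool" where
  "linear_labels_check x \<longleftrightarrow>
     (\<forall>a\<in>elems (arcs_of x). \<forall>b\<in>elems (arcs_of x). label a = label b \<longrightarrow> source a = source b) \<and>
     (\<forall>a\<in>elems (arcs_of x). target a = init_of x \<longrightarrow> (\<forall>s\<in>elems (states_of x). s = init_of x))"

lemma dec_linear_labels_check: "dec linear_labels_check"
  unfolding linear_labels_check_def by (intro dec_intros)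

lemma linear_labels_check_iff:
  assumes wf: "well_formed x" and "is_ts (decoded x)"
  shows "linear_labels_check x \<longleftrightarrow> linear_labels (decoded x)"
proof -
  have init: "init_of x \<in> elems (states_of x)" using assms(2) by (simp add: is_ts_def)
  have 1: "(\<forall>a\<in>elems (arcs_of x). \<forall>b\<in>elems (arcs_of x). label a = label b \<longrightarrow> source a = source b) \<longleftrightarrow>
    (\<forall>s e s' t t'. arc x s e s' \<longrightarrow> arc x t e t' \<longrightarrow> s = t)"
  proof -
    have "(\<forall>b\<in>elems (arcs_of x). label a = label b \<longrightarrow> source a = source b) \<longleftrightarrow>
        (\<forall>t e t'. arc x t e t' \<longrightarrow> label a = e \<longrightarrow> source a = t)" for a
      by (rule all_arc[OF wf, of "\<lambda>t e t'. label a = e \<longrightarrow> source a = t"])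
    then show ?thesis
      using all_arc[OF wf, of "\<lambda>s f s'. \<forall>t e t'. arc x t e t' \<longrightarrow> f = e \<longrightarrow> s = t"] by (simp only:) blast
  qed
  have 2: "(\<forall>a\<in>elems (arcs_of x). target a = init_of x \<longrightarrow> (\<forall>s\<in>elems (states_of x). s = init_of x)) \<longleftrightarrow>
    (\<forall>s e. arc x s e (init_of x) \<longrightarrow> elems (states_of x) = {init_of x})"
    using all_arc[OF wf, of "\<lambda>s e s'. s' = init_of x \<longrightarrow> (\<forall>s\<in>elems (states_of x). s = init_of x)"] init
    by (simp only:) blast
  show ?thesis unfolding linear_labels_check_def linear_labels_def 1 2 delta_decoded[OF wf] decoded_simps ..
qed


section \<open>Decision procedures\<close>

text \<open>Items of the inference: \<open>Node Leaf e\<close> says that the event \<open>e\<close> is rigid, and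
  \<open>Node (tag b) t\<close> that the state \<open>t\<close> is forced to the value \<open>b\<close>.\<close>

definition tag :: "bool \<Rightarrow> tree" where
  "tag b = (if b then Node Leaf Leaf else Node (Node Leaf Leaf) Leaf)"

lemma tag_simps [simp]: "tag b \<noteq> Leaf" "Leaf \<noteq> tag b" "tag b = tag c \<longleftrightarrow> b = c"
  by (auto simp: tag_def)

definition infers :: "tree \<Rightarrow> (tree \<Rightarrow> bool \<Rightarrow> bool) \<Rightarrow> (tree \<Rightarrow> bool) \<Rightarrow> tree list \<Rightarrow> tree \<Rightarrow> bool" where
  "infers x V N S i \<longleftrightarrow>
     hd_tree i = Leaf \<and> (N (tl_tree i) \<or>
       (\<exists>a\<in>elems (arcs_of x). label a = tl_tree i \<and> Node (tag True) (target a) \<in> set S) \<and>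
       (\<exists>a\<in>elems (arcs_of x). label a = tl_tree i \<and> Node (tag False) (target a) \<in> set S)) \<or>
     hd_tree i = tag True \<and> V (tl_tree i) True \<or>
     hd_tree i = tag False \<and> V (tl_tree i) False \<or>
     hd_tree i \<noteq> Leaf \<and> (\<exists>a\<in>elems (arcs_of x). Node Leaf (label a) \<in> set S \<and>
       (target a = tl_tree i \<and> Node (hd_tree i) (source a) \<in> set S \<or>
        source a = tl_tree i \<and> Node (hd_tree i) (target a) \<in> set S))"

text \<open>The universe of the inference: every event, and every state with either value. The
  conversions between lists and trees give the term the shape required by
  \<open>ptime_append\<close> and \<open>ptime_map\<close>.\<close>

definition items :: "tree \<Rightarrow> tree" where
  "items x = tree_of_list (
     list_of_tree (tree_of_list (map (Node Leaf) (list_of_tree (events_of x)))) @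
     list_of_tree (tree_of_list (
       list_of_tree (tree_of_list (map (Node (tag True)) (list_of_tree (states_of x)))) @
       list_of_tree (tree_of_list (map (Node (tag False)) (list_of_tree (states_of x)))))))"

lemma ptime_items: "ptime items"
  unfolding items_def by (intro ptime_append ptime_map dec_intros)

lemma elems_items: "elems (items x) =
  Node Leaf ` elems (events_of x) \<union> Node (tag True) ` elems (states_of x) \<union> Node (tag False) ` elems (states_of x)"
  by (auto simp: items_def)

definition inferred :: "tree \<Rightarrow> (tree \<Rightarrow> bool \<Rightarrow> bool) \<Rightarrow> (tree \<Rightarrow> bool) \<Rightarrow> tree list" where
  "inferred x V N = lfp_list (infers x V N) (list_of_tree (items x))"

definition consistency_check :: "tree \<Rightarrow> (tree \<Rightarrow> bool \<Rightarrow> bool) \<Rightarrow> (tree \<Rightarrow> bool) \<Rightarrow> bool" where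
  "consistency_check x V N \<longleftrightarrow> (\<forall>t\<in>elems (states_of x).
     \<not> (Node (tag True) t \<in> elems (tree_of_list (inferred x V N)) \<and>
        Node (tag False) t \<in> elems (tree_of_list (inferred x V N))))"

lemma dec_consistency_check:
  assumes f: "ptime f" and V: "\<And>b. dec (\<lambda>z. V (hd_tree z) (tl_tree z) b)" and N: "dec (\<lambda>z. N (hd_tree z) (tl_tree z))"
  shows "dec (\<lambda>y. consistency_check (f y) (V y) (N y))"
proof -
  \<comment> \<open>Within the fixpoint, an item \<open>i\<close> is judged in the environment
    \<open>Node y (Node S i)\<close>; this term extracts \<open>y\<close> and the state or event of
    which \<open>i\<close> speaks.\<close>
  let ?z = "\<lambda>z. Node (hd_tree z) (tl_tree (tl_tree (tl_tree z)))"
  have V': "dec (\<lambda>z. V (hd_tree z) (tl_tree (tl_tree (tl_tree z))) b)" for b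
    using dec_comp[OF V, of ?z] by (simp add: ptime_Node ptime_hd ptime_tl ptime_id)
  have N': "dec (\<lambda>z. N (hd_tree z) (tl_tree (tl_tree (tl_tree z))))"
    using dec_comp[OF N, of ?z] by (simp add: ptime_Node ptime_hd ptime_tl ptime_id)
  have "dec (\<lambda>z. infers (f (hd_tree z)) (V (hd_tree z)) (N (hd_tree z))
      (list_of_tree (hd_tree (tl_tree z))) (tl_tree (tl_tree z)))"
    unfolding infers_def by (intro dec_intros V' N' ptime_comp[OF f])
  then have "ptime (\<lambda>y. tree_of_list (inferred (f y) (V y) (N y)))"
    unfolding inferred_def by (intro ptime_lfp_list ptime_comp[OF ptime_items] f)
  from ptime_comp[OF this ptime_hd[OF ptime_id]] show ?thesis
    unfolding consistency_check_def by (intro dec_intros f)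
qed

lemma infers_mono: "set S \<subseteq> set T \<Longrightarrow> infers x V N S i \<Longrightarrow> infers x V N T i"
  unfolding infers_def by blast

text \<open>The inductive rules hold in the fixpoint because it is closed, and it contains nothing
  else because it is least. The hypotheses on \<open>V\<close> and \<open>N\<close> keep the goals
  inside the universe.\<close>

lemma set_inferred:
  assumes wf: "well_formed x" and A: "is_ts (decoded x)"
    and V: "\<And>t b. V t b \<Longrightarrow> t \<in> elems (states_of x)" and N: "\<And>e. N e \<Longrightarrow> e \<in> elems (events_of x)"
  shows "Node (tag b) t \<in> set (inferred x V N) \<longleftrightarrow> forced (delta (decoded x)) V N t b"
proof -
  let ?F = "forced (delta (decoded x)) V N" and ?C = "rigid (delta (decoded x)) V N"
  let ?I = "inferred x V N"
  have mem: "Node (tag b) t \<in> elems (items x)" if "t \<in> elems (states_of x)" for b t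
    using that by (cases b) (auto simp: elems_items)
  have mem_ev: "Node Leaf e \<in> elems (items x)" if "e \<in> elems (events_of x)" for e
    using that by (auto simp: elems_items)
  have ends: "s \<in> elems (states_of x)" "e \<in> elems (events_of x)" "s' \<in> elems (states_of x)"
    if "delta (decoded x) s e = Some s'" for s e s'
    using ts_delta[OF A that] by simp_all
  have closed: "i \<in> set ?I" if "i \<in> elems (items x)" "infers x V N ?I i" for i
    unfolding inferred_def
  proof (rule lfp_list_closed)
    show "infers x V N T y" if "set S \<subseteq> set T" "infers x V N S y" for S T y
      using that by (rule infers_mono)
  qed (use that in \<open>simp_all add: inferred_def\<close>)
  have arcD: "\<exists>a\<in>elems (arcs_of x). P (source a) (label a) (target a)"
    if "delta (decoded x) s e = Some s'" "P s e s'" for P s e s'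
    using that ex_arc[OF wf, of P] delta_decoded[OF wf] by blast
  have "(?F t b \<longrightarrow> Node (tag b) t \<in> set ?I) \<and> (?C e \<longrightarrow> Node Leaf e \<in> set ?I)" for t b e
  proof (induction rule: forced_rigid.induct)
    case (given_value t b)
    then show ?case using V by (intro closed mem) (auto simp: infers_def, cases b, auto)
  next
    case (given_event e)
    then show ?case using N by (intro closed mem_ev) (auto simp: infers_def)
  next
    case (forward e t t' b)
    have "\<exists>a\<in>elems (arcs_of x). Node Leaf (label a) \<in> set ?I \<and> target a = t' \<and> Node (tag b) (source a) \<in> set ?I"
      by (rule arcD[OF forward(3), of "\<lambda>s e s'. Node Leaf e \<in> set ?I \<and> s' = t' \<and> Node (tag b) s \<in> set ?I"])
        (use forward in simp)
    then have "infers x V N ?I (Node (tag b) t')" unfolding infers_def by auto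
    then show ?case using ends(3)[OF forward(3)] by (intro closed mem)
  next
    case (backward e t t' b)
    have "\<exists>a\<in>elems (arcs_of x). Node Leaf (label a) \<in> set ?I \<and> source a = t \<and> Node (tag b) (target a) \<in> set ?I"
      by (rule arcD[OF backward(3), of "\<lambda>s e s'. Node Leaf e \<in> set ?I \<and> s = t \<and> Node (tag b) s' \<in> set ?I"])
        (use backward in simp)
    then have "infers x V N ?I (Node (tag b) t)" unfolding infers_def by auto
    then show ?case using ends(1)[OF backward(3)] by (intro closed mem)
  next
    case (both_values t e t' u u')
    have "\<exists>a\<in>elems (arcs_of x). label a = e \<and> Node (tag True) (target a) \<in> set ?I"
      by (rule arcD[OF both_values(1), of "\<lambda>s f s'. f = e \<and> Node (tag True) s' \<in> set ?I"])
        (use both_values in simp)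
    moreover have "\<exists>a\<in>elems (arcs_of x). label a = e \<and> Node (tag False) (target a) \<in> set ?I"
      by (rule arcD[OF both_values(2), of "\<lambda>s f s'. f = e \<and> Node (tag False) s' \<in> set ?I"])
        (use both_values in simp)
    ultimately have "infers x V N ?I (Node Leaf e)" unfolding infers_def by auto
    then show ?case using ends(2)[OF both_values(1)] by (intro closed mem_ev)
  qed
  moreover
  \<comment> \<open>The items that are true under the inductive definition. One whose head is
    neither \<open>Leaf\<close> nor a tag satisfies both conditions vacuously.\<close>
  let ?Q = "{i. (hd_tree i = Leaf \<longrightarrow> ?C (tl_tree i)) \<and> (\<forall>b. hd_tree i = tag b \<longrightarrow> ?F (tl_tree i) b)}"
  have "set ?I \<subseteq> ?Q" unfolding inferred_def
  proof (rule lfp_list_least)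
    fix S i assume S: "set S \<subseteq> ?Q" and i: "infers x V N S i"
    have ev: "?C e" if "Node Leaf e \<in> set S" for e using S that by force
    have va: "?F t b" if "Node (tag b) t \<in> set S" for t b using S that by force
    have arc: "delta (decoded x) (source a) (label a) = Some (target a)" if "a \<in> elems (arcs_of x)" for a
      using arc_iff[OF wf that] delta_decoded[OF wf] by simp
    have "?C (tl_tree i)" if l: "hd_tree i = Leaf"
    proof -
      from i l consider "N (tl_tree i)" | a b where "a \<in> elems (arcs_of x)" "b \<in> elems (arcs_of x)"
        "label a = tl_tree i" "label b = tl_tree i" "Node (tag True) (target a) \<in> set S" "Node (tag False) (target b) \<in> set S"
        unfolding infers_def by auto
      then show ?thesis
      proof cases
        case 1
        then show ?thesis by (rule given_event)
      next
        case 2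
        have "delta (decoded x) (source a) (tl_tree i) = Some (target a)"
          "delta (decoded x) (source b) (tl_tree i) = Some (target b)"
          using arc[OF 2(1)] arc[OF 2(2)] 2(3,4) by simp_all
        then show ?thesis using va[OF 2(5)] va[OF 2(6)] by (rule both_values)
      qed
    qed
    moreover have "?F (tl_tree i) b" if l: "hd_tree i = tag b" for b
    proof -
      from i l consider "V (tl_tree i) b" | a where "a \<in> elems (arcs_of x)" "Node Leaf (label a) \<in> set S"
          "target a = tl_tree i" "Node (tag b) (source a) \<in> set S"
        | a where "a \<in> elems (arcs_of x)" "Node Leaf (label a) \<in> set S"
          "source a = tl_tree i" "Node (tag b) (target a) \<in> set S"
        unfolding infers_def by auto
      then show ?thesis
      proof cases
        case 1
        then show ?thesis by (rule given_value)
      next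
        case 2
        show ?thesis using forward[OF ev[OF 2(2)] arc[OF 2(1)] va[OF 2(4)]] 2(3) by simp
      next
        case 3
        show ?thesis using backward[OF ev[OF 3(2)] arc[OF 3(1)] va[OF 3(4)]] 3(3) by simp
      qed
    qed
    ultimately show "i \<in> ?Q" by simp
  qed
  ultimately show ?thesis by force
qed

lemma consistency_check_iff:
  assumes "well_formed x" "is_ts (decoded x)"
    "\<And>t b. V t b \<Longrightarrow> t \<in> elems (states_of x)" "\<And>e. N e \<Longrightarrow> e \<in> elems (events_of x)"
  shows "consistency_check x V N \<longleftrightarrow> consistent (delta (decoded x)) V N"
proof -
  have set: "Node (tag b) t \<in> set (inferred x V N) \<longleftrightarrow> forced (delta (decoded x)) V N t b" for b t
    by (rule set_inferred[OF assms(1,2)]) (use assms(3,4) in auto)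
  have "t \<in> elems (states_of x)" if "forced (delta (decoded x)) V N t b" for t b
  proof -
    have "Node (tag b) t \<in> set (inferred x V N)"
      using that set by simp
    then have "Node (tag b) t \<in> elems (items x)"
      unfolding inferred_def by (rule subsetD[OF set_lfp_list_subset])
    then show ?thesis by (cases b) (auto simp: elems_items)
  qed
  then show ?thesis
    unfolding consistency_check_def consistent_def list_of_tree_of_list set by blast
qed

definition event_goal_check :: "tree \<Rightarrow> tree \<Rightarrow> tree \<Rightarrow> tree \<Rightarrow> bool \<Rightarrow> bool" where
  "event_goal_check x s e t b \<longleftrightarrow>
     (if b then \<exists>a\<in>elems (arcs_of x). source a = t \<and> label a = e else t = s)"

definition inferable_check :: "tree \<Rightarrow> bool" where
  "inferable_check x \<longleftrightarrow>
     (\<forall>a\<in>elems (arcs_of x). Node (target a) (Node (label a) (target a)) \<in> elems (arcs_of x)) \<and>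
     (\<forall>s\<in>elems (states_of x). \<forall>s'\<in>elems (states_of x). s \<noteq> s' \<longrightarrow>
        consistency_check x (state_goal s s') (\<lambda>_. False)) \<and>
     (\<forall>s\<in>elems (states_of x). \<forall>e\<in>elems (events_of x).
        \<not> (\<exists>a\<in>elems (arcs_of x). source a = s \<and> label a = e) \<longrightarrow>
        consistency_check x (event_goal_check x s e) (\<lambda>e'. e' = e))"

lemma dec_inferable_check: "dec inferable_check"
proof -
  have "dec (\<lambda>z. state_goal (f (hd_tree z)) (h (hd_tree z)) (tl_tree z) b)" if "ptime f" "ptime h" for f h b
    unfolding state_goal_def
    by (cases b) (simp_all add: dec_eq ptime_tl ptime_id ptime_comp[OF that(1)] ptime_comp[OF that(2)] ptime_hd)
  note 1 = dec_consistency_check[OF _ this dec_const]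
  have "dec (\<lambda>z. event_goal_check (k (hd_tree z)) (f (hd_tree z)) (h (hd_tree z)) (tl_tree z) b)"
    if "ptime k" "ptime f" "ptime h" for k f h b
    unfolding event_goal_check_def
    by (cases b; simp only: if_True if_False) (intro dec_intros that[THEN ptime_comp])+
  note 2 = dec_consistency_check[OF _ this]
  show ?thesis unfolding inferable_check_def
    by (intro dec_intros 1 2 ptime_comp[of "\<lambda>x. x"])
qed

lemma inferable_check_iff:
  assumes wf: "well_formed x" and A: "is_ts (decoded x)"
  shows "inferable_check x \<longleftrightarrow> inferable (decoded x)"
proof -
  have none: "delta (decoded x) s e = None \<longleftrightarrow> \<not> (\<exists>a\<in>elems (arcs_of x). source a = s \<and> label a = e)" for s e
    using ex_arc[OF wf, of "\<lambda>s' e' t. s' = s \<and> e' = e"] delta_decoded[OF wf, of s e]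
    by (cases "delta (decoded x) s e") auto
  have goal: "event_goal_check x s e = event_goal (delta (decoded x)) s e" for s e
    by (intro ext) (simp add: event_goal_check_def event_goal_def none)
  have loop: "(\<forall>a\<in>elems (arcs_of x). Node (target a) (Node (label a) (target a)) \<in> elems (arcs_of x)) \<longleftrightarrow>
      looping (decoded x)"
    using all_arc[OF wf, of "\<lambda>s e t. arc x t e t"] unfolding looping_def delta_decoded[OF wf] arc_def .
  have 1: "consistency_check x (state_goal s s') (\<lambda>_. False) \<longleftrightarrow> consistent (delta (decoded x)) (state_goal s s') (\<lambda>_. False)"
    if "s \<in> elems (states_of x)" "s' \<in> elems (states_of x)" for s s'
    by (rule consistency_check_iff[OF wf A]) (use that in \<open>auto simp: state_goal_def split: if_splits\<close>)
  have 2: "consistency_check x (event_goal (delta (decoded x)) s e) (\<lambda>e'. e' = e) \<longleftrightarrow>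
      consistent (delta (decoded x)) (event_goal (delta (decoded x)) s e) (\<lambda>e'. e' = e)"
    if "s \<in> elems (states_of x)" "e \<in> elems (events_of x)" for s e
    by (rule consistency_check_iff[OF wf A])
      (use that ts_delta(1)[OF A] in \<open>auto simp: event_goal_def split: if_splits\<close>)
  show ?thesis
    unfolding inferable_check_def inferable_def loop goal none[symmetric] decoded_simps
    using 1 2 by blast
qed

section \<open>Search for one of finitely many small systems\<close>

fun nth_tree :: "nat \<Rightarrow> tree \<Rightarrow> tree" where
  "nth_tree 0 t = hd_tree t"
| "nth_tree (Suc i) t = nth_tree i (tl_tree t)"

lemma nth_tree_of_list: "i < length ys \<Longrightarrow> nth_tree i (tree_of_list ys) = ys ! i"
  by (induction ys arbitrary: i) (auto simp: less_Suc_eq_0_disj)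

lemma ptime_nth_tree: "ptime f \<Longrightarrow> ptime (\<lambda>x. nth_tree i (f x))"
proof (induction i arbitrary: f)
  case (Suc i)
  then show ?case using Suc.IH[OF ptime_tl[OF Suc.prems]] by simp
qed (simp add: ptime_hd)

definition represents_check :: "nat \<Rightarrow> (nat \<Rightarrow> nat option) set \<Rightarrow> tree \<Rightarrow> tree \<Rightarrow> bool" where
  "represents_check n F x ys \<longleftrightarrow>
     (\<forall>i\<in>{..<n}. \<forall>j\<in>{..<n}. nth_tree i ys = nth_tree j ys \<longrightarrow> i = j) \<and>
     (\<forall>s\<in>elems (states_of x). s \<in> elems ys) \<and>
     (\<forall>e\<in>elems (events_of x). \<exists>f\<in>F. \<forall>i\<in>{..<n}. \<forall>j\<in>{..<n}.
        Node (nth_tree i ys) (Node e (nth_tree j ys)) \<in> elems (arcs_of x) \<longleftrightarrow> f i = Some j)"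

lemma dec_represents_check:
  assumes "finite F"
  shows "dec (\<lambda>z. represents_check n F (hd_tree z) (tl_tree z))"
  unfolding represents_check_def
  by (intro dec_conj dec_fin_ball dec_fin_bex dec_ball dec_imp dec_iff dec_eq dec_mem dec_const
      ptime_nth_tree ptime_Node ptime_hd ptime_tl ptime_id finite_lessThan assms)

lemma represents_check_iff:
  assumes wf: "well_formed x" and "length ys = n" "set ys \<subseteq> elems (states_of x)"
  shows "represents_check n F x (tree_of_list ys) \<longleftrightarrow> represents ys F (decoded x)"
  using assms(2,3)
  unfolding represents_check_def represents_def delta_decoded[OF wf] arc_def distinct_conv_nth decoded_simps
  by (simp add: nth_tree_of_list) blast

text \<open>For fixed \<open>\<tau>\<close> and \<open>g\<close>, the set \<open>I\<close> of
  separable canonical systems with at most \<open>B\<close> states is a finite constant of the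
  program. At run time only a numbering of the states that matches a member of \<open>I\<close> is
  searched for, and its length is at most \<open>B\<close>.\<close>

lemma in_P_if_few_states:
  fixes B :: nat
  assumes few: "\<And>A :: (tree, tree) ts. is_ts A \<Longrightarrow> g_bounded g A \<Longrightarrow> separable \<tau> A \<Longrightarrow> card (states A) \<le> B"
  shows "in_P (solvability_problem \<tau> g)"
proof (rule in_P_if_criterion)
  define I where "I = {(n, F). n \<le> B \<and> F \<subseteq> partial_maps n \<and> separable \<tau> (canonical n F)}"
  have "I \<subseteq> (SIGMA n:{..B}. Pow (partial_maps n))" by (auto simp: I_def)
  then have fin: "finite I" by (rule finite_subset) (simp add: finite_partial_maps)
  let ?C = "\<lambda>x. \<exists>i\<in>I. \<exists>ys. length ys = fst i \<and> set ys \<subseteq> elems (states_of x) \<and>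
    represents_check (fst i) (snd i) x (tree_of_list ys)"
  show "dec ?C"
  proof (rule dec_fin_bex[OF fin])
    fix i assume "i \<in> I"
    then have "finite (snd i)" using finite_subset[OF _ finite_partial_maps] by (auto simp: I_def)
    then show "dec (\<lambda>x. \<exists>ys. length ys = fst i \<and> set ys \<subseteq> elems (states_of x) \<and>
        represents_check (fst i) (snd i) x (tree_of_list ys))"
      by (intro dec_tuple dec_represents_check ptime_hd ptime_id)
  qed
  fix x assume wf: "well_formed x" and A: "is_ts (decoded x)" "g_bounded g (decoded x)"
  show "?C x \<longleftrightarrow> separable \<tau> (decoded x)"
  proof
    assume "?C x"
    then obtain n F ys where *: "(n, F) \<in> I" "length ys = n" "set ys \<subseteq> elems (states_of x)"
      "represents_check n F x (tree_of_list ys)" by auto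
    then have "represents ys F (decoded x)" using represents_check_iff[OF wf] by blast
    then show "separable \<tau> (decoded x)"
      using separable_if_represents[OF A(1), of ys F] * by (simp add: I_def)
  next
    assume sep: "separable \<tau> (decoded x)"
    obtain ys F where *: "represents ys F (decoded x)" "length ys = card (states (decoded x))"
      "F \<subseteq> partial_maps (length ys)" "separable \<tau> (canonical (length ys) F)"
      by (rule represents_if_separable[OF A(1) sep])
    have set: "set ys \<subseteq> elems (states_of x)" using *(1) by (simp add: represents_def)
    have "(length ys, F) \<in> I" using few[OF A sep] * by (simp add: I_def)
    moreover have "represents_check (length ys) F x (tree_of_list ys)"
      using represents_check_iff[OF wf refl set] *(1) by simp
    ultimately show "?C x" using set by (intro bexI[of _ "(length ys, F)"] exI[of _ ys]) auto
  qed
qed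

section \<open>Assembling the cases\<close>

lemma in_P_one_bounded_linear:
  assumes g: "g < 2" and \<tau>: "{NOP, INP, FREE} \<subseteq> \<tau> \<and> \<tau> \<subseteq> {NOP, INP, USED, FREE} \<or>
    {NOP, OUT, USED} \<subseteq> \<tau> \<and> \<tau> \<subseteq> {NOP, OUT, USED, FREE}"
  shows "in_P (solvability_problem \<tau> g)"
proof (rule in_P_if_criterion[OF dec_linear_labels_check])
  fix x assume x: "well_formed x" "is_ts (decoded x)" "g_bounded g (decoded x)"
  let ?A = "decoded x"
  have "linear_labels ?A \<longleftrightarrow> separable \<tau> ?A"
  proof
    assume "linear_labels ?A"
    then have *: "separable {NOP, INP, FREE} ?A" using separable_if_linear_labels[OF x(2,3) g] by simp
    \<comment> \<open>The criterion does not mention the type, so it provides the regions of the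
      dual type too.\<close>
    from separable_dual[OF this] have "separable {NOP, OUT, USED} ?A" by (simp add: insert_commute)
    with * show "separable \<tau> ?A" using \<tau> separable_mono by blast
  next
    assume sep: "separable \<tau> ?A"
    have "separable {NOP, INP, USED, FREE} ?A"
    proof (cases "\<tau> \<subseteq> {NOP, INP, USED, FREE}")
      case True
      then show ?thesis using separable_mono[OF sep] by simp
    next
      case False
      then have "separable {NOP, OUT, USED, FREE} ?A" using \<tau> separable_mono[OF sep] by blast
      from separable_dual[OF this] show ?thesis by (simp add: insert_commute)
    qed
    then show "linear_labels ?A" using linear_labels_if_separable[OF x(2,3) g] by simp
  qed
  then show "linear_labels_check x \<longleftrightarrow> separable \<tau> ?A" using linear_labels_check_iff[OF x(1,2)] by simp
qed

lemma in_P_two_bounded: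
  assumes g: "g < 3" and \<tau>: "{NOP, SET, RES, USED} \<subseteq> \<tau> \<or> {NOP, SET, RES, FREE} \<subseteq> \<tau>"
    "\<tau> \<subseteq> {NOP, SET, RES, USED, FREE}"
  shows "in_P (solvability_problem \<tau> g)"
proof (rule in_P_if_criterion[OF dec_inferable_check])
  fix x assume x: "well_formed x" "is_ts (decoded x)" "g_bounded g (decoded x)"
  let ?A = "decoded x"
  have "inferable ?A \<longleftrightarrow> separable \<tau> ?A"
  proof
    assume "inferable ?A"
    then have *: "separable {NOP, SET, RES, USED} ?A" using separable_if_inferable[OF x(2,3) g] by simp
    from separable_dual[OF this] have "separable {NOP, SET, RES, FREE} ?A" by (simp add: insert_commute)
    with * show "separable \<tau> ?A" using \<tau> separable_mono by blast
  next
    assume "separable \<tau> ?A"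
    then show "inferable ?A" using inferable_if_separable[OF x(2)] separable_mono[OF _ \<tau>(2)] by blast
  qed
  then show "inferable_check x \<longleftrightarrow> separable \<tau> ?A" using inferable_check_iff[OF x(1,2)] by simp
qed

text \<open>The bound is computed for the largest type, which separates whatever a smaller one does;
  so it depends on \<open>g\<close> only.\<close>

lemma in_P_one_bounded_cyclic:
  assumes g: "g < 2" and \<tau>: "\<tau> \<subseteq> {NOP, SET, RES, SWAP, USED, FREE}"
  shows "in_P (solvability_problem \<tau> g)"
proof (rule in_P_if_few_states)
  let ?\<tau> = "{NOP, SET, RES, SWAP, USED, FREE}"
  fix A :: "(tree, tree) ts" assume A: "is_ts A" "g_bounded g A" "separable \<tau> A"
  have sep: "separable ?\<tau> A" by (rule separable_mono[OF A(3) \<tau>])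
  show "card (states A) \<le> 2 ^ (2 * card ?\<tau> ^ g)"
    by (rule few_states[OF A(1,2) sep]) (use live_at_init_one_bounded[OF A(1,2) g sep] in auto)
qed

lemma in_P_total:
  assumes \<tau>: "\<tau> \<subseteq> {NOP, SET, RES, SWAP}"
  shows "in_P (solvability_problem \<tau> g)"
proof (rule in_P_if_few_states)
  let ?\<tau> = "{NOP, SET, RES, SWAP}"
  fix A :: "(tree, tree) ts" assume A: "is_ts A" "g_bounded g A" "separable \<tau> A"
  have sep: "separable ?\<tau> A" by (rule separable_mono[OF A(3) \<tau>])
  show "card (states A) \<le> 2 ^ (2 * card ?\<tau> ^ g)"
    by (rule few_states[OF A(1,2) sep]) (use live_at_init_total[OF A(1) sep] in auto)
qed

lemma in_P_decreasing:
  assumes \<tau>: "\<tau> \<subseteq> {NOP, INP, USED} \<or> \<tau> \<subseteq> {NOP, OUT, FREE}"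
  shows "in_P (solvability_problem \<tau> g)"
proof (rule in_P_if_few_states)
  let ?\<tau> = "{NOP, INP, USED}"
  fix A :: "(tree, tree) ts" assume A: "is_ts A" "g_bounded g A" "separable \<tau> A"
  have sep: "separable ?\<tau> A"
  proof (cases "\<tau> \<subseteq> ?\<tau>")
    case True
    then show ?thesis by (rule separable_mono[OF A(3)])
  next
    case False
    then have "separable {NOP, OUT, FREE} A" using \<tau> separable_mono[OF A(3)] by blast
    from separable_dual[OF this] show ?thesis by simp
  qed
  show "card (states A) \<le> 2 ^ (2 * card ?\<tau> ^ g)"
    by (rule few_states[OF A(1,2) sep]) (use live_at_init_decreasing[OF A(1) sep] in auto)
qed

theorem theorem10:
  fixes g :: nat and \<tau> :: "interaction set"
  assumes
    "(\<tau> \<in> {{NOP, INP, FREE}, {NOP, INP, USED, FREE}, {NOP, OUT, USED}, {NOP, OUT, USED, FREE}} \<and> g < 2) \<or>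
     (\<exists>\<omega>. \<omega> \<noteq> {} \<and> \<omega> \<subseteq> {USED, FREE} \<and> \<tau> = {NOP, SET, RES} \<union> \<omega> \<and> g < 3) \<or>
     (\<exists>\<tau>' \<omega>. \<tau>' \<in> {{NOP, SET, SWAP}, {NOP, RES, SWAP}, {NOP, RES, SET, SWAP}} \<and>
        \<omega> \<noteq> {} \<and> \<omega> \<subseteq> {USED, FREE} \<and> \<tau> = \<tau>' \<union> \<omega> \<and> g < 2) \<or>
     (\<tau> \<in> {{NOP, INP}, {NOP, INP, USED}, {NOP, OUT}, {NOP, OUT, FREE}} \<or>
      \<tau> \<in> {{NOP, SET, SWAP}, {NOP, RES, SWAP}, {NOP, SET, RES}, {NOP, SET, RES, SWAP}})"
  shows "in_P (solvability_problem \<tau> g)"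
  using assms
proof (elim disjE exE conjE)
  assume "\<tau> \<in> {{NOP, INP, FREE}, {NOP, INP, USED, FREE}, {NOP, OUT, USED}, {NOP, OUT, USED, FREE}}" "g < 2"
  then show ?thesis by (intro in_P_one_bounded_linear) auto
next
  fix \<omega> assume \<omega>: "\<omega> \<noteq> {}" "\<omega> \<subseteq> {USED, FREE}" and "\<tau> = {NOP, SET, RES} \<union> \<omega>" "g < 3"
  moreover have "USED \<in> \<omega> \<or> FREE \<in> \<omega>" using \<omega> by blast
  ultimately show ?thesis by (intro in_P_two_bounded) auto
next
  fix \<tau>' \<omega> assume "\<tau>' \<in> {{NOP, SET, SWAP}, {NOP, RES, SWAP}, {NOP, RES, SET, SWAP}}"
    "\<omega> \<subseteq> {USED, FREE}" "\<tau> = \<tau>' \<union> \<omega>" "g < 2"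
  then show ?thesis by (intro in_P_one_bounded_cyclic) auto
next
  assume "\<tau> \<in> {{NOP, INP}, {NOP, INP, USED}, {NOP, OUT}, {NOP, OUT, FREE}}"
  then show ?thesis by (intro in_P_decreasing) auto
next
  assume "\<tau> \<in> {{NOP, SET, SWAP}, {NOP, RES, SWAP}, {NOP, SET, RES}, {NOP, SET, RES, SWAP}}"
  then show ?thesis by (intro in_P_total) auto
qed

end
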